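(* For every $n\ge2$, there are a polynomially convex compact set $K\subset\mathbb C^n$ that is non-pluripolar at every point and non-plurithin at every point and satisfies $V_K^*|_K=0$, and a point $a\in K$, such that the following holds. For every $\tau>0$ there is a function $\Psi_\tau\in C^\infty(\mathbb C^n)\cap\mathcal L_\tau^+$ such that, with $\psi_\tau=\Psi_\tau|_K$ and $F_\delta=V_{\delta,K,\psi_\tau}^*$, $$\Lambda(K,\psi_\tau)=[\tau,\infty),\qquad \Lambda_{\mathrm{reg}}(K,\psi_\tau)=\{\tau\},$$ $F_\delta(a)\ne\psi_\tau(a)$ for every $\delta>\tau$, and the right derivative $D_\tau(a)=\lim_{h\downarrow0}\frac{F_{\tau+h}(a)-\psi_\tau(a)}{h}$ satisfies $$D_\tau(a)\ge\frac{8\log3-4\log2}{9}>0=V_K^*(a).$$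
   Context: Write $\log^+t=\max\{\log t,0\}$, $\log^+0=0$; $\|\cdot\|$ is the Euclidean norm. For $\delta>0$, $\mathcal L_\delta=\{u\in \mathrm{PSH}(\mathbb C^n): u(z)\le\delta\log^+\|z\|+C_u\text{ on }\mathbb C^n\}$ and $\mathcal L_\delta^+=\{u\in\mathcal L_\delta:u(z)\ge\delta\log^+\|z\|-C_u\text{ on }\mathbb C^n\}$, for some constants depending on $u$. $f^*(z)=\limsup_{\zeta\to z}f(\zeta)$ is the upper semicontinuous regularization. For compact $K$ and bounded $\psi:K\to\mathbb R$, $V_{\delta,K,\psi}(z)=\sup\{u(z):u\in\mathcal L_\delta,\ u\le\psi\text{ on }K\}$, $F_\delta=V_{\delta,K,\psi}^*$, $V_K=V_{1,K,0}$; $\Lambda(K,\psi)=\{\delta>0:V_{\delta,K,\psi}|_K=\psi\}$, $\Lambda_{\mathrm{reg}}(K,\psi)=\{\delta\in\Lambda(K,\psi):F_\delta|_K=\psi\}$. A set is pluripolar if near each point it lies in the $-\infty$ locus of a plurisubharmonic function not identically $-\infty$; $K$ is non-pluripolar at every point if $K\cap B(a,r)$ is non-pluripolar for all $a\in K$, $r>0$. A set $E\subset\mathbb C^n$ is plurithin at $a$ if $a$ is not an accumulation point of $E\setminus\{a\}$, or there is a plurisubharmonic function $u$ near $a$ with $\limsup_{E\setminus\{a\}\ni z\to a}u(z)<u(a)$; otherwise it is non-plurithin at $a$. "Non-plurithin at every point" means at every point of $K$. *)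

theory Defs
  imports "HOL-Analysis.Analysis"
begin

section \<open>Plurisubharmonic functions\<close>

text \<open>Functions with values in \<open>[-\<infinity>, \<infinity>)\<close> are represented by \<^typ>\<open>ereal\<close>-valued functions that do not
  take the value \<open>\<infinity>\<close> on the domain under consideration.\<close>

definition usc_on :: "'a::topological_space set \<Rightarrow> ('a \<Rightarrow> ereal) \<Rightarrow> bool" where
  "usc_on S u \<longleftrightarrow> (\<forall>c. openin (top_of_set S) {z \<in> S. u z < c})"

text \<open>The mean value over a circle, as the integral of the positive part minus the integral of the
  negative part (\<^const>\<open>e2ennreal\<close> sends negative numbers to 0). An upper semicontinuous function
  \<open>u < \<infinity>\<close> is bounded above on the circle, so the first integral is finite and the difference is
  never of the form \<open>\<infinity> - \<infinity>\<close>.\<close>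

definition circle_mean :: "(complex \<Rightarrow> ereal) \<Rightarrow> complex \<Rightarrow> real \<Rightarrow> ereal" where
  "circle_mean u c r =
    (enn2ereal (\<integral>\<^sup>+\<theta>\<in>{0..2*pi}. e2ennreal (u (c + of_real r * cis \<theta>)) \<partial>lborel)
     - enn2ereal (\<integral>\<^sup>+\<theta>\<in>{0..2*pi}. e2ennreal (- u (c + of_real r * cis \<theta>)) \<partial>lborel)) / ereal (2*pi)"

text \<open>The function that is identically \<open>-\<infinity>\<close> counts as (pluri)subharmonic; where it has to be
  excluded, this is said explicitly.\<close>

definition subharmonic_on :: "complex set \<Rightarrow> (complex \<Rightarrow> ereal) \<Rightarrow> bool" where
  "subharmonic_on D u \<longleftrightarrow>
    open D \<and> (\<forall>z\<in>D. u z < \<infinity>) \<and> usc_on D u \<and>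
    (\<forall>c r. 0 < r \<and> cball c r \<subseteq> D \<longrightarrow> u c \<le> circle_mean u c r)"

definition psh_on :: "(complex^'n) set \<Rightarrow> (complex^'n \<Rightarrow> ereal) \<Rightarrow> bool" where
  "psh_on \<Omega> u \<longleftrightarrow>
    open \<Omega> \<and> (\<forall>z\<in>\<Omega>. u z < \<infinity>) \<and> usc_on \<Omega> u \<and>
    (\<forall>a b. subharmonic_on {t. a + t *s b \<in> \<Omega>} (\<lambda>t. u (a + t *s b)))"

text \<open>The neighbourhoods in the following definition are balls, hence connected, so that ``not
  identically \<open>-\<infinity>\<close>'' has its usual force.\<close>

definition pluripolar :: "(complex^'n) set \<Rightarrow> bool" where
  "pluripolar E \<longleftrightarrow>
    (\<forall>a\<in>E. \<exists>r>0. \<exists>u. psh_on (ball a r) u \<and> (\<exists>z\<in>ball a r. u z \<noteq> -\<infinity>) \<and>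
      (\<forall>z\<in>E \<inter> ball a r. u z = -\<infinity>))"

definition nonpluripolar_everywhere :: "(complex^'n) set \<Rightarrow> bool" where
  "nonpluripolar_everywhere K \<longleftrightarrow> (\<forall>a\<in>K. \<forall>r>0. \<not> pluripolar (K \<inter> ball a r))"

definition plurithin_at :: "(complex^'n) set \<Rightarrow> complex^'n \<Rightarrow> bool" where
  "plurithin_at E a \<longleftrightarrow>
    \<not> a islimpt (E - {a}) \<or>
    (\<exists>r>0. \<exists>u. psh_on (ball a r) u \<and> Limsup (at a within (E - {a})) u < u a)"

definition nonplurithin_everywhere :: "(complex^'n) set \<Rightarrow> bool" where
  "nonplurithin_everywhere K \<longleftrightarrow> (\<forall>a\<in>K. \<not> plurithin_at K a)"

section \<open>Polynomial convexity\<close>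

definition complex_polynomial :: "(complex^'n \<Rightarrow> complex) \<Rightarrow> bool" where
  "complex_polynomial p \<longleftrightarrow>
    (\<exists>(A :: ('n \<Rightarrow> nat) set) c. finite A \<and> p = (\<lambda>z. \<Sum>\<alpha>\<in>A. c \<alpha> * (\<Prod>i\<in>UNIV. (z $ i) ^ \<alpha> i)))"

definition polynomial_hull :: "(complex^'n) set \<Rightarrow> (complex^'n) set" where
  "polynomial_hull K =
    {z. \<forall>p. complex_polynomial p \<longrightarrow> norm (p z) \<le> (SUP w\<in>K. norm (p w))}"

text \<open>Only meant for nonempty compact \<open>K\<close>: the supremum above is a supremum of real numbers.\<close>

definition polynomially_convex :: "(complex^'n) set \<Rightarrow> bool" where
  "polynomially_convex K \<longleftrightarrow> polynomial_hull K = K"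

section \<open>Smooth functions\<close>

text \<open>Real differentiability, of order \<open>k\<close>: a function is of class \<open>C\<^sup>k\<^sup>+\<^sup>1\<close> if it is differentiable and
  all its directional derivatives are of class \<open>C\<^sup>k\<close>.\<close>

primrec Ck :: "nat \<Rightarrow> ('a::real_normed_vector \<Rightarrow> 'b::real_normed_vector) \<Rightarrow> bool" where
  "Ck 0 f \<longleftrightarrow> continuous_on UNIV f"
| "Ck (Suc k) f \<longleftrightarrow>
    (\<forall>x. f differentiable (at x)) \<and> (\<forall>v. Ck k (\<lambda>x. frechet_derivative f (at x) v))"

definition smooth :: "('a::real_normed_vector \<Rightarrow> 'b::real_normed_vector) \<Rightarrow> bool" where
  "smooth f \<longleftrightarrow> (\<forall>k. Ck k f)"

section \<open>Lelong classes and weighted extremal functions\<close>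

definition log_plus :: "real \<Rightarrow> real" where
  "log_plus t = (if t = 0 then 0 else max (ln t) 0)"

definition lelong :: "real \<Rightarrow> (complex^'n \<Rightarrow> ereal) set" where
  "lelong \<delta> =
    {u. psh_on UNIV u \<and> (\<exists>C::real. \<forall>z. u z \<le> ereal (\<delta> * log_plus (norm z) + C))}"

definition lelong_plus :: "real \<Rightarrow> (complex^'n \<Rightarrow> ereal) set" where
  "lelong_plus \<delta> =
    {u \<in> lelong \<delta>. \<exists>C::real. \<forall>z. u z \<ge> ereal (\<delta> * log_plus (norm z) - C)}"

text \<open>The upper limit is taken over full neighbourhoods of \<open>z\<close>, including \<open>z\<close> itself.\<close>

definition usc_reg :: "('a::topological_space \<Rightarrow> ereal) \<Rightarrow> 'a \<Rightarrow> ereal" where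
  "usc_reg f z = Limsup (nhds z) f"

text \<open>A weight on \<open>K\<close> is given by a function on the whole space, of which only the values on \<open>K\<close> are
  used; thus \<open>\<psi>\<close> also stands for its own restriction to \<open>K\<close>.\<close>

definition extremal :: "real \<Rightarrow> (complex^'n) set \<Rightarrow> (complex^'n \<Rightarrow> real) \<Rightarrow> complex^'n \<Rightarrow> ereal" where
  "extremal \<delta> K \<psi> z = (SUP u \<in> {u \<in> lelong \<delta>. \<forall>w\<in>K. u w \<le> ereal (\<psi> w)}. u z)"

definition extremal_reg :: "real \<Rightarrow> (complex^'n) set \<Rightarrow> (complex^'n \<Rightarrow> real) \<Rightarrow> complex^'n \<Rightarrow> ereal" where
  "extremal_reg \<delta> K \<psi> = usc_reg (extremal \<delta> K \<psi>)"

definition Lambda :: "(complex^'n) set \<Rightarrow> (complex^'n \<Rightarrow> real) \<Rightarrow> real set" where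
  "Lambda K \<psi> = {\<delta>. 0 < \<delta> \<and> (\<forall>z\<in>K. extremal \<delta> K \<psi> z = ereal (\<psi> z))}"

definition Lambda_reg :: "(complex^'n) set \<Rightarrow> (complex^'n \<Rightarrow> real) \<Rightarrow> real set" where
  "Lambda_reg K \<psi> = {\<delta> \<in> Lambda K \<psi>. \<forall>z\<in>K. extremal_reg \<delta> K \<psi> z = ereal (\<psi> z)}"

end

theory Submission
  imports Defs
    "HOL-Complex_Analysis.Complex_Analysis"
    "HOL-Computational_Algebra.Fundamental_Theorem_Algebra"
    "HOL-Real_Asymp.Real_Asymp"
begin

text \<open>
  \<open>K\<close> consists of the product of a large disc in \<open>z\<^sub>1\<close> with \<open>{0} \<union> \<Union>\<^sub>j D\<^sub>j\<close> in \<open>z\<^sub>2\<close> (and with unit discs in the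
  other variables), where \<open>D\<^sub>0\<close> is a unit disc around \<open>30\<close> and \<open>D\<^sub>1, D\<^sub>2, \<dots>\<close> are tiny discs converging
  to \<open>0\<close>, together with a horn: over the crescent \<open>\<bar>z\<^sub>1\<bar> \<ge> 1\<close>, \<open>\<bar>z\<^sub>1 + 1\<bar> \<le> 2\<close> its fibre is a disc tangent to the
  imaginary axis at \<open>z\<^sub>2 = 0\<close> that shrinks to a point as \<open>z\<^sub>1 \<rightarrow> 1\<close>. The distinguished point is \<open>a = 0\<close>.

  The weight is \<open>\<tau> ln \<bar>z - p\<bar>\<close>, smoothed inside the unit ball around \<open>p = (0, 30)\<close>, which lies in \<open>K\<close>. The
  Bernstein-Walsh inequality on lines through \<open>p\<close> gives \<open>V_\<tau> = \<Psi>\<close> everywhere. The discs \<open>D\<^sub>j\<close> are so small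
  that the plane \<open>z\<^sub>2 = 0\<close> is controlled only by the horn, that is, by the values on \<open>\<bar>z\<^sub>1\<bar> \<ge> 1\<close>. This
  suffices for \<open>V_K\<^sup>* = 0\<close>, but \<open>ln \<bar>z - p\<bar>\<close> is larger on \<open>\<bar>z\<^sub>1\<bar> \<ge> 1\<close> than at \<open>a\<close>, so that for small \<open>h\<close> the function
  \<open>(\<tau> + h/2) ln \<bar>z\<^sub>2 - 30\<bar>\<close> plus small multiples of logarithmic poles at the discs competes and beats \<open>\<Psi>\<close>
  near \<open>a\<close> by a multiple of \<open>h\<close>. Concavity in \<open>\<delta>\<close> gives the existence of the derivative.

  Polynomial convexity is seen by evaluating limits of polynomials at points of the hull: functions such as
  \<open>exp (1 / (1 + s - z\<^sub>1) - 1/2 + s / (z\<^sub>2 - s\<^sup>2))\<close>, cut off away from the outer discs, have modulus at most 1 on \<open>K\<close>.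
\<close>

section \<open>Circle means\<close>

text \<open>The formula for the horn comes from the coordinates G = 1 / (1 - z1) and F = 1 / z2. In
  them the crescent without its cusp is the strip 1/4 \<le> Re G \<le> 1/2, and the fibres of the
  horn are the half-planes Re F \<le> -|G|^2: a piece of a Siegel half-space, which is why the hull
  can be computed. The poles of G and F meet K and are moved off it by s and s^2; then |G|^2 + Re F
  \<le> 0 survives exactly on the relevant part of K, and Re G \<le> 1/2 survives with the
  correction s Re F. The fibres must degenerate somewhere on |z1| = 1: a fixed disc over the whole
  circle would put the product of the unit disc with that disc into the hull. The price is an
  exceptional point z1 = 1 in the proof of \<open>V_K\<^sup>* = 0\<close>. Since a lies in K, the
  unregularized extremal function equals the weight at a for every \<delta> \<ge> \<tau>. The jump
  is detected at the points (0, ctr k / 2), which lie in the gaps between consecutive small discs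
  and tend to a. The value of the derivative is not computed; the bound D \<ge> 1 is enough.\<close>

definition cmean :: "(complex \<Rightarrow> real) \<Rightarrow> complex \<Rightarrow> real \<Rightarrow> real" where
  "cmean f c r = integral {0..2*pi} (\<lambda>\<theta>. f (c + of_real r * cis \<theta>)) / (2*pi)"

text \<open>Agreement is required only almost everywhere because a subharmonic function may equal
  -\<infinity> on a null set of the circle; \<open>subharmonic_add_continuous\<close> relies on
  this.\<close>

lemma circle_mean_eq_real:
  assumes int: "set_integrable lborel {0..2*pi} g"
    and eq: "AE \<theta> in lborel. \<theta> \<in> {0..2*pi} \<longrightarrow> u (c + of_real r * cis \<theta>) = ereal (g \<theta>)"
  shows "circle_mean u c r = ereal (integral {0..2*pi} g / (2*pi))"
proof -
  define G where "G = (\<lambda>\<theta>. indicator {0..2*pi} \<theta> * g \<theta>)"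
  have G: "integrable lborel G"
    using int by (simp add: set_integrable_def G_def)
  have 1: "(\<integral>\<^sup>+\<theta>\<in>{0..2*pi}. e2ennreal (u (c + of_real r * cis \<theta>)) \<partial>lborel) = (\<integral>\<^sup>+\<theta>. ennreal (G \<theta>) \<partial>lborel)"
  proof (rule nn_integral_cong_AE)
    show "AE \<theta> in lborel. e2ennreal (u (c + of_real r * cis \<theta>)) * indicator {0..2*pi} \<theta> = ennreal (G \<theta>)"
      using eq by eventually_elim (simp add: G_def ennreal_def e2ennreal_neg split: split_indicator)
  qed
  have 2: "(\<integral>\<^sup>+\<theta>\<in>{0..2*pi}. e2ennreal (- u (c + of_real r * cis \<theta>)) \<partial>lborel) = (\<integral>\<^sup>+\<theta>. ennreal (- G \<theta>) \<partial>lborel)"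
  proof (rule nn_integral_cong_AE)
    show "AE \<theta> in lborel. e2ennreal (- u (c + of_real r * cis \<theta>)) * indicator {0..2*pi} \<theta> = ennreal (- G \<theta>)"
      using eq by eventually_elim (simp add: G_def ennreal_def e2ennreal_neg split: split_indicator)
  qed
  have fin1: "(\<integral>\<^sup>+\<theta>. ennreal (G \<theta>) \<partial>lborel) \<noteq> \<infinity>" "(\<integral>\<^sup>+\<theta>. ennreal (- G \<theta>) \<partial>lborel) \<noteq> \<infinity>"
    using G by (auto simp: real_integrable_def)
  then obtain x y where xy: "0 \<le> x" "(\<integral>\<^sup>+\<theta>. ennreal (G \<theta>) \<partial>lborel) = ennreal x"
     "0 \<le> y" "(\<integral>\<^sup>+\<theta>. ennreal (- G \<theta>) \<partial>lborel) = ennreal y"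
    by (metis ennreal_cases infinity_ennreal_def)
  have "integral {0..2*pi} g = integral\<^sup>L lborel G"
    using set_borel_integral_eq_integral(2)[OF int]
    by (simp add: set_lebesgue_integral_def G_def)
  also have "\<dots> = x - y"
    using real_lebesgue_integral_def[OF G] xy by simp
  finally show ?thesis
    unfolding circle_mean_def 1 2 xy using xy(1,3) by (simp add: enn2ereal_ennreal)
qed

lemma circle_mean_real:
  assumes "continuous_on (sphere c \<bar>r\<bar>) f"
  shows "circle_mean (\<lambda>z. ereal (f z)) c r = ereal (cmean f c r)"
    and cmean_integrable: "(\<lambda>\<theta>. f (c + of_real r * cis \<theta>)) integrable_on {0..2*pi}"
proof -
  have "continuous_on {0..2*pi} (\<lambda>\<theta>. f (c + of_real r * cis \<theta>))"
    by (rule continuous_on_compose2[OF assms]) (auto intro!: continuous_intros simp: dist_norm norm_mult)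
  then have s: "set_integrable lborel {0..2*pi} (\<lambda>\<theta>. f (c + of_real r * cis \<theta>))"
    by (rule borel_integrable_atLeastAtMost')
  then show "circle_mean (\<lambda>z. ereal (f z)) c r = ereal (cmean f c r)"
    unfolding cmean_def by (rule circle_mean_eq_real) simp
  show "(\<lambda>\<theta>. f (c + of_real r * cis \<theta>)) integrable_on {0..2*pi}"
    using set_borel_integral_eq_integral(1)[OF s] .
qed

lemma circle_mean_mono:
  assumes "\<And>\<theta>. u (c + of_real r * cis \<theta>) \<le> v (c + of_real r * cis \<theta>)"
  shows "circle_mean u c r \<le> circle_mean v c r"
  unfolding circle_mean_def
  by (intro ereal_divide_right_mono ereal_minus_mono)
     (auto intro!: nn_integral_mono mult_right_mono e2ennreal_mono assms simp: less_eq_ennreal.rep_eq[symmetric])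

lemma cmean_mono:
  assumes "continuous_on (sphere c \<bar>r\<bar>) f" "continuous_on (sphere c \<bar>r\<bar>) g"
    and "\<And>z. z \<in> sphere c \<bar>r\<bar> \<Longrightarrow> f z \<le> g z"
  shows "cmean f c r \<le> cmean g c r"
proof -
  have "integral {0..2*pi} (\<lambda>\<theta>. f (c + of_real r * cis \<theta>)) \<le> integral {0..2*pi} (\<lambda>\<theta>. g (c + of_real r * cis \<theta>))"
    by (rule integral_le[OF cmean_integrable[OF assms(1)] cmean_integrable[OF assms(2)]])
       (auto intro!: assms(3) simp: dist_norm norm_mult)
  then show ?thesis unfolding cmean_def by (simp add: divide_right_mono)
qed

lemma cmean_add:
  assumes "continuous_on (sphere c \<bar>r\<bar>) f" "continuous_on (sphere c \<bar>r\<bar>) g"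
  shows "cmean (\<lambda>z. f z + g z) c r = cmean f c r + cmean g c r"
  unfolding cmean_def
  by (simp add: integral_add[OF cmean_integrable[OF assms(1)] cmean_integrable[OF assms(2)]] add_divide_distrib)

lemma cmean_cmult: "cmean (\<lambda>z. a * f z) c r = a * cmean f c r"
  unfolding cmean_def by simp

lemma cmean_const [simp]: "cmean (\<lambda>z. a) c r = a"
  unfolding cmean_def by simp

text \<open>Cauchy's formula for the branch \<open>Ln (1 + w * u)\<close>, holomorphic on the closed
  unit disc and 0 at its centre. Parametrizing the circle leaves the integrand f times \<i>, so the
  wanted real part is read off as an imaginary part.\<close>

lemma mean_ln_one_plus:
  assumes "norm w < 1"
  shows "((\<lambda>\<theta>. ln (norm (1 + w * cis \<theta>))) has_integral 0) {0..2*pi}"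
proof -
  define f where "f = (\<lambda>u. Ln (1 + w * u))"
  have nonpos: "1 + w * u \<notin> \<real>\<^sub>\<le>\<^sub>0" if "norm u \<le> 1" for u
  proof
    assume "1 + w * u \<in> \<real>\<^sub>\<le>\<^sub>0"
    then have "Re (1 + w * u) \<le> 0" by (simp add: complex_nonpos_Reals_iff)
    then have "1 \<le> \<bar>Re (w * u)\<bar>" by simp
    also have "\<dots> \<le> norm (w * u)" by (rule abs_Re_le_cmod)
    also have "\<dots> \<le> norm w * 1" unfolding norm_mult using that by (intro mult_left_mono) auto
    finally show False using assms by simp
  qed
  have "f holomorphic_on cball 0 1"
    unfolding f_def using nonpos by (intro holomorphic_intros) auto
  then have "((\<lambda>u. f u / (u - 0)) has_contour_integral (2 * of_real pi * \<i> * f 0)) (circlepath 0 1)"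
    by (intro Cauchy_integral_circlepath_simple) auto
  then have "((\<lambda>u. f u / u) has_contour_integral 0) (part_circlepath 0 1 0 (2 * pi))"
    by (simp add: f_def circlepath_def)
  then have "((\<lambda>t. f (cis t) / cis t * \<i> * cis t) has_integral 0) {0..2*pi}"
    by (subst (asm) has_contour_integral_part_circlepath_iff) auto
  then have "((\<lambda>t. f (cis t) * \<i>) has_integral 0) {0..2*pi}"
    by (simp add: field_simps)
  from has_integral_linear[OF this bounded_linear_Im]
  have "((\<lambda>t. Re (f (cis t))) has_integral 0) {0..2*pi}" by (simp add: o_def)
  then show ?thesis
    proof (rule has_integral_eq[rotated])
    fix t :: real
    have "1 + w * cis t \<noteq> 0" using nonpos[of "cis t"] by auto
    then show "Re (f (cis t)) = ln (norm (1 + w * cis t))" by (simp add: f_def)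
  qed
qed

text \<open>Factor out the larger of |c - q| and r; the remaining factor has the form |1 + w e^(i
  \<theta>)| with |w| < 1 and contributes nothing.\<close>

lemma cmean_ln_dist:
  assumes "r > 0"
  shows "norm (c - q) > r \<Longrightarrow> cmean (\<lambda>t. ln (norm (t - q))) c r = ln (norm (c - q))"
    and "norm (c - q) < r \<Longrightarrow> cmean (\<lambda>t. ln (norm (t - q))) c r = ln r"
proof -
  assume *: "norm (c - q) > r"
  define w where "w = of_real r / (c - q)"
  have w: "norm w < 1" using * assms by (simp add: w_def norm_divide) (simp add: divide_simps)
  have nz: "c - q \<noteq> 0" using * assms by auto
  have "1 + w * cis \<theta> \<noteq> 0" for \<theta>
  proof
    assume "1 + w * cis \<theta> = 0"
    then have "norm (w * cis \<theta>) = 1" by (metis add_eq_0_iff norm_minus_cancel norm_one)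
    then show False using w by (simp add: norm_mult)
  qed
  moreover have "c + of_real r * cis \<theta> - q = (c - q) * (1 + w * cis \<theta>)" for \<theta>
    using nz by (simp add: w_def field_simps)
  ultimately have "ln (norm (c + of_real r * cis \<theta> - q)) = ln (norm (c - q)) + ln (norm (1 + w * cis \<theta>))" for \<theta>
    using nz by (simp add: norm_mult ln_mult)
  moreover have "((\<lambda>\<theta>. ln (norm (c - q)) + ln (norm (1 + w * cis \<theta>))) has_integral (ln (norm (c - q)) * (2*pi) + 0)) {0..2*pi}"
    using has_integral_const_real[of "ln (norm (c-q))" 0 "2*pi"]
    by (intro has_integral_add mean_ln_one_plus w) (simp add: mult_ac)
  ultimately show "cmean (\<lambda>t. ln (norm (t - q))) c r = ln (norm (c - q))"
    unfolding cmean_def by (simp add: integral_unique)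
next
  assume *: "norm (c - q) < r"
  \<comment> \<open>The factor is 1 + ((c - q) / r) e^(-i \<theta>). Conjugation does not change its
    modulus and turns it into the shape of \<open>mean_ln_one_plus\<close>.\<close>
  define w where "w = cnj ((c - q) / of_real r)"
  have w: "norm w < 1" using * assms by (simp only: w_def complex_mod_cnj norm_divide) simp
  have "1 + w * cis \<theta> \<noteq> 0" for \<theta>
  proof
    assume "1 + w * cis \<theta> = 0"
    then have "norm (w * cis \<theta>) = 1" by (metis add_eq_0_iff norm_minus_cancel norm_one)
    then show False using w by (simp add: norm_mult)
  qed
  moreover have "norm (c + of_real r * cis \<theta> - q) = r * norm (1 + w * cis \<theta>)" for \<theta>
  proof -
    have "c + of_real r * cis \<theta> - q = of_real r * cis \<theta> * cnj (1 + w * cis \<theta>)"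
      proof -
      have 1: "cis \<theta> * cis (- \<theta>) = 1" by (simp add: cis_mult)
      have "of_real r * cis \<theta> * cnj (1 + w * cis \<theta>)
          = of_real r * cis \<theta> + (of_real r * ((c - q) / of_real r)) * (cis \<theta> * cis (- \<theta>))"
        by (simp add: w_def cis_cnj distrib_left mult_ac)
      then show ?thesis using assms by (simp add: 1)
    qed
    then show ?thesis using assms by (simp only: norm_mult complex_mod_cnj) simp
  qed
  ultimately have "ln (norm (c + of_real r * cis \<theta> - q)) = ln r + ln (norm (1 + w * cis \<theta>))" for \<theta>
    using assms by (simp add: ln_mult)
  moreover have "((\<lambda>\<theta>. ln r + ln (norm (1 + w * cis \<theta>))) has_integral (ln r * (2*pi) + 0)) {0..2*pi}"
    using has_integral_const_real[of "ln r" 0 "2*pi"]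
    by (intro has_integral_add mean_ln_one_plus w) (simp add: mult_ac)
  ultimately show "cmean (\<lambda>t. ln (norm (t - q))) c r = ln r"
    unfolding cmean_def by (simp add: integral_unique)
qed

lemma has_integral_Re_cis: "((\<lambda>\<theta>. Re (q * cis \<theta>)) has_integral 0) {0..2*pi}"
proof -
  have "((\<lambda>\<theta>. Re (q * cis \<theta>)) has_integral (Im (q * cis (2*pi)) - Im (q * cis 0))) {0..2*pi}"
    by (rule fundamental_theorem_of_calculus)
       (auto intro!: derivative_eq_intros simp flip: has_real_derivative_iff_has_vector_derivative)
  then show ?thesis by simp
qed

lemma cmean_norm_sq: "cmean (\<lambda>t. (norm t)^2) c r = (norm c)^2 + r^2"
proof -
  have "(norm (c + of_real r * cis \<theta>))^2 = (norm c)^2 + r^2 + Re ((2 * of_real r * cnj c) * cis \<theta>)" for \<theta>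
  proof -
    have "(cos \<theta>)^2 = 1 - (sin \<theta>)^2" by (simp add: cos_squared_eq)
    then show ?thesis
      unfolding cmod_power2 by (simp add: power2_eq_square algebra_simps) (simp add: power2_eq_square[symmetric] distrib_left[symmetric])
  qed
  moreover have "((\<lambda>\<theta>. ((norm c)^2 + r^2) + Re ((2 * of_real r * cnj c) * cis \<theta>)) has_integral ((((norm c)^2 + r^2) * (2*pi)) + 0)) {0..2*pi}"
    using has_integral_const_real[of "(norm c)^2 + r^2" 0 "2*pi"]
    by (intro has_integral_add has_integral_Re_cis) (simp add: mult_ac)
  ultimately show ?thesis
    unfolding cmean_def by (simp add: integral_unique)
qed

text \<open>Fejer-Riesz factorization: the positive trigonometric polynomial P + 2 Re (q e^(i
  \<theta>)) equals X |1 + w e^(i \<theta>)|^2, where X is the larger root of X^2 - P X + |q|^2 = 0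
  and w = q / X. Only ln X survives in the mean.\<close>

lemma mean_ln_trig:
  fixes q :: complex
  assumes P: "P > 2 * norm q"
  shows "((\<lambda>\<theta>. ln (P + 2 * Re (q * cis \<theta>)) / 2) has_integral
           (2 * pi * (ln ((P + sqrt (P^2 - 4 * (norm q)^2)) / 2) / 2))) {0..2*pi}"
proof -
  define X where "X = (P + sqrt (P^2 - 4 * (norm q)^2)) / 2"
  have P0: "P > 0" using P norm_ge_zero[of q] by linarith
  have sq: "P^2 - 4 * (norm q)^2 \<ge> 0"
    using power_mono[of "2 * norm q" P 2] P by (simp add: power_mult_distrib)
  have X0: "X > 0" using P0 sq by (simp add: X_def add_pos_nonneg)
  have Xroot: "X^2 - P * X + (norm q)^2 = 0"
  proof -
    have "(sqrt (P^2 - 4 * (norm q)^2))^2 = P^2 - 4 * (norm q)^2" using sq by simp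
    then show ?thesis unfolding X_def by (simp add: power2_eq_square field_simps)
  qed
  define w where "w = q / of_real X"
  have qX: "norm q < X"
  proof -
    have "2 * norm q < P" by fact
    also have "P \<le> 2 * X" using sq by (simp add: X_def)
    finally show ?thesis by simp
  qed
  then have w: "norm w < 1" using X0 by (simp add: w_def norm_divide)
  have eq: "P + 2 * Re (q * cis \<theta>) = X * (norm (1 + w * cis \<theta>))^2" for \<theta>
  proof -
    have n: "(norm (1 + z))^2 = 1 + 2 * Re z + (norm z)^2" for z :: complex
      unfolding cmod_power2 by (simp add: power2_eq_square algebra_simps)
    have "X * (norm (1 + w * cis \<theta>))^2 = X * (1 + 2 * Re (w * cis \<theta>) + (norm w)^2)"
      by (simp add: n norm_mult)
    also have "(norm w)^2 = (norm q)^2 / X^2" using X0 by (simp add: w_def norm_divide power_divide)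
    also have "Re (w * cis \<theta>) = Re (q * cis \<theta>) / X" by (simp add: w_def)
    also have "X * (1 + 2 * (Re (q * cis \<theta>) / X) + (norm q)^2 / X^2) = X + 2 * Re (q * cis \<theta>) + (norm q)^2 / X"
      using X0 by (simp add: field_simps power2_eq_square)
    also have "X + (norm q)^2 / X = P" using Xroot X0 by (simp add: field_simps power2_eq_square)
    then have "X + 2 * Re (q * cis \<theta>) + (norm q)^2 / X = P + 2 * Re (q * cis \<theta>)" by simp
    finally show ?thesis by simp
  qed
  have nz: "1 + w * cis \<theta> \<noteq> 0" for \<theta>
  proof
    assume "1 + w * cis \<theta> = 0"
    then have "norm (w * cis \<theta>) = 1" by (metis add_eq_0_iff norm_minus_cancel norm_one)
    then show False using w by (simp add: norm_mult)
  qed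
  have "ln (P + 2 * Re (q * cis \<theta>)) / 2 = ln X / 2 + ln (norm (1 + w * cis \<theta>))" for \<theta>
    unfolding eq using nz[of \<theta>] X0 by (simp add: ln_mult ln_realpow)
  moreover have "((\<lambda>\<theta>. ln X / 2 + ln (norm (1 + w * cis \<theta>))) has_integral (ln X / 2 * (2*pi) + 0)) {0..2*pi}"
    using has_integral_const_real[of "ln X / 2" 0 "2*pi"]
    by (intro has_integral_add mean_ln_one_plus w) (simp add: mult_ac)
  ultimately show ?thesis unfolding X_def by (simp only: mult_ac add_0_right times_divide_eq_right)
qed

section \<open>Maximum principle and continuous plurisubharmonic functions\<close>

text \<open>Extended-real functions are almost always compared with continuous majorants; this turns
  the Lebesgue mean of the definition into the real mean \<open>cmean\<close>.\<close>

lemma subharmonic_le_cmean: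
  assumes v: "subharmonic_on D v" and r: "0 < r" "cball c r \<subseteq> D"
    and f: "continuous_on (sphere c r) f" and le: "\<And>z. z \<in> sphere c r \<Longrightarrow> v z \<le> ereal (f z)"
  shows "v c \<le> ereal (cmean f c r)"
proof -
  have "v c \<le> circle_mean v c r" using v r by (auto simp: subharmonic_on_def)
  also have "\<dots> \<le> circle_mean (\<lambda>z. ereal (f z)) c r"
    by (rule circle_mean_mono) (use r in \<open>auto intro!: le simp: dist_norm norm_mult\<close>)
  also have "\<dots> = ereal (cmean f c r)" using f r by (intro circle_mean_real) auto
  finally show ?thesis .
qed

lemma usc_attains_max:
  fixes \<phi> :: "'a::topological_space \<Rightarrow> ereal"
  assumes X: "compact X" "X \<noteq> {}" and usc: "\<And>c. openin (top_of_set X) {x \<in> X. \<phi> x < c}"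
  shows "\<exists>x\<in>X. \<forall>y\<in>X. \<phi> y \<le> \<phi> x"
proof (rule ccontr)
  assume no: "\<not> ?thesis"
  define U where "U = (\<lambda>y. {x \<in> X. \<phi> x < \<phi> y})"
  have "X \<subseteq> (\<Union>y\<in>X. U y)" using no by (auto simp: U_def not_le)
  moreover have "\<exists>T. open T \<and> U y = X \<inter> T" for y
    using usc[of "\<phi> y"] by (auto simp: U_def openin_open)
  then obtain T where T: "\<And>y. open (T y)" "\<And>y. U y = X \<inter> T y" by metis
  ultimately have "X \<subseteq> (\<Union>y\<in>X. T y)" by auto
  from compactE_image[OF X(1) T(1) this] obtain Y where Y: "Y \<subseteq> X" "finite Y" "X \<subseteq> (\<Union>y\<in>Y. T y)" by metis
  then have "Y \<noteq> {}" using X by auto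
  then have fin: "finite (\<phi> ` Y)" "\<phi> ` Y \<noteq> {}" using Y by auto
  from Max_in[OF this] obtain y where y: "y \<in> Y" "\<phi> y = Max (\<phi> ` Y)" by auto
  then obtain y' where "y' \<in> Y" "y \<in> T y'" using Y by auto
  then have "y \<in> U y'" using T(2)[of y'] y Y by auto
  then have "\<phi> y < \<phi> y'" by (simp add: U_def)
  moreover have "\<phi> y' \<le> \<phi> y" using y fin \<open>y' \<in> Y\<close> by simp
  ultimately show False by simp
qed

lemma usc_add_continuous:
  fixes v :: "'a::topological_space \<Rightarrow> ereal"
  assumes v: "\<And>c. open {x. v x < c}" and k: "continuous_on X k"
  shows "openin (top_of_set X) {x \<in> X. v x + ereal (k x) < c}"
proof -
  \<comment> \<open>A real number q in between separates the two summands, so the sublevel set is a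
    union of sets that are visibly open.\<close>
  have eq: "v x + ereal (k x) < c \<longleftrightarrow> (\<exists>q::real. v x < ereal q \<and> ereal q + ereal (k x) < c)" for x
  proof
    assume "v x + ereal (k x) < c"
    then have "v x < c - ereal (k x)" by (cases "v x"; cases c) auto
    from ereal_dense2[OF this] obtain q where q: "v x < ereal q" "ereal q < c - ereal (k x)" by auto
    then show "\<exists>q::real. v x < ereal q \<and> ereal q + ereal (k x) < c" by (intro exI[of _ q]) (cases c; auto)
  next
    assume "\<exists>q::real. v x < ereal q \<and> ereal q + ereal (k x) < c"
    then obtain q where q: "v x < ereal q" "ereal q + ereal (k x) < c" by auto
    from q(1) have "v x + ereal (k x) < ereal q + ereal (k x)" by (cases "v x") auto
    then show "v x + ereal (k x) < c" using q(2) by (rule less_trans)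
  qed
  have "openin (top_of_set X) {x \<in> X. v x < ereal q \<and> ereal q + ereal (k x) < c}" for q
  proof -
    have c: "continuous_on X (\<lambda>x. ereal (q + k x))"
      by (intro continuous_intros k)
    have "openin (top_of_set X) (X \<inter> {x. v x < ereal q})" using v by (simp add: openin_open_Int)
    moreover have "openin (top_of_set X) (X \<inter> (\<lambda>x. ereal (q + k x)) -` {..<c})"
      by (rule continuous_openin_preimage_gen[OF c]) simp
    ultimately have "openin (top_of_set X) ((X \<inter> {x. v x < ereal q}) \<inter> (X \<inter> (\<lambda>x. ereal (q + k x)) -` {..<c}))"
      by (rule openin_Int)
    moreover have "(X \<inter> {x. v x < ereal q}) \<inter> (X \<inter> (\<lambda>x. ereal (q + k x)) -` {..<c}) = {x \<in> X. v x < ereal q \<and> ereal q + ereal (k x) < c}"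
      by auto
    ultimately show ?thesis by simp
  qed
  then have "openin (top_of_set X) (\<Union>q. {x \<in> X. v x < ereal q \<and> ereal q + ereal (k x) < c})"
    by (intro openin_Union) auto
  moreover have "(\<Union>q. {x \<in> X. v x < ereal q \<and> ereal q + ereal (k x) < c}) = {x \<in> X. v x + ereal (k x) < c}"
    using eq by auto
  ultimately show ?thesis by simp
qed

lemma usc_on_UNIV: "usc_on UNIV u \<longleftrightarrow> (\<forall>c. open {z. u z < c})"
  by (simp add: usc_on_def)

text \<open>At a maximum of \<open>v - g + \<eta> |t|\<^sup>2\<close> the submean inequality would be violated by \<open>\<eta> r\<^sup>2\<close>.\<close>

lemma maximum_principle_ln:
  fixes v :: "complex \<Rightarrow> ereal"
  assumes v: "subharmonic_on UNIV v" and \<Omega>: "open \<Omega>" "bounded \<Omega>"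
    and q: "q1 \<notin> closure \<Omega>" "q2 \<notin> closure \<Omega>"
    and g: "g = (\<lambda>t. \<alpha> + c1 * ln (norm (t - q1)) + c2 * ln (norm (t - q2)))"
    and fr: "\<And>t. t \<in> frontier \<Omega> \<Longrightarrow> v t \<le> ereal (g t)"
    and s: "s \<in> \<Omega>"
  shows "v s \<le> ereal (g s)"
proof (rule ccontr)
  assume "\<not> ?thesis"
  then have gt: "v s > ereal (g s)" by simp
  define X where "X = closure \<Omega>"
  have X: "compact X" "s \<in> X" using \<Omega> s closure_subset by (auto simp: X_def compact_closure)
  then have "X \<noteq> {}" by auto
  note X = X(1) this X(2)
  have contg: "continuous_on X g"
    using q unfolding g X_def by (intro continuous_intros) auto
  obtain d where d: "d > 0" "ereal (g s + d) \<le> v s"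
  proof (cases "v s")
    case (real x)
    then show ?thesis using gt that[of "x - g s"] by auto
  next
    case PInf
    then show ?thesis using that[of 1] by auto
  qed (use gt in auto)
  obtain B where B: "B > 0" "\<And>t. t \<in> X \<Longrightarrow> norm t \<le> B"
    using compact_imp_bounded[OF X(1)] by (auto simp: bounded_pos)
  \<comment> \<open>The perturbation is then at most d / 2 on X, while the maximum of v + k is at
    least d. Hence the maximum is not attained on the frontier.\<close>
  define \<eta> where "\<eta> = d / (2 * B^2)"
  have \<eta>: "\<eta> > 0" using d B by (simp add: \<eta>_def)
  define k where "k = (\<lambda>t::complex. \<eta> * (norm t)^2 - g t)"
  have contk: "continuous_on X k" unfolding k_def by (intro continuous_intros contg)
  have usc: "openin (top_of_set X) {x \<in> X. v x + ereal (k x) < c}" for c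
    by (rule usc_add_continuous[OF _ contk]) (use v in \<open>auto simp: subharmonic_on_def usc_on_UNIV\<close>)
  obtain t0 where t0: "t0 \<in> X" "\<And>t. t \<in> X \<Longrightarrow> v t + ereal (k t) \<le> v t0 + ereal (k t0)"
    using usc_attains_max[OF X(1,2) usc] by blast
  have big: "ereal d \<le> v t0 + ereal (k t0)"
  proof -
    have "ereal d \<le> v s + ereal (k s)"
      using d \<eta> by (cases "v s") (auto simp: k_def add_increasing2 algebra_simps intro: order_trans[of d "d + _"])
    also have "\<dots> \<le> v t0 + ereal (k t0)" using t0 X by auto
    finally show ?thesis .
  qed
  have vfin: "v t0 < \<infinity>" using v by (auto simp: subharmonic_on_def)
  then obtain x where x: "v t0 = ereal x" using big by (cases "v t0") auto
  have "t0 \<in> \<Omega>"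
  proof (rule ccontr)
    assume "t0 \<notin> \<Omega>"
    then have "t0 \<in> frontier \<Omega>" using t0 \<Omega> by (auto simp: X_def frontier_def interior_open)
    then have "v t0 \<le> ereal (g t0)" by (rule fr)
    then have "x + k t0 \<le> \<eta> * (norm t0)^2" using x by (simp add: k_def)
    also have "\<dots> \<le> \<eta> * B^2" using B(2)[OF t0(1)] \<eta> by (intro mult_left_mono power_mono) auto
    also have "\<dots> = d / 2" using B by (simp add: \<eta>_def)
    finally show False using big x d by simp
  qed
  then obtain r0 where r0: "r0 > 0" "cball t0 r0 \<subseteq> \<Omega>" using \<Omega> open_contains_cball by blast
  have nb: "t0 \<in> X" "q1 \<notin> X" "q2 \<notin> X" using t0 q by (auto simp: X_def)
  have sub: "cball t0 r0 \<subseteq> X" using r0 closure_subset X_def by blast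
  have far: "norm (t0 - q) > r0" if "q \<notin> X" for q
    using sub that by (force simp: dist_norm)
  have sph: "sphere t0 r0 \<subseteq> X" using sub by auto
  define f where "f = (\<lambda>t. (x + k t0) + (g t + (-\<eta>) * (norm t)^2))"
  have vf: "v t \<le> ereal (f t)" if "t \<in> sphere t0 r0" for t
  proof -
    have "v t + ereal (k t) \<le> ereal (x + k t0)" using t0(2)[of t] that sph x by auto
    then show ?thesis by (cases "v t") (auto simp: f_def k_def)
  qed
  have "continuous_on (sphere t0 r0) f" unfolding f_def
    by (intro continuous_intros continuous_on_subset[OF contg sph])
  from subharmonic_le_cmean[OF v r0(1) _ this vf]
  have "x \<le> cmean f t0 r0" using x by simp
  also have "cmean f t0 r0 = (x + k t0) + (cmean g t0 r0 + (-\<eta>) * ((norm t0)^2 + r0^2))"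
  proof -
    have 1: "continuous_on (sphere t0 \<bar>r0\<bar>) g" using r0(1) continuous_on_subset[OF contg sph] by simp
    have 2: "continuous_on (sphere t0 \<bar>r0\<bar>) (\<lambda>t. (-\<eta>) * (norm t)^2)" by (intro continuous_intros)
    have 3: "continuous_on (sphere t0 \<bar>r0\<bar>) (\<lambda>t. g t + (-\<eta>) * (norm t)^2)" by (intro continuous_on_add 1 2)
    show ?thesis unfolding f_def
      by (simp only: cmean_add[OF continuous_on_const 3] cmean_add[OF 1 2] cmean_const cmean_cmult cmean_norm_sq)
  qed
  also have "cmean g t0 r0 = g t0"
  proof -
    have c: "continuous_on (sphere t0 r0) (\<lambda>t. c * ln (norm (t - q)))" if "q \<notin> X" for q c
      using that sph by (intro continuous_intros) auto
    have c': "continuous_on (sphere t0 r0) (\<lambda>t. \<alpha> + c1 * ln (norm (t - q1)))"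
      by (intro continuous_on_add c nb) auto
    show ?thesis unfolding g
      using r0(1) c[OF nb(2)] c[OF nb(3)] c'
      by (simp add: cmean_add cmean_cmult cmean_ln_dist(1)[OF r0(1) far[OF nb(2)]] cmean_ln_dist(1)[OF r0(1) far[OF nb(3)]])
  qed
  also have "(x + k t0) + (g t0 + (-\<eta>) * ((norm t0)^2 + r0^2)) = x - \<eta> * r0^2"
    by (simp add: k_def algebra_simps)
  finally have "\<eta> * r0^2 \<le> 0" by simp
  moreover have "\<eta> * r0^2 > 0" using \<eta> r0(1) by simp
  ultimately show False by simp
qed

text \<open>Maximum principle on a large annulus with the slope \<delta> + \<epsilon>. The surplus
  \<epsilon> lets the majorant overtake the unknown constant C on the outer circle; afterwards
  \<epsilon> tends to 0.\<close>

lemma bernstein_walsh: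
  fixes v :: "complex \<Rightarrow> ereal"
  assumes v: "subharmonic_on UNIV v" and \<rho>: "\<rho> > 0" and \<delta>: "\<delta> \<ge> 0"
    and growth: "\<And>t. v t \<le> ereal (\<delta> * ln (1 + norm t) + C)"
    and M: "\<And>t. t \<in> cball c \<rho> \<Longrightarrow> v t \<le> ereal M"
  shows "v t \<le> ereal (M + \<delta> * max 0 (ln (norm (t - c) / \<rho>)))"
proof (cases "norm (t - c) \<le> \<rho>")
  case True
  then have "v t \<le> ereal M" by (intro M) (simp add: dist_norm norm_minus_commute)
  also have "\<dots> \<le> ereal (M + \<delta> * max 0 (ln (norm (t - c) / \<rho>)))" using \<delta> by simp
  finally show ?thesis .
next
  case False
  define T where "T = norm (t - c)"
  have T: "T > \<rho>" using False by (simp add: T_def)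
  have main: "v t \<le> ereal (M + (\<delta> + \<epsilon>) * ln (T / \<rho>))" if \<epsilon>: "\<epsilon> > 0" for \<epsilon>
  proof -
    \<comment> \<open>On |z - c| = R this gives 1 + |z| \<le> D R / \<rho>, and E is the size of ln
      (R / \<rho>) at which the surplus \<epsilon> ln (R / \<rho>) outweighs \<delta> ln D + C -
      M.\<close>
    define D where "D = 1 + norm c + \<rho>"
    have D: "D > 0" using \<rho> by (simp add: D_def add_pos_pos add_nonneg_pos)
    define E where "E = (\<delta> * ln D + C - M) / \<epsilon>"
    define R where "R = max (T + 1) (\<rho> * exp E)"
    have R: "R > T" "R > \<rho>" "ln (R / \<rho>) \<ge> E"
    proof -
      show "R > T" "R > \<rho>" using T by (auto simp: R_def)
      have "exp E \<le> R / \<rho>" using \<rho> by (simp add: R_def field_simps)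
      then show "ln (R / \<rho>) \<ge> E" using \<rho> \<open>R > \<rho>\<close> by (subst ln_ge_iff) auto
    qed
    define \<Omega> where "\<Omega> = ball c R - cball c \<rho>"
    have op: "open \<Omega>" unfolding \<Omega>_def by (intro open_Diff) auto
    have clos: "closure \<Omega> \<subseteq> cball c R - ball c \<rho>" unfolding \<Omega>_def
      by (rule closure_minimal) (auto intro: closed_Diff)
    define g where "g = (\<lambda>z. (M - (\<delta> + \<epsilon>) * ln \<rho>) + (\<delta> + \<epsilon>) * ln (norm (z - c)) + 0 * ln (norm (z - c)))"
    have geq: "g z = M + (\<delta> + \<epsilon>) * ln (norm (z - c) / \<rho>)" if "z \<noteq> c" for z
      using that \<rho> by (simp add: g_def ln_div algebra_simps)
    have "v t \<le> ereal (g t)"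
    proof (rule maximum_principle_ln[OF v op _ _ _ g_def])
      show "bounded \<Omega>" unfolding \<Omega>_def by (intro bounded_subset[OF bounded_ball]) auto
      show "c \<notin> closure \<Omega>" "c \<notin> closure \<Omega>" using clos \<rho> by auto
      show "t \<in> \<Omega>" using T R by (auto simp: \<Omega>_def T_def dist_norm norm_minus_commute)
      fix z assume "z \<in> frontier \<Omega>"
      then have z: "z \<in> cball c R - ball c \<rho>" "z \<notin> \<Omega>"
        using clos op by (auto simp: frontier_def interior_open)
      then have "norm (z - c) = R \<or> norm (z - c) = \<rho>" by (auto simp: \<Omega>_def dist_norm norm_minus_commute)
      then show "v z \<le> ereal (g z)"
      proof
        assume z: "norm (z - c) = \<rho>"
        then have "v z \<le> ereal M" by (intro M) (simp add: dist_norm norm_minus_commute)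
        also have "M = g z" using z \<rho> by (subst geq) auto
        finally show ?thesis .
      next
        assume z: "norm (z - c) = R"
        have nz: "1 + norm z \<le> D * (R / \<rho>)"
        proof -
          have "norm z \<le> R + norm c" using norm_triangle_sub[of z c] z by simp
          moreover have "R + norm c + 1 \<le> D * (R / \<rho>)"
          proof -
            have "(1 + norm c) * 1 \<le> (1 + norm c) * (R / \<rho>)" using R \<rho> by (intro mult_left_mono) auto
            then show ?thesis using \<rho> by (simp add: D_def field_simps)
          qed
          ultimately show ?thesis by simp
        qed
        have "v z \<le> ereal (\<delta> * ln (1 + norm z) + C)" by (rule growth)
        also have "\<delta> * ln (1 + norm z) + C \<le> \<delta> * ln (D * (R / \<rho>)) + C"
          using nz \<delta> by (intro add_right_mono mult_left_mono ln_mono) (auto simp: add_pos_nonneg)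
        also have "\<dots> = \<delta> * (ln D + ln (R / \<rho>)) + C"
          using D R \<rho> T ln_mult_pos[of D "R / \<rho>"] by simp
        also have "\<dots> \<le> M + (\<delta> + \<epsilon>) * ln (R / \<rho>)"
        proof -
          have "\<epsilon> * E \<le> \<epsilon> * ln (R / \<rho>)" using R(3) \<epsilon> by (intro mult_left_mono) auto
          moreover have "\<epsilon> * E = \<delta> * ln D + C - M" using \<epsilon> by (simp add: E_def)
          ultimately show ?thesis by (simp add: algebra_simps)
        qed
        also have "\<dots> = g z" using z R \<rho> by (subst geq) auto
        finally show ?thesis by simp
      qed
    qed
    then show ?thesis using T \<rho> by (subst (asm) geq) (auto simp: T_def)
  qed
  define L where "L = ln (T / \<rho>)"
  have L: "L > 0" using T \<rho> by (simp add: L_def)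
  have "v t \<le> ereal (M + \<delta> * L)"
  proof (cases "v t")
    case (real y)
    have "y \<le> M + \<delta> * L"
    proof (rule field_le_epsilon)
      fix e :: real assume "e > 0"
      then have "v t \<le> ereal (M + (\<delta> + e / L) * ln (T / \<rho>))" using L by (intro main) auto
      then have "y \<le> M + (\<delta> + e / L) * L" unfolding real L_def[symmetric] by (simp only: ereal_less_eq)
      moreover have "(\<delta> + e / L) * L = \<delta> * L + e" using L by (simp add: distrib_right)
      ultimately show "y \<le> M + \<delta> * L + e" by linarith
    qed
    then show ?thesis using real by simp
  next
    case PInf
    then show ?thesis using main[of 1] by simp
  qed auto
  moreover have "max 0 (ln (norm (t - c) / \<rho>)) = L" using L unfolding L_def T_def by (simp only: max_def) simp
  ultimately show ?thesis by (simp only:)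
qed

text \<open>The unit circle in every complex direction suffices: a circle of any centre and radius
  on a line is a unit circle for another base point and direction, see
  \<open>cmean_line\<close>.\<close>

definition cpsh :: "(complex^'n \<Rightarrow> real) \<Rightarrow> bool" where
  "cpsh f \<longleftrightarrow> continuous_on UNIV f \<and> (\<forall>a b. f a \<le> cmean (\<lambda>t. f (a + t *s b)) 0 1)"

lemma continuous_on_line:
  fixes f :: "complex^'n \<Rightarrow> 'b::topological_space"
  assumes "continuous_on UNIV f" 
  shows "continuous_on A (\<lambda>t. f (a + t *s b))"
proof -
  have "continuous_on A (\<lambda>t::complex. \<chi> i. a $ i + t * b $ i)"
    by (intro continuous_on_vec_lambda continuous_intros)
  moreover have "(\<lambda>t. \<chi> i. a $ i + t * b $ i) = (\<lambda>t. a + t *s b)"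
    by (auto simp: vec_eq_iff)
  ultimately have "continuous_on A (\<lambda>t. a + t *s b)" by (simp only:)
  then show ?thesis by (rule continuous_on_compose2[OF assms]) auto
qed

lemma cmean_line:
  "cmean (\<lambda>t. f (a + t *s b)) c r = cmean (\<lambda>t. f ((a + c *s b) + t *s (of_real r *s b))) 0 1"
proof -
  have "a + (c + complex_of_real r * cis \<theta>) *s b = a + c *s b + cis \<theta> *s (of_real r *s b)" for \<theta>
    by (simp add: vec_eq_iff algebra_simps)
  then show ?thesis unfolding cmean_def by (simp only: add_0_left of_real_1 mult_1_left)
qed

lemma cpsh_imp_psh:
  assumes "cpsh f"
  shows "psh_on UNIV (\<lambda>z. ereal (f z))"
proof -
  have cont: "continuous_on UNIV f" using assms by (simp add: cpsh_def)
  have usc: "usc_on UNIV (\<lambda>x. ereal (k x))" if "continuous_on UNIV k" for k :: "'x::topological_space \<Rightarrow> real"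
    unfolding usc_on_UNIV
  proof
    fix c
    have "open ((\<lambda>x. ereal (k x)) -` {..<c})"
      using that by (intro open_vimage continuous_intros) auto
    then show "open {z. ereal (k z) < c}" by (simp add: vimage_def)
  qed
  have "subharmonic_on UNIV (\<lambda>t. ereal (f (a + t *s b)))" for a b
  proof -
    have c: "continuous_on A (\<lambda>t. f (a + t *s b))" for A by (rule continuous_on_line[OF cont])
    have "ereal (f (a + c *s b)) \<le> circle_mean (\<lambda>t. ereal (f (a + t *s b))) c r" for c r
      unfolding circle_mean_real(1)[OF c] cmean_line[of f a b c r] ereal_less_eq(3)
      using assms unfolding cpsh_def by blast
    then show ?thesis using usc[OF c] by (simp add: subharmonic_on_def)
  qed
  then show ?thesis using usc[OF cont] by (simp add: psh_on_def)
qed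

lemma cpsh_continuous: "cpsh f \<Longrightarrow> continuous_on A f"
  using continuous_on_subset by (auto simp: cpsh_def)

lemma cpsh_const: "cpsh (\<lambda>z. c)"
  by (simp add: cpsh_def)

lemma cpsh_add:
  assumes "cpsh f" "cpsh g"
  shows "cpsh (\<lambda>z. f z + g z)"
proof -
  have "f a + g a \<le> cmean (\<lambda>t. f (a + t *s b)) 0 1 + cmean (\<lambda>t. g (a + t *s b)) 0 1" for a b
    using assms by (intro add_mono) (auto simp: cpsh_def)
  then show ?thesis using assms
    by (auto simp: cpsh_def cmean_add continuous_on_line intro: continuous_on_add)
qed

lemma cpsh_cmult:
  assumes "cpsh f" "c \<ge> 0"
  shows "cpsh (\<lambda>z. c * f z)"
  using assms by (auto simp: cpsh_def cmean_cmult intro!: continuous_intros mult_left_mono)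

text \<open>A smoothing of the logarithm of the distance to p in the coordinates I. All coordinates
  are used for the weight, a single one for the logarithmic poles of the competitor.\<close>

definition logreg :: "real \<Rightarrow> 'n set \<Rightarrow> complex^'n \<Rightarrow> complex^'n \<Rightarrow> real" where
  "logreg e I p z = ln (e^2 + (\<Sum>i\<in>I. (norm (z $ i - p $ i))^2)) / 2"

text \<open>On a circle the argument of the logarithm is A + B + 2 Re (q e^(i \<theta>)), so
  \<open>mean_ln_trig\<close> gives its mean explicitly. Cauchy-Schwarz in the form |q|^2 \<le> (A -
  e^2) B yields both the positivity needed there and that the larger root is at least A.\<close>

lemma cpsh_logreg:
  fixes p :: "complex^'n"
  assumes e: "e \<noteq> 0"
  shows "cpsh (logreg e I p)"
proof -
  have pos: "e^2 + (\<Sum>i\<in>I. (norm (z $ i - p $ i))^2) > 0" for z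
    using e by (intro add_pos_nonneg sum_nonneg) auto
  have fin: "finite I" by simp
  have cont: "continuous_on UNIV (logreg e I p)"
    unfolding logreg_def by (intro continuous_intros ballI) (use pos in \<open>simp_all add: less_imp_neq[THEN not_sym]\<close>)
  have "logreg e I p a \<le> cmean (\<lambda>t. logreg e I p (a + t *s b)) 0 1" for a b
  proof -
    define d where "d = a - p"
    define A where "A = e^2 + (\<Sum>i\<in>I. (norm (d $ i))^2)"
    define B where "B = (\<Sum>i\<in>I. (norm (b $ i))^2)"
    define q where "q = (\<Sum>i\<in>I. cnj (d $ i) * b $ i)"
    have AB: "A > 0" "B \<ge> 0" using pos[of a] by (auto simp: A_def B_def d_def sum_nonneg)
    have nq: "(norm q)^2 \<le> (A - e^2) * B"
    proof -
      have "norm q \<le> (\<Sum>i\<in>I. norm (d $ i) * norm (b $ i))"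
        unfolding q_def by (rule order_trans[OF norm_sum]) (simp add: norm_mult)
      then have "(norm q)^2 \<le> (\<Sum>i\<in>I. norm (d $ i) * norm (b $ i))^2" by (intro power_mono) auto
      also have "\<dots> \<le> (A - e^2) * B" unfolding A_def B_def
        using Cauchy_Schwarz_ineq_sum[of "\<lambda>i. norm (d $ i)" "\<lambda>i. norm (b $ i)" I] by (simp only: add_diff_cancel_left')
      finally show ?thesis .
    qed
    have e2: "e^2 > 0" using e by simp
    have "(2 * norm q)^2 \<le> 4 * ((A - e^2) * B)" using nq by (simp add: power_mult_distrib)
    also have "\<dots> < (A + B)^2"
    proof -
      have "(A + B)^2 - 4 * ((A - e^2) * B) = (A - B)^2 + 4 * e^2 * B" by (simp add: power2_eq_square algebra_simps)
      moreover have "\<dots> > 0"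
      proof (cases "B = 0")
        case True then show ?thesis using AB by simp
      next
        case False then show ?thesis using AB e2 by (intro add_nonneg_pos) auto
      qed
      ultimately show ?thesis by linarith
    qed
    finally have P: "2 * norm q < A + B" using AB by (rule_tac power2_less_imp_less) auto
    have eq: "logreg e I p (a + cis \<theta> *s b) = ln ((A + B) + 2 * Re (q * cis \<theta>)) / 2" for \<theta>
    proof -
      have n: "(norm (x + cis \<theta> * y))^2 = (norm x)^2 + (norm y)^2 + 2 * Re (cnj x * y * cis \<theta>)" for x y :: complex
      proof -
        have "(norm (x + u))^2 = (norm x)^2 + (norm u)^2 + 2 * Re (cnj x * u)" for u
          unfolding cmod_power2 by (simp add: power2_eq_square algebra_simps)
        from this[of "cis \<theta> * y"] show ?thesis by (simp add: norm_mult mult_ac)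
      qed
      have "(\<Sum>i\<in>I. (norm ((a + cis \<theta> *s b) $ i - p $ i))^2) = (\<Sum>i\<in>I. (norm (d $ i + cis \<theta> * b $ i))^2)"
        by (intro sum.cong) (auto simp: d_def algebra_simps)
      also have "\<dots> = (\<Sum>i\<in>I. (norm (d $ i))^2) + B + (\<Sum>i\<in>I. 2 * Re (cnj (d $ i) * b $ i * cis \<theta>))"
        by (simp only: n sum.distrib B_def)
      also have "(\<Sum>i\<in>I. 2 * Re (cnj (d $ i) * b $ i * cis \<theta>)) = 2 * Re (q * cis \<theta>)"
        by (simp only: q_def sum_distrib_left[symmetric] Re_sum[symmetric] sum_distrib_right[symmetric])
      finally show ?thesis unfolding logreg_def A_def by (simp only: add.assoc)
    qed
    have "cmean (\<lambda>t. logreg e I p (a + t *s b)) 0 1 = ln (((A + B) + sqrt ((A + B)^2 - 4 * (norm q)^2)) / 2) / 2"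
      unfolding cmean_def using integral_unique[OF mean_ln_trig[OF P]] by (simp add: eq)
    also have "\<dots> \<ge> ln A / 2"
    proof -
      have "(A - B)^2 \<le> (A + B)^2 - 4 * (norm q)^2"
      proof -
        have "(A + B)^2 - (A - B)^2 = 4 * (A * B)" by (simp add: power2_eq_square algebra_simps)
        moreover have "(A - e^2) * B = A * B - e^2 * B" by (simp add: algebra_simps)
        moreover have "e^2 * B \<ge> 0" using e2 AB by simp
        ultimately show ?thesis using nq by linarith
      qed
      then have "\<bar>A - B\<bar> \<le> sqrt ((A + B)^2 - 4 * (norm q)^2)" by (intro real_le_rsqrt) simp
      then have "A - B \<le> sqrt ((A + B)^2 - 4 * (norm q)^2)" by (rule abs_le_D1)
      then have "A \<le> ((A + B) + sqrt ((A + B)^2 - 4 * (norm q)^2)) / 2" by (simp add: field_simps)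
      then show ?thesis using AB by simp
    qed
    finally show ?thesis by (simp add: logreg_def A_def d_def)
  qed
  then show ?thesis using cont by (simp add: cpsh_def)
qed

section \<open>Lelong classes\<close>

text \<open>The difficulty is additivity of a mean that is defined through positive and negative
  parts. Unless v c = -\<infinity>, v turns out to be integrable on the circle, and real integration
  applies.\<close>

lemma subharmonic_add_continuous:
  assumes v: "subharmonic_on UNIV v" and k: "continuous_on UNIV k" and l: "l > 0" and r: "r > 0"
    and kc: "k c \<le> cmean k c r"
  shows "ereal (k c) + ereal l * v c \<le> circle_mean (\<lambda>z. ereal (k z) + ereal l * v z) c r"
proof (cases "v c = -\<infinity>")
  case True
  then show ?thesis using l by simp
next
  case False
  define G where "G = (\<lambda>\<theta>. v (c + of_real r * cis \<theta>))"
  have vfin: "v z < \<infinity>" and opn: "open {z. v z < a}" for z a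
    using v by (auto simp: subharmonic_on_def usc_on_UNIV)
  have Gm: "G \<in> borel_measurable borel"
  proof (rule borel_measurableI_less)
    fix a
    have "open ((\<lambda>\<theta>. c + of_real r * cis \<theta>) -` {z. v z < a})"
      by (intro open_vimage opn continuous_intros)
    then show "{\<theta> \<in> space borel. G \<theta> < a} \<in> sets borel" by (simp add: G_def vimage_def)
  qed
  have "\<exists>x\<in>sphere c r. \<forall>y\<in>sphere c r. v y \<le> v x"
  proof (rule usc_attains_max)
    show "sphere c r \<noteq> {}" using r by simp
    show "openin (top_of_set (sphere c r)) {x \<in> sphere c r. v x < a}" for a
      using opn[of a] openin_open_Int[of "{z. v z < a}" "sphere c r"] by (simp add: Int_def)
  qed auto
  then obtain x where x: "\<And>y. y \<in> sphere c r \<Longrightarrow> v y \<le> v x" by blast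
  obtain B where B: "v x \<le> ereal B" using vfin[of x] by (cases "v x") auto
  have GB: "G \<theta> \<le> ereal B" for \<theta>
    unfolding G_def by (rule order_trans[OF x B]) (use r in \<open>simp add: dist_norm norm_mult\<close>)
  define P where "P = (\<integral>\<^sup>+\<theta>\<in>{0..2*pi}. e2ennreal (G \<theta>) \<partial>lborel)"
  define N where "N = (\<integral>\<^sup>+\<theta>\<in>{0..2*pi}. e2ennreal (- G \<theta>) \<partial>lborel)"
  have "P \<le> (\<integral>\<^sup>+\<theta>\<in>{0..2*pi}. ennreal B \<partial>lborel)"
    unfolding P_def by (intro nn_integral_mono mult_right_mono) (use GB e2ennreal_mono in \<open>force simp: ennreal_def\<close>)+
  also have "\<dots> < \<infinity>" by (simp add: nn_integral_cmult ennreal_mult_less_top)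
  finally have P: "P < \<infinity>" .
  have mean: "circle_mean v c r = (enn2ereal P - enn2ereal N) / ereal (2*pi)"
    by (simp add: circle_mean_def P_def N_def G_def)
  have vle: "v c \<le> circle_mean v c r" using v r by (auto simp: subharmonic_on_def)
  \<comment> \<open>The positive part P is finite by semicontinuity, so an infinite negative part
    would make the mean, and with it v c, equal to -\<infinity>.\<close>
  have N: "N < \<infinity>"
  proof (rule ccontr)
    assume "\<not> N < \<infinity>"
    then have "N = \<infinity>" by (metis infinity_ennreal_def top.not_eq_extremum)
    moreover have "enn2ereal P \<noteq> \<infinity>" using P by auto
    ultimately have "circle_mean v c r = -\<infinity>" unfolding mean
      by (cases "enn2ereal P") simp_all
    then show False using vle False by auto
  qed
  have mp: "(\<lambda>x. e2ennreal (G x) * indicator {0..2 * pi} x) \<in> borel_measurable borel"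
    and mn: "(\<lambda>x. e2ennreal (- G x) * indicator {0..2 * pi} x) \<in> borel_measurable borel"
    using Gm by measurable
  define g where "g = (\<lambda>\<theta>. real_of_ereal (G \<theta>))"
  have gm: "g \<in> borel_measurable borel" unfolding g_def by (rule borel_measurable_real_of_ereal[OF Gm])
  have int: "set_integrable lborel {0..2*pi} g"
    unfolding set_integrable_def
  proof (rule integrableI_bounded)
    have "(\<integral>\<^sup>+\<theta>. ennreal (norm (indicator {0..2*pi} \<theta> *\<^sub>R g \<theta>)) \<partial>lborel)
        \<le> (\<integral>\<^sup>+\<theta>. (e2ennreal (G \<theta>) * indicator {0..2*pi} \<theta> + e2ennreal (- G \<theta>) * indicator {0..2*pi} \<theta>) \<partial>lborel)"
    proof (rule nn_integral_mono)
      fix \<theta> :: real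
      have "ennreal \<bar>g \<theta>\<bar> \<le> e2ennreal (G \<theta>) + e2ennreal (- G \<theta>)"
      proof (cases "G \<theta>")
        case (real y)
        then show ?thesis by (cases "y \<ge> 0") (auto simp: g_def ennreal_def[symmetric] ennreal_neg abs_if)
      qed (auto simp: g_def)
      then show "ennreal (norm (indicator {0..2*pi} \<theta> *\<^sub>R g \<theta>)) \<le>
         e2ennreal (G \<theta>) * indicator {0..2*pi} \<theta> + e2ennreal (- G \<theta>) * indicator {0..2*pi} \<theta>"
        by (simp split: split_indicator)
    qed
    also have "\<dots> = P + N" unfolding P_def N_def by (rule nn_integral_add) (simp_all add: mp mn)
    also have "\<dots> < \<infinity>" using P N by simp
    finally show "(\<integral>\<^sup>+\<theta>. ennreal (norm (indicator {0..2*pi} \<theta> *\<^sub>R g \<theta>)) \<partial>lborel) < \<infinity>" .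
  qed (use gm in \<open>simp add: borel_measurable_times\<close>)
  have AE: "AE \<theta> in lborel. \<theta> \<in> {0..2*pi} \<longrightarrow> G \<theta> = ereal (g \<theta>)"
  proof -
    have "AE \<theta> in lborel. e2ennreal (- G \<theta>) * indicator {0..2*pi} \<theta> \<noteq> \<infinity>"
      using N unfolding N_def by (intro nn_integral_noteq_infinite) (simp_all add: mn)
    then show ?thesis
    proof eventually_elim
      case (elim \<theta>)
      show ?case
      proof
        assume "\<theta> \<in> {0..2*pi}"
        then have "e2ennreal (- G \<theta>) \<noteq> \<infinity>" using elim by simp
        then have "G \<theta> \<noteq> -\<infinity>" by (auto simp: e2ennreal_infty)
        moreover have "G \<theta> \<noteq> \<infinity>" using GB[of \<theta>] by auto
        ultimately show "G \<theta> = ereal (g \<theta>)" by (cases "G \<theta>") (auto simp: g_def)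
      qed
    qed
  qed
  have m1: "circle_mean v c r = ereal (integral {0..2*pi} g / (2*pi))"
    by (rule circle_mean_eq_real[OF int]) (use AE in \<open>simp add: G_def\<close>)
  have ki: "set_integrable lborel {0..2*pi} (\<lambda>\<theta>. k (c + of_real r * cis \<theta>))"
    by (intro borel_integrable_atLeastAtMost' continuous_on_compose2[OF k] continuous_intros) auto
  have lg: "set_integrable lborel {0..2*pi} (\<lambda>\<theta>. l * g \<theta>)" using int by simp
  have int2: "set_integrable lborel {0..2*pi} (\<lambda>\<theta>. k (c + of_real r * cis \<theta>) + l * g \<theta>)"
    by (intro set_integral_add(1) ki lg)
  have m2: "circle_mean (\<lambda>z. ereal (k z) + ereal l * v z) c r =
      ereal (integral {0..2*pi} (\<lambda>\<theta>. k (c + of_real r * cis \<theta>) + l * g \<theta>) / (2*pi))"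
  proof (rule circle_mean_eq_real[OF int2])
    show "AE \<theta> in lborel. \<theta> \<in> {0..2*pi} \<longrightarrow>
       ereal (k (c + of_real r * cis \<theta>)) + ereal l * v (c + of_real r * cis \<theta>) =
       ereal (k (c + of_real r * cis \<theta>) + l * g \<theta>)"
      using AE by eventually_elim (auto simp: G_def)
  qed
  have "integral {0..2*pi} (\<lambda>\<theta>. k (c + of_real r * cis \<theta>) + l * g \<theta>) =
     integral {0..2*pi} (\<lambda>\<theta>. k (c + of_real r * cis \<theta>)) + l * integral {0..2*pi} g"
    using set_borel_integral_eq_integral(1)[OF ki] set_borel_integral_eq_integral(1)[OF lg]
    by (simp add: integral_add)
  then have m2': "circle_mean (\<lambda>z. ereal (k z) + ereal l * v z) c r =
      ereal (cmean k c r + l * (integral {0..2*pi} g / (2*pi)))"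
    unfolding m2 by (simp add: cmean_def add_divide_distrib)
  obtain y where y: "v c = ereal y" using False vfin[of c] by (cases "v c") auto
  then have "y \<le> integral {0..2*pi} g / (2*pi)" using vle m1 by simp
  then have "k c + l * y \<le> cmean k c r + l * (integral {0..2*pi} g / (2*pi))"
    using kc l by (intro add_mono mult_left_mono) auto
  then show ?thesis unfolding m2' y by simp
qed

lemma psh_add_cpsh:
  fixes f :: "complex^'n \<Rightarrow> real"
  assumes u: "psh_on UNIV u" and f: "cpsh f" and l: "l > 0"
  shows "psh_on UNIV (\<lambda>z. ereal (f z) + ereal l * u z)"
proof -
  have usc: "usc_on UNIV (\<lambda>x. ereal (k x) + ereal l * w x)"
    if w: "usc_on UNIV w" and k: "continuous_on UNIV k" for k and w :: "'x::topological_space \<Rightarrow> ereal"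
  proof -
    have "open {x. ereal l * w x < c}" for c
    proof -
      have "ereal l * w x < c \<longleftrightarrow> w x < c / ereal l" for x
        using l by (simp add: ereal_less_divide_pos mult.commute)
      then show ?thesis using w by (simp add: usc_on_UNIV)
    qed
    from usc_add_continuous[OF this k] show ?thesis
      by (simp add: usc_on_UNIV add.commute)
  qed
  have cont: "continuous_on UNIV f" using f by (rule cpsh_continuous)
  have fin: "ereal (f z) + ereal l * u z < \<infinity>" for z
    using u l by (cases "u z") (auto simp: psh_on_def dest!: bspec[of _ _ z])
  have "subharmonic_on UNIV (\<lambda>t. ereal (f (a + t *s b)) + ereal l * u (a + t *s b))" for a b
  proof -
    have s: "subharmonic_on UNIV (\<lambda>t. u (a + t *s b))" using u by (simp add: psh_on_def)
    have c: "continuous_on UNIV (\<lambda>t. f (a + t *s b))" by (rule continuous_on_line[OF cont])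
    have "f (a + c *s b) \<le> cmean (\<lambda>t. f (a + t *s b)) c r" for c r
      unfolding cmean_line[of f a b c r] using f unfolding cpsh_def by blast
    then show ?thesis
      using subharmonic_add_continuous[OF s c l] usc[OF _ c, of "\<lambda>t. u (a + t *s b)"] s fin
      by (simp add: subharmonic_on_def)
  qed
  then show ?thesis using usc[OF _ cont] u fin by (simp add: psh_on_def)
qed

section \<open>Growth along complex lines and Bernstein-Walsh estimates in several variables\<close>

lemma log_plus_nonneg: "x \<ge> 0 \<Longrightarrow> log_plus x \<ge> 0"
  by (simp add: log_plus_def)

lemma log_plus_le: "x \<ge> 0 \<Longrightarrow> log_plus x \<le> ln (1 + x)"
  by (auto simp: log_plus_def)

lemma lelong_line_growth:
  fixes u :: "complex^'n \<Rightarrow> ereal"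
  assumes u: "u \<in> lelong \<delta>" and \<delta>: "\<delta> \<ge> 0"
  shows "\<exists>C. \<forall>t. u (a + t *s b) \<le> ereal (\<delta> * ln (1 + norm t) + C)"
proof -
  obtain C where C: "\<And>z. u z \<le> ereal (\<delta> * log_plus (norm z) + C)" using u by (auto simp: lelong_def)
  define A where "A = 1 + norm a + norm b"
  have A: "A > 0" by (simp add: A_def add_pos_nonneg)
  have "u (a + t *s b) \<le> ereal (\<delta> * ln (1 + norm t) + (\<delta> * ln A + C))" for t
  proof -
    have "norm (t *s b) = norm t * norm b"
      by (simp add: norm_vec_def L2_set_right_distrib norm_mult)
    then have "norm (a + t *s b) \<le> norm a + norm t * norm b"
      using norm_triangle_ineq[of a "t *s b"] by simp
    moreover have "(1 + norm t) * A = 1 + norm a + norm b + norm t + norm t * norm a + norm t * norm b"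
      by (simp add: A_def algebra_simps)
    moreover have "0 \<le> norm t * norm a" by simp
    ultimately have "1 + norm (a + t *s b) \<le> (1 + norm t) * A"
      using norm_ge_zero[of t] norm_ge_zero[of b] by linarith
    then have "ln (1 + norm (a + t *s b)) \<le> ln ((1 + norm t) * A)"
      by (intro ln_mono) (auto simp: add_pos_nonneg)
    also have "\<dots> = ln (1 + norm t) + ln A" using A by (intro ln_mult_pos) (auto simp: add_pos_nonneg)
    finally have "log_plus (norm (a + t *s b)) \<le> ln (1 + norm t) + ln A"
      using log_plus_le[of "norm (a + t *s b)"] by simp
    then have "\<delta> * log_plus (norm (a + t *s b)) \<le> \<delta> * (ln (1 + norm t) + ln A)" using \<delta> by (rule mult_left_mono)
    then have "ereal (\<delta> * log_plus (norm (a + t *s b)) + C) \<le> ereal (\<delta> * ln (1 + norm t) + (\<delta> * ln A + C))"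
      by (simp add: algebra_simps)
    then show ?thesis using C order_trans by blast
  qed
  then show ?thesis by blast
qed

lemma lelong_subharmonic_line: "u \<in> lelong \<delta> \<Longrightarrow> subharmonic_on UNIV (\<lambda>t. u (a + t *s b))"
  by (simp add: lelong_def psh_on_def)

lemma lelong_bernstein_walsh_line:
  fixes u :: "complex^'n \<Rightarrow> ereal"
  assumes u: "u \<in> lelong \<delta>" and \<delta>: "\<delta> \<ge> 0" and \<rho>: "\<rho> > 0"
    and M: "\<And>t. t \<in> cball c \<rho> \<Longrightarrow> u (a + t *s b) \<le> ereal M"
  shows "u (a + t *s b) \<le> ereal (M + \<delta> * max 0 (ln (norm (t - c) / \<rho>)))"
proof -
  obtain C where C: "\<And>t. u (a + t *s b) \<le> ereal (\<delta> * ln (1 + norm t) + C)"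
    using lelong_line_growth[OF u \<delta>, of a b] by blast
  show ?thesis by (rule bernstein_walsh[OF lelong_subharmonic_line[OF u] \<rho> \<delta> C M])
qed

text \<open>The one-variable estimate is applied to one coordinate after the other. Coordinates
  outside I stay frozen at z, so polydiscs inside a fibre of K can be used as well as full
  ones.\<close>

lemma lelong_bernstein_walsh_polydisc:
  fixes u :: "complex^'n \<Rightarrow> ereal"
  assumes u: "u \<in> lelong \<delta>" and \<delta>: "\<delta> \<ge> 0" and fin: "finite I"
    and \<rho>: "\<And>i. i \<in> I \<Longrightarrow> \<rho> i > 0"
    and M: "\<And>w. (\<And>i. i \<in> I \<Longrightarrow> norm (w $ i - c i) \<le> \<rho> i) \<Longrightarrow> (\<And>i. i \<notin> I \<Longrightarrow> w $ i = z $ i) \<Longrightarrow> u w \<le> ereal M"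
  shows "u z \<le> ereal (M + \<delta> * (\<Sum>i\<in>I. max 0 (ln (norm (z $ i - c i) / \<rho> i))))"
  using fin \<rho> M
proof (induction I arbitrary: z rule: finite_induct)
  case empty
  have "u z \<le> ereal M" by (rule empty) auto
  then show ?case by simp
next
  case (insert j I)
  define S where "S = M + \<delta> * (\<Sum>i\<in>I. max 0 (ln (norm (z $ i - c i) / \<rho> i)))"
  define a where "a = z - (z $ j) *s axis j 1"
  have co: "(a + t *s axis j 1) $ i = (if i = j then t else z $ i)" for t i
    by (simp add: a_def axis_def)
  have zj: "z = a + (z $ j) *s axis j 1" by (simp add: a_def)
  have "u (a + t *s axis j 1) \<le> ereal S" if t: "t \<in> cball (c j) (\<rho> j)" for t
  proof -
    have "u (a + t *s axis j 1) \<le> ereal (M + \<delta> * (\<Sum>i\<in>I. max 0 (ln (norm ((a + t *s axis j 1) $ i - c i) / \<rho> i))))"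
    proof (rule insert.IH)
      fix w assume w: "\<And>i. i \<in> I \<Longrightarrow> norm (w $ i - c i) \<le> \<rho> i" "\<And>i. i \<notin> I \<Longrightarrow> w $ i = (a + t *s axis j 1) $ i"
      have "w $ j = t" using w(2)[of j] insert.hyps co[of t j] by presburger
      then show "u w \<le> ereal M"
        using w t co by (intro insert.prems(2)) (auto simp: dist_norm norm_minus_commute simp del: vector_add_component vector_smult_component)
    qed (use insert.prems in auto)
    also have "(\<Sum>i\<in>I. max 0 (ln (norm ((a + t *s axis j 1) $ i - c i) / \<rho> i))) = (\<Sum>i\<in>I. max 0 (ln (norm (z $ i - c i) / \<rho> i)))"
      using insert.hyps co by (intro sum.cong refl) (auto simp del: vector_add_component vector_smult_component)
    finally show ?thesis by (simp add: S_def)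
  qed
  from lelong_bernstein_walsh_line[OF u \<delta> _ this, where t = "z $ j"] insert.prems(1)[of j]
  have "u z \<le> ereal (S + \<delta> * max 0 (ln (norm (z $ j - c j) / \<rho> j)))"
    unfolding zj[symmetric] by simp
  also have "S + \<delta> * max 0 (ln (norm (z $ j - c j) / \<rho> j)) = M + \<delta> * (\<Sum>i\<in>insert j I. max 0 (ln (norm (z $ i - c i) / \<rho> i)))"
    using insert.hyps by (simp add: S_def algebra_simps)
  finally show ?case .
qed

section \<open>Smooth functions of one real variable\<close>

primrec dk :: "nat \<Rightarrow> (real \<Rightarrow> real) \<Rightarrow> bool" where
  "dk 0 f \<longleftrightarrow> continuous_on UNIV f"
| "dk (Suc k) f \<longleftrightarrow> (\<exists>f'. (\<forall>x. (f has_real_derivative f' x) (at x)) \<and> dk k f')"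

lemma dk_SucI: "(\<And>x. (f has_real_derivative f' x) (at x)) \<Longrightarrow> dk k f' \<Longrightarrow> dk (Suc k) f"
  by auto

lemma DERIV_imp_continuous_on:
  fixes f :: "real \<Rightarrow> real"
  shows "(\<And>x. (f has_real_derivative f' x) (at x)) \<Longrightarrow> continuous_on UNIV f"
  by (rule continuous_at_imp_continuous_on) (use DERIV_isCont in blast)

lemma dk_Suc_imp: "dk (Suc k) f \<Longrightarrow> dk k f"
proof (induction k arbitrary: f)
  case 0
  then show ?case using DERIV_imp_continuous_on by auto
next
  case (Suc k)
  then obtain f' where "\<forall>x. (f has_real_derivative f' x) (at x)" "dk (Suc k) f'" by auto
  then show ?case using Suc.IH by auto
qed

lemma dk_const: "dk k (\<lambda>x. c)"
  by (induction k arbitrary: c) (auto intro!: exI[of _ "\<lambda>x. 0"])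

lemma dk_ident: "dk k (\<lambda>x. x)"
  by (cases k) (auto intro!: exI[of _ "\<lambda>x. 1"] dk_const)

lemma dk_add: "dk k f \<Longrightarrow> dk k g \<Longrightarrow> dk k (\<lambda>x. f x + g x)"
proof (induction k arbitrary: f g)
  case 0
  then show ?case by (auto intro: continuous_on_add)
next
  case (Suc k)
  then obtain f' g' where "\<forall>x. (f has_real_derivative f' x) (at x)" "dk k f'"
    "\<forall>x. (g has_real_derivative g' x) (at x)" "dk k g'" by auto
  then show ?case using Suc.IH[of f' g']
    by (intro dk_SucI[of _ "\<lambda>x. f' x + g' x"] DERIV_add) auto
qed

lemma dk_mult: "dk k f \<Longrightarrow> dk k g \<Longrightarrow> dk k (\<lambda>x. f x * g x)"
proof (induction k arbitrary: f g)
  case 0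
  then show ?case by (auto intro: continuous_on_mult)
next
  case (Suc k)
  then obtain f' g' where d: "\<forall>x. (f has_real_derivative f' x) (at x)" "dk k f'"
    "\<forall>x. (g has_real_derivative g' x) (at x)" "dk k g'" by auto
  have "dk k (\<lambda>x. f' x * g x + g' x * f x)"
    by (intro dk_add Suc.IH d dk_Suc_imp[OF Suc.prems(1)] dk_Suc_imp[OF Suc.prems(2)])
  then show ?case using d
    by (intro dk_SucI[of _ "\<lambda>x. f' x * g x + g' x * f x"] DERIV_mult) auto
qed

lemma dk_inverse: "dk k f \<Longrightarrow> (\<And>x. f x \<noteq> 0) \<Longrightarrow> dk k (\<lambda>x. inverse (f x))"
proof (induction k)
  case 0
  then show ?case by (auto intro: continuous_on_inverse)
next
  case (Suc k)
  then obtain f' where d: "\<forall>x. (f has_real_derivative f' x) (at x)" "dk k f'" by auto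
  have i: "dk k (\<lambda>x. inverse (f x))" using Suc dk_Suc_imp by blast
  have "dk k (\<lambda>x. (- 1) * (inverse (f x) * f' x * inverse (f x)))"
    by (intro dk_mult dk_const i d)
  moreover have "((\<lambda>x. inverse (f x)) has_real_derivative (- 1) * (inverse (f x) * f' x * inverse (f x))) (at x)" for x
    using DERIV_inverse'[of f "f' x" x UNIV] d Suc.prems by simp
  ultimately show ?case by (intro dk_SucI)
qed

lemma dk_affine: "dk k f \<Longrightarrow> dk k (\<lambda>x. f (a * x + b))"
proof (induction k arbitrary: f)
  case 0
  then show ?case by (auto intro!: continuous_on_compose2[of UNIV f] continuous_intros)
next
  case (Suc k)
  then obtain f' where d: "\<forall>x. (f has_real_derivative f' x) (at x)" "dk k f'" by auto
  have "dk k (\<lambda>x. f' (a * x + b) * a)" by (intro dk_mult dk_const Suc.IH d)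
  moreover have "((\<lambda>x. f (a * x + b)) has_real_derivative f' (a * x + b) * a) (at x)" for x
  proof -
    have "((\<lambda>x. a * x + b) has_real_derivative a) (at x)" by (auto intro!: derivative_eq_intros)
    then show ?thesis using DERIV_chain2[of f "f' (a * x + b)" "\<lambda>x. a * x + b" x a UNIV] d by blast
  qed
  ultimately show ?case by (intro dk_SucI)
qed

text \<open>The flat function exp (-1/x) with extra powers of 1/x. The index m makes the family
  closed under differentiation up to linear combinations, so smoothness is an induction.\<close>

definition expfl :: "nat \<Rightarrow> real \<Rightarrow> real" where
  "expfl m x = (if x > 0 then (1/x)^m * exp (- (1/x)) else 0)"

text \<open>A single term of the exponential series at 1/x. The quadratic bound is what makes the
  derivative at 0 vanish.\<close>

lemma expfl_bound: "\<bar>expfl m x\<bar> \<le> fact (m + 2) * x^2"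
proof (cases "x > 0")
  case True
  define y where "y = 1/x"
  have y: "y > 0" "x = 1/y" using True by (auto simp: y_def)
  have "(\<Sum>n\<in>{m+2}. y^n /\<^sub>R fact n) \<le> (\<Sum>n. y^n /\<^sub>R fact n)"
    by (rule sum_le_suminf[OF summable_exp_generic]) (use y in auto)
  then have "y^(m+2) / fact (m+2) \<le> exp y" by (simp add: exp_def divide_inverse_commute)
  then have "y^m * y^2 \<le> fact (m+2) * exp y"
    by (simp add: pos_divide_le_eq power_add mult_ac power2_eq_square del: fact_Suc)
  then have "y^m * exp (- y) \<le> fact (m+2) * (1/y)^2"
    using y by (simp add: exp_minus divide_simps mult_ac del: fact_Suc)
  moreover have "expfl m x = y^m * exp (- y)" using True by (simp add: expfl_def y_def)
  ultimately show ?thesis using y by simp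
next
  case False
  then show ?thesis by (simp add: expfl_def)
qed

lemma expfl_deriv: "(expfl m has_real_derivative (expfl (m+2) x - m * expfl (m+1) x)) (at x)"
proof -
  consider "x > 0" | "x < 0" | "x = 0" by linarith
  then show ?thesis
  proof cases
    case 1
    have "((\<lambda>x. (1/x)^m * exp (- (1/x))) has_real_derivative (expfl (m+2) x - m * expfl (m+1) x)) (at x)"
    proof -
      have d: "((\<lambda>x. (1/x)^m * exp (- (1/x))) has_real_derivative
          ((real m * (1/x)^(m-1) * (- ((1/x)^2))) * exp (- (1/x)) + (exp (- (1/x)) * (1/x)^2) * (1/x)^m)) (at x)"
        using 1 by (auto intro!: derivative_eq_intros simp: power2_eq_square)
      have "real m * (1/x)^(m-1) * (1/x)^2 = real m * (1/x)^(m+1)"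
        by (cases m) (auto simp: power2_eq_square)
      then have "(real m * (1/x)^(m-1) * (- ((1/x)^2))) * exp (- (1/x)) + (exp (- (1/x)) * (1/x)^2) * (1/x)^m
          = (1/x)^(m+2) * exp (- (1/x)) - real m * ((1/x)^(m+1) * exp (- (1/x)))"
        by (simp only: mult_minus_right mult_minus_left power_add mult_ac)
      then show ?thesis using d 1 by (simp only: expfl_def if_True)
    qed
    then show ?thesis
      by (rule has_field_derivative_transform_within[OF _ 1]) (auto simp: expfl_def dist_real_def)
  next
    case 2
    have "((\<lambda>x. 0) has_real_derivative (expfl (m+2) x - m * expfl (m+1) x)) (at x)"
      using 2 by (simp add: expfl_def)
    then show ?thesis
      by (rule has_field_derivative_transform_within[where d = "-x"]) (use 2 in \<open>auto simp: expfl_def dist_real_def\<close>)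
  next
    case 3
    have "((\<lambda>h. (expfl m (0 + h) - expfl m 0) / h) \<longlongrightarrow> 0) (at 0)"
    proof (rule Lim_null_comparison)
      show "\<forall>\<^sub>F h in at 0. norm ((expfl m (0 + h) - expfl m 0) / h) \<le> fact (m + 2) * \<bar>h\<bar>"
      proof (rule eventually_mono[OF eventually_at_ball'[of 1]])
        fix h :: real assume "h \<in> ball 0 1 \<and> h \<noteq> 0 \<and> h \<in> UNIV"
        then show "norm ((expfl m (0 + h) - expfl m 0) / h) \<le> fact (m + 2) * \<bar>h\<bar>"
          using expfl_bound[of m h] by (simp add: expfl_def[of m 0] divide_le_eq power2_eq_square abs_mult mult.assoc)
      qed auto
      show "((\<lambda>h. fact (m + 2) * \<bar>h\<bar>) \<longlongrightarrow> 0) (at (0::real))" by (auto intro!: tendsto_eq_intros)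
    qed
    then show ?thesis using 3 by (simp add: DERIV_def expfl_def)
  qed
qed

lemma dk_expfl: "dk k (expfl m)"
proof (induction k arbitrary: m)
  case 0
  show ?case using DERIV_imp_continuous_on[OF expfl_deriv] by simp
next
  case (Suc k)
  have "dk k (\<lambda>x. expfl (m+2) x + (- real m) * expfl (m+1) x)"
    by (intro dk_add dk_mult dk_const Suc)
  then show ?case using expfl_deriv[of m] by (intro dk_SucI[of _ "\<lambda>x. expfl (m+2) x - real m * expfl (m+1) x"]) auto
qed

lemma expfl_nonneg: "expfl m x \<ge> 0" by (simp add: expfl_def)

lemma expfl0_pos: "x > 0 \<Longrightarrow> expfl 0 x > 0" by (simp add: expfl_def)

lemma expfl0_mono: "x \<le> y \<Longrightarrow> expfl 0 x \<le> expfl 0 y"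
  by (auto simp: expfl_def frac_le)

definition smstep :: "real \<Rightarrow> real \<Rightarrow> real \<Rightarrow> real" where
  "smstep a b x = expfl 0 (x - a) * inverse (expfl 0 (x - a) + expfl 0 (b - x))"

context
  fixes a b :: real assumes ab: "a < b"
begin

lemma smstep_denom: "expfl 0 (x - a) + expfl 0 (b - x) > 0"
proof (cases "x > a")
  case True then show ?thesis using expfl0_pos[of "x - a"] expfl_nonneg[of 0 "b - x"] by simp
next
  case False then show ?thesis using ab expfl0_pos[of "b - x"] expfl_nonneg[of 0 "x - a"] by simp
qed

lemma dk_smstep: "dk k (smstep a b)"
proof -
  have 1: "dk k (\<lambda>x. expfl 0 (x - a))" using dk_affine[OF dk_expfl, of k 0 1 "-a"] by simp
  have 2: "dk k (\<lambda>x. expfl 0 (b - x))" using dk_affine[OF dk_expfl, of k 0 "-1" b] by simp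
  have "dk k (\<lambda>x. expfl 0 (x - a) * inverse (expfl 0 (x - a) + expfl 0 (b - x)))"
    using smstep_denom by (intro dk_mult dk_inverse dk_add 1 2) (simp add: less_imp_neq[THEN not_sym])
  then show ?thesis by (simp add: smstep_def[abs_def])
qed

lemma smstep_0: "x \<le> a \<Longrightarrow> smstep a b x = 0" by (simp add: smstep_def expfl_def)

lemma smstep_1: "x \<ge> b \<Longrightarrow> smstep a b x = 1"
  using ab expfl0_pos[of "x - a"] by (simp add: smstep_def expfl_def[of 0 "b - x"])

lemma smstep_nonneg: "smstep a b x \<ge> 0" and smstep_le_1: "smstep a b x \<le> 1"
  using smstep_denom[of x] expfl_nonneg[of 0 "x - a"] expfl_nonneg[of 0 "b - x"]
  by (auto simp: smstep_def field_simps)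

lemma smstep_mono: "x \<le> y \<Longrightarrow> smstep a b x \<le> smstep a b y"
proof -
  assume "x \<le> y"
  then have "expfl 0 (x - a) \<le> expfl 0 (y - a)" "expfl 0 (b - y) \<le> expfl 0 (b - x)"
    by (auto intro!: expfl0_mono)
  then have "expfl 0 (x - a) * expfl 0 (b - y) \<le> expfl 0 (y - a) * expfl 0 (b - x)"
    by (intro mult_mono expfl_nonneg)
  then show ?thesis using smstep_denom[of x] smstep_denom[of y]
    by (simp add: smstep_def field_simps)
qed

end

text \<open>The argument s stands for a squared distance. With g' = S / (2 s) and S a nondecreasing
  smooth step from 0 to 1, g is convex as a function of ln s; the last property states this through
  support lines, and \<open>max s (1/4)\<close> appears because g is constant up to 1/4. Convexity
  in the logarithm is what plurisubharmonicity needs.\<close>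

lemma smooth_log_cutoff:
  obtains g :: "real \<Rightarrow> real" where "\<And>k. dk k g" "\<And>s. s \<ge> 1 \<Longrightarrow> g s = ln s / 2" "g 0 \<ge> - ln 2"
    "\<And>s. s \<le> 1/4 \<Longrightarrow> g s = g 0"
    "\<And>s. s > 0 \<Longrightarrow> g s \<ge> ln s / 2" "\<And>s t. s \<le> t \<Longrightarrow> g s \<le> g t"
    "\<And>s0. \<exists>m\<ge>0. \<forall>s. g s \<ge> g s0 + m * (ln (max s (1/4)) / 2 - ln (max s0 (1/4)) / 2)"
proof -
  define S where "S = smstep (1/4) 1"
  \<comment> \<open>A positive smooth function that equals x for x \<ge> 1/4, where S lives;
    dividing by it avoids the singularity at 0.\<close>
  define w where "w = (\<lambda>x. 1 + smstep (1/8) (1/4) x * (x + (-1)))"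
  define G where "G = (\<lambda>x. S x * inverse (2 * w x))"
  have wpos: "w x > 0" for x
  proof (cases "x \<le> 1/8")
    case True then show ?thesis by (simp add: w_def smstep_0)
  next
    case False
    define y where "y = smstep (1/8) (1/4) x"
    have "0 \<le> y" "y \<le> 1" unfolding y_def by (rule smstep_nonneg smstep_le_1; simp)+
    then have "y * (1 - x) < 1"
    proof (cases "x \<ge> 1")
      case True
      then have "y * (1 - x) \<le> 0" using \<open>0 \<le> y\<close> by (intro mult_nonneg_nonpos) auto
      then show ?thesis by simp
    next
      case F: False
      then have "y * (1 - x) \<le> 1 * (1 - x)" using \<open>y \<le> 1\<close> by (intro mult_right_mono) auto
      then show ?thesis using False by simp
    qed
    then show ?thesis by (simp add: w_def y_def[symmetric] algebra_simps)
  qed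
  have wx: "w x = x" if "x \<ge> 1/4" for x using that by (simp add: w_def smstep_1)
  have dkG: "dk k G" for k
  proof -
    have "dk k w" unfolding w_def by (intro dk_add dk_const dk_mult dk_smstep dk_ident) auto
    then show ?thesis unfolding G_def S_def using wpos
      by (intro dk_mult dk_smstep dk_inverse dk_const) (auto simp: less_imp_neq[THEN not_sym])
  qed
  have G0: "G x = 0" if "x \<le> 1/4" for x using that by (simp add: G_def S_def smstep_0)
  have G1: "G x = S x / (2 * x)" if "x \<ge> 1/4" for x using that by (simp add: G_def wx field_simps)
  have contG: "continuous_on A G" for A using dkG[of 0] continuous_on_subset by auto
  define g0 where "g0 = (\<lambda>x. integral {-1..x} G)"
  have g00: "g0 x = 0" if "x \<le> 1/4" for x
  proof -
    have "integral {-1..x} G = integral {-1..x} (\<lambda>_. 0)" by (rule integral_cong) (use G0 that in auto)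
    then show ?thesis by (simp add: g0_def)
  qed
  have dg0: "(g0 has_real_derivative G x) (at x)" for x
  proof (cases "x < 0")
    case True
    have "((\<lambda>x. 0) has_real_derivative G x) (at x)" using True by (simp add: G0)
    then show ?thesis by (rule has_field_derivative_transform_within[where d = "-x"]) (use True in \<open>auto simp: g00 dist_real_def\<close>)
  next
    case False
    have "(g0 has_real_derivative G x) (at x within {-1..x+1})" unfolding g0_def
      by (rule integral_has_real_derivative[OF contG]) (use False in auto)
    then show ?thesis using False by (simp add: at_within_Icc_at)
  qed
  define g where "g = (\<lambda>x. g0 x - g0 1)"
  have dg: "(g has_real_derivative G x) (at x)" for x unfolding g_def
    using DERIV_diff[OF dg0 DERIV_const] by simp
  have S01: "0 \<le> S x" "S x \<le> 1" for x unfolding S_def by (rule smstep_nonneg smstep_le_1; simp)+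
  have Gnn: "G x \<ge> 0" for x using wpos[of x] S01 by (simp add: G_def)
  have mono: "g s \<le> g t" if "s \<le> t" for s t
    by (rule DERIV_nonneg_imp_nondecreasing[OF that]) (use dg Gnn in blast)
  have dln: "((\<lambda>s. m * (ln s / 2)) has_real_derivative m / (2 * s)) (at s)" if "s > 0" for s m
    using that by (auto intro!: derivative_eq_intros simp: field_simps)
  \<comment> \<open>The difference of the two sides has derivative (S x - S s0) / (2 x), which
    changes sign only at s0, so its minimum is at s0.\<close>
  have supp: "g s0 + S s0 * (ln s / 2 - ln s0 / 2) \<le> g s" if s: "s \<ge> 1/4" "s0 \<ge> 1/4" for s s0
  proof -
    define \<phi> where "\<phi> = (\<lambda>s. g s - S s0 * (ln s / 2))"
    have d\<phi>: "(\<phi> has_real_derivative (S x - S s0) / (2 * x)) (at x)" if "x \<ge> 1/4" for x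
    proof -
      have "(\<phi> has_real_derivative G x - S s0 / (2 * x)) (at x)"
        unfolding \<phi>_def using that by (intro DERIV_diff dg dln) auto
      then show ?thesis using that by (simp add: G1 diff_divide_distrib)
    qed
    have "\<phi> s0 \<le> \<phi> s"
    proof (cases "s0 \<le> s")
      case True
      show ?thesis
      proof (rule DERIV_nonneg_imp_nondecreasing[OF True])
        fix x assume x: "s0 \<le> x" "x \<le> s"
        then have "0 \<le> (S x - S s0) / (2 * x)" using s by (intro divide_nonneg_nonneg) (auto simp: S_def intro!: smstep_mono)
        then show "\<exists>y. (\<phi> has_real_derivative y) (at x) \<and> 0 \<le> y" using d\<phi>[of x] x s by auto
      qed
    next
      case False
      then have "s \<le> s0" by simp
      then show ?thesis
      proof (rule DERIV_nonpos_imp_nonincreasing)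
        fix x assume x: "s \<le> x" "x \<le> s0"
        then have "(S x - S s0) / (2 * x) \<le> 0" using s by (intro divide_nonpos_nonneg) (auto simp: S_def intro!: smstep_mono)
        then show "\<exists>y. (\<phi> has_real_derivative y) (at x) \<and> y \<le> 0" using d\<phi>[of x] x s by auto
      qed
    qed
    then show ?thesis by (simp add: \<phi>_def algebra_simps)
  qed
  have gconst: "g s = g (max s (1/4))" for s
    by (cases "s \<le> 1/4") (auto simp: g_def g00 max_def)
  have S1: "S 1 = 1" by (simp add: S_def smstep_1)
  have g1: "g 1 = 0" by (simp add: g_def)
  have ge: "g s \<ge> ln s / 2" if "s \<ge> 1/4" for s
    using supp[of s 1] that S1 g1 by simp
  show ?thesis
  proof (rule that)
    show "dk k g" for k
    proof (cases k)
      case 0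
      then show ?thesis using DERIV_imp_continuous_on[OF dg] by simp
    next
      case (Suc j)
      then show ?thesis using dk_SucI[OF dg dkG[of j]] by simp
    qed
    show "g s = ln s / 2" if "s \<ge> 1" for s
    proof -
      have "S s = 1" using that by (simp add: S_def smstep_1)
      then show ?thesis using supp[of 1 s] ge[of s] that g1 by simp
    qed
    have "ln (1/4) / 2 = - ln (2::real)"
      using ln_realpow[of "2::real" 2] by (simp add: ln_div)
    then show "g 0 \<ge> - ln 2" using ge[of "1/4"] gconst[of 0] by simp
    show "g s = g 0" if "s \<le> 1/4" for s using gconst[of s] gconst[of 0] that by (simp add: max_def)
    show "g s \<ge> ln s / 2" if "s > 0" for s
    proof (cases "s \<ge> 1/4")
      case False
      then have "ln s \<le> ln (1/4)" using that by simp
      then show ?thesis using ge[of "1/4"] gconst[of s] False by (simp add: max_def)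
    qed (use ge in auto)
    show "\<exists>m\<ge>0. \<forall>s. g s \<ge> g s0 + m * (ln (max s (1/4)) / 2 - ln (max s0 (1/4)) / 2)" for s0
    proof (intro exI conjI allI)
      show "S (max s0 (1/4)) \<ge> 0" by (rule S01)
      fix s
      show "g s \<ge> g s0 + S (max s0 (1/4)) * (ln (max s (1/4)) / 2 - ln (max s0 (1/4)) / 2)"
        using supp[of "max s (1/4)" "max s0 (1/4)"] by (simp only: gconst[of s, symmetric] gconst[of s0, symmetric])
    qed
  qed (rule mono)
qed

section \<open>Differentiability classes on normed spaces and radial functions\<close>

lemma Ck_Suc_imp: "Ck (Suc k) f \<Longrightarrow> Ck k f"
proof (induction k arbitrary: f)
  case 0
  then show ?case
    by (auto intro!: continuous_at_imp_continuous_on differentiable_imp_continuous_within)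
next
  case (Suc k)
  show ?case unfolding Ck.simps(2)[of k]
  proof (intro conjI allI)
    show "f differentiable (at x)" for x using Suc.prems by simp
    show "Ck k (\<lambda>x. frechet_derivative f (at x) v)" for v
      by (rule Suc.IH) (use Suc.prems in simp)
  qed
qed

lemma CkI_Suc:
  assumes "\<And>x. (f has_derivative f' x) (at x)" "\<And>v. Ck k (\<lambda>x. f' x v)"
  shows "Ck (Suc k) f"
proof -
  have "frechet_derivative f (at x) = f' x" for x using frechet_derivative_at[OF assms(1)] by simp
  then show ?thesis using assms by (auto simp: differentiable_def)
qed

lemma Ck_Suc_derivative: "Ck (Suc k) f \<Longrightarrow> (f has_derivative frechet_derivative f (at x)) (at x)"
  by (simp add: frechet_derivative_works)

lemma Ck_const: "Ck k (\<lambda>x. c)"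
proof (induction k arbitrary: c)
  case (Suc k)
  show ?case by (rule CkI_Suc[where f' = "\<lambda>x v. 0"]) (use Suc in auto)
qed auto

lemma Ck_add: "Ck k f \<Longrightarrow> Ck k g \<Longrightarrow> Ck k (\<lambda>x. f x + g x)"
proof (induction k arbitrary: f g)
  case (Suc k)
  show ?case
  proof (rule CkI_Suc)
    show "((\<lambda>x. f x + g x) has_derivative (\<lambda>v. frechet_derivative f (at x) v + frechet_derivative g (at x) v)) (at x)" for x
      by (intro has_derivative_add Ck_Suc_derivative[OF Suc.prems(1)] Ck_Suc_derivative[OF Suc.prems(2)])
    show "Ck k (\<lambda>x. frechet_derivative f (at x) v + frechet_derivative g (at x) v)" for v
      using Suc.prems by (intro Suc.IH) auto
  qed
qed (auto intro: continuous_on_add)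

lemma Ck_mult:
  fixes f g :: "'a::real_normed_vector \<Rightarrow> real"
  shows "Ck k f \<Longrightarrow> Ck k g \<Longrightarrow> Ck k (\<lambda>x. f x * g x)"
proof (induction k arbitrary: f g)
  case (Suc k)
  show ?case
  proof (rule CkI_Suc)
    show "((\<lambda>x. f x * g x) has_derivative (\<lambda>v. f x * frechet_derivative g (at x) v + frechet_derivative f (at x) v * g x)) (at x)" for x
      by (intro has_derivative_mult Ck_Suc_derivative[OF Suc.prems(1)] Ck_Suc_derivative[OF Suc.prems(2)])
    show "Ck k (\<lambda>x. f x * frechet_derivative g (at x) v + frechet_derivative f (at x) v * g x)" for v
      using Suc.prems by (intro Ck_add Suc.IH Ck_Suc_imp[OF Suc.prems(1)] Ck_Suc_imp[OF Suc.prems(2)]) auto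
  qed
qed (auto intro: continuous_on_mult)

lemma Ck_inner:
  fixes p v :: "'a::real_inner"
  shows "Ck k (\<lambda>x. (x - p) \<bullet> v)"
proof (cases k)
  case 0
  then show ?thesis by (auto intro!: continuous_intros)
next
  case (Suc j)
  have "Ck (Suc j) (\<lambda>x. (x - p) \<bullet> v)"
    by (rule CkI_Suc[where f' = "\<lambda>x h. h \<bullet> v"]) (auto intro!: derivative_eq_intros Ck_const)
  then show ?thesis using Suc by simp
qed

text \<open>The squared norm is smooth, and a directional derivative of a radial function is a
  linear factor times a radial function of the same kind, so the induction closes.\<close>

lemma Ck_radial:
  fixes p :: "'a::real_inner"
  shows "dk k f \<Longrightarrow> Ck k (\<lambda>x. f ((norm (x - p))^2))"
proof (induction k arbitrary: f)
  case 0
  then show ?case by (auto intro!: continuous_on_compose2[of UNIV f] continuous_intros)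
next
  case (Suc k)
  then obtain f' where f': "\<And>x. (f has_real_derivative f' x) (at x)" "dk k f'" by auto
  show ?case
  proof (rule CkI_Suc)
    fix x :: 'a
    have "((\<lambda>x. (norm (x - p))^2) has_derivative (\<lambda>v. 2 * ((x - p) \<bullet> v))) (at x)"
      unfolding power2_norm_eq_inner by (auto intro!: derivative_eq_intros simp: inner_commute)
    moreover have "(f has_derivative (\<lambda>h. h * f' ((norm (x - p))^2))) (at ((norm (x - p))^2))"
      using f'(1) by (simp add: has_field_derivative_def mult_commute_abs)
    ultimately have "((\<lambda>x. f ((norm (x - p))^2)) has_derivative (\<lambda>v. 2 * ((x - p) \<bullet> v) * f' ((norm (x - p))^2))) (at x)"
      by (rule has_derivative_compose)
    then show "((\<lambda>x. f ((norm (x - p))^2)) has_derivative (\<lambda>v. 2 * (((x - p) \<bullet> v) * f' ((norm (x - p))^2)))) (at x)"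
      by (simp add: mult.assoc)
  next
    fix v :: 'a
    show "Ck k (\<lambda>x. 2 * (((x - p) \<bullet> v) * f' ((norm (x - p))^2)))"
      by (intro Ck_mult Ck_const Ck_inner Suc.IH f'(2))
  qed
qed

section \<open>The weight\<close>

definition logcut :: "real \<Rightarrow> real" where
  "logcut = (SOME g. (\<forall>k. dk k g) \<and> (\<forall>s\<ge>1. g s = ln s / 2) \<and> g 0 \<ge> - ln 2 \<and> (\<forall>s\<le>1/4. g s = g 0) \<and>
     (\<forall>s>0. g s \<ge> ln s / 2) \<and> (\<forall>s t. s \<le> t \<longrightarrow> g s \<le> g t) \<and>
     (\<forall>s0. \<exists>m\<ge>0. \<forall>s. g s \<ge> g s0 + m * (ln (max s (1/4)) / 2 - ln (max s0 (1/4)) / 2)))"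

lemma logcut:
  "dk k logcut" "s \<ge> 1 \<Longrightarrow> logcut s = ln s / 2" "logcut 0 \<ge> - ln 2" "s \<le> 1/4 \<Longrightarrow> logcut s = logcut 0"
  "s > 0 \<Longrightarrow> logcut s \<ge> ln s / 2" "s \<le> t \<Longrightarrow> logcut s \<le> logcut t"
  "\<exists>m\<ge>0. \<forall>s. logcut s \<ge> logcut s0 + m * (ln (max s (1/4)) / 2 - ln (max s0 (1/4)) / 2)"
proof -
  have "\<exists>g. (\<forall>k. dk k g) \<and> (\<forall>s\<ge>1. g s = ln s / 2) \<and> g 0 \<ge> - ln 2 \<and> (\<forall>s\<le>1/4. g s = g 0) \<and>
     (\<forall>s>0. g s \<ge> ln s / 2) \<and> (\<forall>s t. s \<le> t \<longrightarrow> g s \<le> g t) \<and>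
     (\<forall>s0. \<exists>m\<ge>0. \<forall>s. g s \<ge> g s0 + m * (ln (max s (1/4)) / 2 - ln (max s0 (1/4)) / 2))"
    by (rule smooth_log_cutoff) blast
  from someI_ex[OF this, folded logcut_def]
  show "dk k logcut" "s \<ge> 1 \<Longrightarrow> logcut s = ln s / 2" "logcut 0 \<ge> - ln 2" "s \<le> 1/4 \<Longrightarrow> logcut s = logcut 0"
    "s > 0 \<Longrightarrow> logcut s \<ge> ln s / 2" "s \<le> t \<Longrightarrow> logcut s \<le> logcut t"
    "\<exists>m\<ge>0. \<forall>s. logcut s \<ge> logcut s0 + m * (ln (max s (1/4)) / 2 - ln (max s0 (1/4)) / 2)"
    by blast+
qed

definition logweight :: "real \<Rightarrow> complex^'n \<Rightarrow> complex^'n \<Rightarrow> real" where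
  "logweight \<tau> p z = \<tau> * logcut ((norm (z - p))^2)"

lemma smooth_logweight: "smooth (logweight \<tau> (p :: complex^'n))"
proof -
  have "Ck k (\<lambda>z. (\<lambda>s. \<tau> * logcut s) ((norm (z - p))^2))" for k
    by (intro Ck_radial dk_mult dk_const logcut)
  then show ?thesis by (simp add: smooth_def logweight_def[abs_def])
qed

lemma norm_vec_sq: "(norm (z :: complex^'n))^2 = (\<Sum>i\<in>UNIV. (norm (z $ i))^2)"
  by (simp add: norm_vec_def L2_set_def sum_nonneg)

lemma logweight_far: "norm (z - p) \<ge> 1 \<Longrightarrow> logweight \<tau> p z = \<tau> * ln (norm (z - p))"
proof -
  assume 1: "norm (z - p) \<ge> 1"
  then have "(norm (z - p))^2 \<ge> 1" by simp
  moreover have "ln ((norm (z - p))^2) = 2 * ln (norm (z - p))" using 1 by (subst ln_realpow) auto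
  ultimately show ?thesis by (simp add: logweight_def logcut)
qed

lemma logcut_sq_ge:
  assumes "x \<ge> 0" shows "x > 0 \<Longrightarrow> logcut (x^2) \<ge> ln x" and "logcut (x^2) \<ge> - ln 2"
proof -
  assume "x > 0"
  then have "ln (x^2) = 2 * ln x" by (subst ln_realpow) auto
  then show "logcut (x^2) \<ge> ln x" using logcut(5)[of "x^2"] \<open>x > 0\<close> by simp
next
  show "logcut (x^2) \<ge> - ln 2" using logcut(3) logcut(6)[of 0 "x^2"] by simp
qed

text \<open>At a point with |a - p|^2 > 1/4 the support line in ln s becomes a minorant m
  \<open>logreg\<close> + const, which is plurisubharmonic and touches the function at a up to an
  error of order e^2. At the other points the function attains its minimum.\<close>

lemma cpsh_logcut:
  fixes p :: "complex^'n"
  shows "cpsh (\<lambda>z. logcut ((norm (z - p))^2))"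
proof -
  have cont: "continuous_on UNIV (\<lambda>z. logcut ((norm (z - p))^2))"
    using logcut(1)[of 0] by (auto intro!: continuous_on_compose2[of UNIV logcut] continuous_intros)
  have "logcut ((norm (a - p))^2) \<le> cmean (\<lambda>t. logcut ((norm (a + t *s b - p))^2)) 0 1" for a b :: "complex^'n"
  proof (cases "(norm (a - p))^2 \<le> 1/4")
    case True
    have "logcut ((norm (a - p))^2) = cmean (\<lambda>t. logcut 0) 0 1" unfolding cmean_const by (rule logcut(4)[OF True])
    also have "\<dots> \<le> cmean (\<lambda>t. logcut ((norm (a + t *s b - p))^2)) 0 1"
      by (intro cmean_mono continuous_on_line[OF cont] continuous_on_const logcut(6)) simp
    finally show ?thesis .
  next
    case False
    define s0 where "s0 = (norm (a - p))^2"
    obtain m where m: "m \<ge> 0" "\<And>s. logcut s \<ge> logcut s0 + m * (ln (max s (1/4)) / 2 - ln (max s0 (1/4)) / 2)"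
      using logcut(7)[of s0] by blast
    have main: "logcut s0 \<le> cmean (\<lambda>t. logcut ((norm (a + t *s b - p))^2)) 0 1 + m * (2 * e^2)" if e: "e > 0" for e
    proof -
      \<comment> \<open>The shift 2 m e^2 pays for replacing \<open>logreg\<close> by half the
        logarithm of max (|z - p|^2, 1/4), since ln (1 + e^2 / M) / 2 \<le> 2 e^2 for M \<ge>
        1/4.\<close>
      define L where "L = (\<lambda>z. (logcut s0 - m * (2 * e^2 + ln s0 / 2)) + m * logreg e UNIV p z)"
      have cL: "cpsh L" unfolding L_def using e m
        by (intro cpsh_add cpsh_const cpsh_cmult cpsh_logreg) auto
      have le: "L z \<le> logcut ((norm (z - p))^2)" for z
      proof -
        define M where "M = max ((norm (z - p))^2) (1/4)"
        have M: "M \<ge> 1/4" by (simp add: M_def)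
        have "logreg e UNIV p z = ln (e^2 + (norm (z - p))^2) / 2"
          by (simp add: logreg_def norm_vec_sq)
        also have "\<dots> \<le> ln (M * (1 + e^2 / M)) / 2"
          using e M by (intro divide_right_mono ln_mono) (auto simp: M_def add_pos_nonneg field_simps)
        also have "\<dots> = (ln M + ln (1 + e^2 / M)) / 2" using M e by (subst ln_mult_pos) (auto simp: add_pos_nonneg)
        also have "ln (1 + e^2 / M) \<le> e^2 / M" using M by (intro ln_add_one_self_le_self) auto
        also have "e^2 / M \<le> e^2 / (1/4)" using M by (intro divide_left_mono) auto
        finally have "logreg e UNIV p z \<le> ln M / 2 + 2 * e^2" by (simp add: field_simps)
        then have "m * logreg e UNIV p z \<le> m * (ln M / 2 + 2 * e^2)" using m by (intro mult_left_mono)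
        then have "L z \<le> logcut s0 + m * (ln M / 2 - ln (max s0 (1/4)) / 2)"
          using False by (simp add: L_def s0_def max_def algebra_simps)
        also have "\<dots> \<le> logcut ((norm (z - p))^2)" unfolding M_def by (rule m)
        finally show ?thesis .
      qed
      have "logreg e UNIV p a \<ge> ln s0 / 2"
      proof -
        have "s0 > 0" using False unfolding s0_def by linarith
        then have "ln s0 \<le> ln (e^2 + s0)" using e by (intro ln_mono) auto
        then show ?thesis by (simp add: logreg_def s0_def norm_vec_sq)
      qed
      then have "m * (ln s0 / 2) \<le> m * logreg e UNIV p a" using m by (intro mult_left_mono)
      then have "logcut s0 - m * (2 * e^2) \<le> L a" by (simp add: L_def algebra_simps)
      also have "\<dots> \<le> cmean (\<lambda>t. L (a + t *s b)) 0 1" using cL by (simp add: cpsh_def)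
      also have "\<dots> \<le> cmean (\<lambda>t. logcut ((norm (a + t *s b - p))^2)) 0 1"
        by (intro cmean_mono continuous_on_line[OF cont] continuous_on_line[OF cpsh_continuous[OF cL]] le)
      finally show ?thesis by simp
    qed
    have "logcut s0 \<le> cmean (\<lambda>t. logcut ((norm (a + t *s b - p))^2)) 0 1"
    proof (rule field_le_epsilon)
      fix \<epsilon> :: real assume \<epsilon>: "\<epsilon> > 0"
      \<comment> \<open>This makes the error 2 m e^2 at most \<epsilon>; the summand 1 covers the
        slope m = 0.\<close>
      define e where "e = sqrt (\<epsilon> / (2 * m + 1))"
      have "m * (2 * e^2) = \<epsilon> * (2 * m / (2 * m + 1))" using m \<epsilon> by (simp add: e_def)
      also have "\<dots> \<le> \<epsilon> * 1" using m \<epsilon> by (intro mult_left_mono) auto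
      finally show "logcut s0 \<le> cmean (\<lambda>t. logcut ((norm (a + t *s b - p))^2)) 0 1 + \<epsilon>"
        using main[of e] m \<epsilon> by (simp add: e_def)
    qed
    then show ?thesis by (simp add: s0_def)
  qed
  then show ?thesis using cont by (simp add: cpsh_def)
qed

lemma cpsh_logweight: "\<tau> \<ge> 0 \<Longrightarrow> cpsh (logweight \<tau> p)"
  using cpsh_cmult[OF cpsh_logcut] by (simp add: logweight_def[abs_def])

lemma ln_one_plus_le_log_plus: "x \<ge> 0 \<Longrightarrow> ln (1 + x) \<le> log_plus x + ln 2"
proof (cases "x \<le> 1")
  case True
  assume "x \<ge> 0"
  then have "ln (1 + x) \<le> ln 2" using True by simp
  then show ?thesis using log_plus_nonneg[OF \<open>x \<ge> 0\<close>] by simp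
next
  case False
  assume "x \<ge> 0"
  have "ln (1 + x) \<le> ln (2 * x)" using False by simp
  also have "\<dots> = ln 2 + ln x" using False by (subst ln_mult_pos) auto
  finally show ?thesis using False by (simp add: log_plus_def)
qed

lemma lelong_logweight:
  assumes \<tau>: "\<tau> \<ge> 0"
  shows "(\<lambda>z. ereal (logweight \<tau> p z)) \<in> lelong_plus \<tau>"
proof -
  have up: "logcut ((norm (z - p))^2) \<le> log_plus (norm z) + (ln 2 + ln (1 + norm p))" for z
  proof (cases "norm (z - p) \<ge> 1")
    case True
    have "logcut ((norm (z - p))^2) = ln (norm (z - p))" using logweight_far[OF True, of 1] by (simp add: logweight_def)
    also have "\<dots> \<le> ln ((1 + norm z) * (1 + norm p))"
    proof (rule ln_mono)
      have "norm (z - p) \<le> norm z + norm p" by (rule norm_triangle_ineq4)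
      moreover have "(1 + norm z) * (1 + norm p) = 1 + norm z + norm p + norm z * norm p" by (simp add: algebra_simps)
      moreover have "norm z * norm p \<ge> 0" by simp
      ultimately show "norm (z - p) \<le> (1 + norm z) * (1 + norm p)" by linarith
    qed (use True in auto)
    also have "\<dots> = ln (1 + norm z) + ln (1 + norm p)" by (intro ln_mult_pos) (auto simp: add_pos_nonneg)
    finally show ?thesis using ln_one_plus_le_log_plus[of "norm z"] by simp
  next
    case False
    then have "(norm (z - p))^2 \<le> 1" by (simp add: abs_square_le_1)
    then have "logcut ((norm (z - p))^2) \<le> logcut 1" by (rule logcut)
    also have "logcut 1 = 0" by (simp add: logcut(2))
    finally show ?thesis using log_plus_nonneg[of "norm z"] by (smt (verit) ln_ge_zero norm_ge_zero)
  qed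
  have low: "log_plus (norm z) - (ln 2 + ln (2 + norm p)) \<le> logcut ((norm (z - p))^2)" for z
  proof (cases "norm (z - p) \<ge> 1")
    case True
    define x where "x = norm (z - p)"
    have x: "x \<ge> 1" using True x_def by simp
    have "log_plus (norm z) \<le> ln (1 + norm z)" by (simp add: log_plus_le)
    also have "\<dots> \<le> ln (x * (2 + norm p))"
    proof (rule ln_mono)
      have "norm z \<le> x + norm p" unfolding x_def using norm_triangle_sub[of z p] by (simp add: add.commute)
      moreover have "1 * norm p \<le> x * norm p" using x by (intro mult_right_mono) auto
      ultimately show "1 + norm z \<le> x * (2 + norm p)" using x by (simp add: algebra_simps)
    qed (auto simp: add_pos_nonneg)
    also have "\<dots> = ln x + ln (2 + norm p)" using x by (intro ln_mult_pos) (auto simp: add_pos_nonneg)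
    also have "ln x \<le> logcut ((norm (z - p))^2)" unfolding x_def[symmetric] using x by (intro logcut_sq_ge) auto
    finally have "log_plus (norm z) \<le> logcut ((norm (z - p))^2) + ln (2 + norm p)" by simp
    moreover have "0 < ln (2::real)" by simp
    ultimately show ?thesis by linarith
  next
    case False
    have "norm z \<le> norm (z - p) + norm p" using norm_triangle_sub[of z p] by (simp add: add.commute)
    then have "log_plus (norm z) \<le> ln (2 + norm p)"
    proof -
      have "ln (1 + norm z) \<le> ln (2 + norm p)"
        using False \<open>norm z \<le> norm (z - p) + norm p\<close> by (intro ln_mono) (auto simp: add_pos_nonneg)
      then show ?thesis using log_plus_le[of "norm z"] by simp
    qed
    then show ?thesis using logcut_sq_ge(2)[of "norm (z - p)"] by simp
  qed
  have "logweight \<tau> p z \<le> \<tau> * log_plus (norm z) + \<tau> * (ln 2 + ln (1 + norm p))" for z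
    using mult_left_mono[OF up \<tau>] by (simp add: logweight_def distrib_left)
  moreover have "logweight \<tau> p z \<ge> \<tau> * log_plus (norm z) - \<tau> * (ln 2 + ln (2 + norm p))" for z
    using mult_left_mono[OF low \<tau>] by (simp add: logweight_def right_diff_distrib)
  moreover have "psh_on UNIV (\<lambda>z. ereal (logweight \<tau> p z))" using \<tau> by (intro cpsh_imp_psh cpsh_logweight)
  ultimately show ?thesis by (auto simp: lelong_plus_def lelong_def)
qed

section \<open>Pluripolarity and plurithinness\<close>

lemma cmean_affine:
  assumes "continuous_on (sphere c \<bar>r\<bar>) f"
  shows "cmean (\<lambda>t. B + n * f t) c r = B + n * cmean f c r"
  by (simp only: cmean_add[OF continuous_on_const continuous_on_mult_left[OF assms]] cmean_const cmean_cmult)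

lemma cmean_pos:
  assumes f: "continuous_on UNIV f" "\<And>z. f z \<ge> 0" and r: "r > 0" and w: "norm (w - c) = r" "f w > 0"
  shows "cmean f c r > 0"
proof -
  define F where "F = (\<lambda>\<theta>. f (c + of_real r * cis \<theta>))"
  have cont: "continuous_on {0..2*pi} F" unfolding F_def
    by (rule continuous_on_compose2[OF f(1)]) (auto intro!: continuous_intros)
  define \<theta> where "\<theta> = Arg2pi (w - c)"
  have "w - c = of_real r * cis \<theta>" unfolding \<theta>_def using Arg2pi_eq[of "w - c"] w by (simp add: cis_conv_exp)
  then have "F \<theta> > 0" using w by (simp add: F_def algebra_simps)
  moreover have "\<theta> \<in> {0..2*pi}" unfolding \<theta>_def using Arg2pi[of "w - c"] by (auto simp: less_imp_le)
  ultimately have "\<not> (\<forall>x\<in>{0..2*pi}. F x = 0)" by force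
  then have "integral {0..2*pi} F \<noteq> 0" using integral_eq_0_iff[OF cont] f by (auto simp: F_def)
  moreover have "integral {0..2*pi} F \<ge> 0" using f by (intro integral_nonneg integrable_continuous_real cont) (auto simp: F_def)
  ultimately show ?thesis by (simp add: cmean_def F_def)
qed

lemma usc_bounded_above_compact:
  assumes u: "usc_on D u" "\<And>z. z \<in> D \<Longrightarrow> u z < \<infinity>" and X: "compact X" "X \<subseteq> D"
  shows "\<exists>B::real. \<forall>x\<in>X. u x \<le> ereal B"
proof (cases "X = {}")
  case False
  have "\<exists>x\<in>X. \<forall>y\<in>X. u y \<le> u x"
  proof (rule usc_attains_max[OF X(1) False])
    fix c
    have "openin (top_of_set D) {z \<in> D. u z < c}" using u by (simp add: usc_on_def)
    then obtain T where "open T" "{z \<in> D. u z < c} = D \<inter> T" by (auto simp: openin_open)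
    then have "{x \<in> X. u x < c} = X \<inter> T" using X by auto
    then show "openin (top_of_set X) {x \<in> X. u x < c}" using \<open>open T\<close> by (simp add: openin_open_Int)
  qed
  then obtain x where "x \<in> X" "\<And>y. y \<in> X \<Longrightarrow> u y \<le> u x" by blast
  moreover have "u x < \<infinity>" using u(2) X \<open>x \<in> X\<close> by auto
  ultimately show ?thesis by (cases "u x") (auto intro!: exI[of _ "real_of_ereal (u x)"])
qed auto

text \<open>On the circle v lies below B - n \<phi> for a tent function \<phi> around w and every n.
  The mean of \<phi> is positive, so a large n pushes the value at the centre below any real
  number.\<close>

lemma subharmonic_neg_infinity:
  assumes v: "subharmonic_on D v" and r: "r > 0" "cball c r \<subseteq> D" and w: "norm (w - c) = r"
    and e: "e > 0" "\<And>t. dist t w < e \<Longrightarrow> t \<in> D \<Longrightarrow> v t = -\<infinity>"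
  shows "v c = -\<infinity>"
proof (rule ccontr)
  assume "v c \<noteq> -\<infinity>"
  moreover have "c \<in> D" using r by auto
  then have "v c < \<infinity>" using v unfolding subharmonic_on_def by blast
  ultimately obtain x where x: "v c = ereal x" by (cases "v c") auto
  have "sphere c r \<subseteq> D" using r by auto
  then have "\<exists>B::real. \<forall>t\<in>sphere c r. v t \<le> ereal B"
    using v by (intro usc_bounded_above_compact[of D]) (auto simp: subharmonic_on_def)
  then obtain B where B: "\<And>t. t \<in> sphere c r \<Longrightarrow> v t \<le> ereal B" by blast
  define \<phi> where "\<phi> = (\<lambda>t. max 0 (e - dist t w))"
  have c\<phi>: "continuous_on A \<phi>" for A unfolding \<phi>_def by (intro continuous_intros)
  have pos: "cmean \<phi> c r > 0" by (rule cmean_pos[OF c\<phi> _ r(1) w]) (auto simp: \<phi>_def e)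
  define n where "n = (\<bar>B - x\<bar> + 1) / cmean \<phi> c r"
  have n: "n \<ge> 0" using pos by (simp add: n_def)
  have "v c \<le> ereal (cmean (\<lambda>t. B + (- n) * \<phi> t) c r)"
  proof (rule subharmonic_le_cmean[OF v r])
    show "continuous_on (sphere c r) (\<lambda>t. B + (- n) * \<phi> t)" by (intro continuous_intros c\<phi>)
    fix t assume t: "t \<in> sphere c r"
    show "v t \<le> ereal (B + (- n) * \<phi> t)"
    proof (cases "dist t w < e")
      case True
      then have "v t = -\<infinity>" using e(2)[of t] t r by auto
      then show ?thesis by simp
    next
      case False
      then show ?thesis using B[OF t] by (simp add: \<phi>_def)
    qed
  qed
  also have "cmean (\<lambda>t. B + (- n) * \<phi> t) c r = B - n * cmean \<phi> c r"
    unfolding cmean_affine[OF c\<phi>] by simp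
  also have "n * cmean \<phi> c r = \<bar>B - x\<bar> + 1" using pos by (simp add: n_def)
  finally show False using x by simp
qed

lemma norm_vscale: "norm (t *s b) = norm t * norm (b :: complex^'n)"
  by (simp add: norm_vec_def L2_set_right_distrib norm_mult)

text \<open>The interior A of the -\<infinity> set is relatively closed in the ball: if p in A is
  close to a limit point c, every c' near c is the centre of a circle through p inside a complex
  line, and \<open>subharmonic_neg_infinity\<close> applies. Connectedness of the ball finishes the
  proof.\<close>

lemma psh_neg_infinity_open:
  fixes u :: "complex^'n \<Rightarrow> ereal"
  assumes u: "psh_on (ball a r) u" and V: "open V" "V \<noteq> {}" "V \<subseteq> ball a r" "\<And>z. z \<in> V \<Longrightarrow> u z = -\<infinity>"
    and z: "z \<in> ball a r"
  shows "u z = -\<infinity>"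
proof -
  define S where "S = {z \<in> ball a r. u z = -\<infinity>}"
  define A where "A = interior S"
  have AV: "V \<subseteq> A" unfolding A_def S_def using V by (intro interior_maximal) auto
  have AS: "A \<subseteq> S" unfolding A_def by (rule interior_subset)
  have "closedin (top_of_set (ball a r)) A"
    unfolding closedin_limpt
  proof (intro conjI allI impI)
    show "A \<subseteq> ball a r" using AS by (auto simp: S_def)
    fix c assume c: "c islimpt A \<and> c \<in> ball a r"
    then obtain d0 where d0: "d0 > 0" "ball c d0 \<subseteq> ball a r" using open_contains_ball[of "ball a r"] by (metis open_ball)
    \<comment> \<open>The point c' is within d of c and the circle has radius at most 2 d, so the
      disc it bounds stays within 3 d < d0 of c.\<close>
    define d where "d = d0 / 4"
    have d: "d > 0" using d0 by (simp add: d_def)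
    obtain p where p: "p \<in> A" "dist p c < d" using c d by (auto simp: islimpt_approachable)
    have "u c' = -\<infinity>" if c': "c' \<in> ball c d" for c'
    proof (cases "c' = p")
      case True
      then show ?thesis using p AS by (auto simp: S_def)
    next
      case False
      define b where "b = p - c'"
      have nb: "norm b \<le> 2 * d"
      proof -
        have "dist p c' \<le> dist p c + dist c c'" by (rule dist_triangle)
        then show ?thesis using p c' by (simp add: b_def dist_norm)
      qed
      define D where "D = {t. c' + t *s b \<in> ball a r}"
      have sub: "subharmonic_on D (\<lambda>t. u (c' + t *s b))" using u by (simp add: psh_on_def D_def)
      have cb: "cball 0 1 \<subseteq> D"
      proof
        fix t :: complex assume "t \<in> cball 0 1"
        then have "norm t \<le> 1" by simp
        then have "norm (t *s b) \<le> 1 * (2 * d)" unfolding norm_vscale using nb by (intro mult_mono) auto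
        moreover have "dist c (c' + t *s b) \<le> dist c c' + norm (t *s b)"
          using norm_triangle_ineq4[of "c - c'" "t *s b"] by (simp add: dist_norm algebra_simps)
        ultimately have "dist c (c' + t *s b) < d0" using c' d0(1) by (simp add: d_def)
        then show "t \<in> D" using d0 by (auto simp: D_def)
      qed
      obtain e where e: "e > 0" "ball p e \<subseteq> A" using p open_contains_ball[of A] by (auto simp: A_def)
      have nb0: "norm b > 0" using False by (simp add: b_def)
      have "u (c' + 0 *s b) = -\<infinity>"
      proof (rule subharmonic_neg_infinity[OF sub _ cb, where w = 1 and e = "e / norm b"])
        fix t assume t: "dist t 1 < e / norm b" "t \<in> D"
        have "dist p (c' + t *s b) = norm ((1 - t) *s b)" by (simp add: dist_norm b_def vector_ssub_ldistrib vec_eq_iff algebra_simps)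
        also have "\<dots> < e" unfolding norm_vscale using t nb0 by (simp add: dist_norm norm_minus_commute pos_less_divide_eq)
        finally have "c' + t *s b \<in> A" using e by auto
        then show "u (c' + t *s b) = -\<infinity>" using AS by (auto simp: S_def)
      qed (use e nb0 in auto)
      then show ?thesis by simp
    qed
    moreover have "ball c d \<subseteq> ball a r" using d0 by (auto simp: d_def)
    ultimately have "ball c d \<subseteq> S" by (auto simp: S_def)
    then have "ball c d \<subseteq> A" unfolding A_def by (intro interior_maximal) auto
    then show "c \<in> A" using d by auto
  qed
  moreover have "openin (top_of_set (ball a r)) A"
    using AS by (intro openin_open_subtopology[THEN iffD2] open_openin[THEN iffD1]) (auto simp: A_def S_def openin_open intro!: exI[of _ "interior S"])
  ultimately have "A = {} \<or> A = ball a r"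
    using connected_ball[of a r] unfolding connected_clopen by blast
  then have "A = ball a r" using AV V by auto
  then show ?thesis using z AS by (auto simp: S_def)
qed

lemma not_pluripolar_open:
  fixes E :: "(complex^'n) set"
  assumes V: "open V" "V \<noteq> {}" "V \<subseteq> E"
  shows "\<not> pluripolar E"
proof
  assume pp: "pluripolar E"
  obtain b where b: "b \<in> V" using V by auto
  then obtain r u where r: "r > 0" and u: "psh_on (ball b r) u" "\<exists>z\<in>ball b r. u z \<noteq> -\<infinity>" "\<forall>z\<in>E \<inter> ball b r. u z = -\<infinity>"
    using pp V unfolding pluripolar_def by blast
  have "u z = -\<infinity>" if "z \<in> ball b r" for z
  proof (rule psh_neg_infinity_open[OF u(1) _ _ _ _ that, of "V \<inter> ball b r"])
    show "open (V \<inter> ball b r)" using V by auto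
    show "V \<inter> ball b r \<noteq> {}" using b r by auto
  qed (use u V in auto)
  then show False using u(2) by auto
qed

text \<open>A closed disc through a contains a sector with vertex a, so on every small circle about
  a an arc of fixed angular size lies in E. If u were at most m < u a there and at most slightly
  above u a elsewhere, the submean inequality would fail.\<close>

lemma not_plurithin_disc:
  fixes E :: "(complex^'n) set" and a :: "complex^'n"
  assumes \<rho>: "\<rho> > 0" "a $ i \<in> cball c \<rho>"
    and E: "\<And>t. a $ i + t \<in> cball c \<rho> \<Longrightarrow> a + t *s axis i 1 \<in> E"
  shows "\<not> plurithin_at E a"
proof -
  define b :: "complex^'n" where "b = axis i 1"
  have nb: "norm b = 1" by (simp add: b_def norm_axis_1)
  define d where "d = a $ i - c"
  have d: "norm d \<le> \<rho>" using \<rho> by (simp add: d_def dist_norm norm_minus_commute)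
  \<comment> \<open>The direction from a to the centre of the disc; if a is the centre, any
    direction serves.\<close>
  define e where "e = (if d = 0 then 1 else - d / of_real (norm d))"
  have e: "norm e = 1" by (auto simp: e_def norm_divide)
  have in_disc: "a + (of_real s * w) *s b \<in> E" if s: "0 \<le> s" "s \<le> \<rho>" and w: "norm w = 1" "Re (w * cnj e) \<ge> 1/2" for s w
  proof -
    have n: "(norm (d + x))^2 = (norm d)^2 + (norm x)^2 + 2 * Re (x * cnj d)" for x
      unfolding cmod_power2 by (simp add: power2_eq_square algebra_simps)
    have de: "d = - of_real (norm d) * e" by (auto simp: e_def)
    have "Re (of_real s * w * cnj d) = - s * norm d * Re (w * cnj e)"
      by (subst de) (simp add: algebra_simps)
    also have "\<dots> \<le> - s * norm d * (1/2)"
      using s w mult_left_mono[of "1/2" "Re (w * cnj e)" "s * norm d"] by simp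
    finally have "(norm (d + of_real s * w))^2 \<le> (norm d)^2 + s^2 - s * norm d"
      unfolding n using s w by (simp add: norm_mult)
    also have "\<dots> \<le> \<rho>^2"
    proof (cases "s \<le> norm d")
      case True
      then have "s * s \<le> s * norm d" using s by (intro mult_left_mono) auto
      then show ?thesis using power_mono[OF d, of 2] by (simp add: power2_eq_square)
    next
      case False
      then have "norm d * norm d \<le> s * norm d" by (intro mult_right_mono) auto
      then show ?thesis using power_mono[OF s(2) s(1), of 2] by (simp add: power2_eq_square)
    qed
    finally have "norm (d + of_real s * w) \<le> \<rho>" by (rule power2_le_imp_le) (use \<rho> in auto)
    then show ?thesis unfolding b_def by (intro E) (simp add: d_def dist_norm norm_minus_commute algebra_simps)
  qed
  have lim: "a islimpt (E - {a})"
    unfolding islimpt_approachable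
  proof (intro allI impI)
    fix \<epsilon> :: real assume \<epsilon>: "\<epsilon> > 0"
    define s where "s = min \<rho> (\<epsilon> / 2)"
    have s: "s > 0" "s \<le> \<rho>" "s < \<epsilon>" using \<epsilon> \<rho> by (auto simp: s_def)
    have "e * cnj e = 1" using e by (simp add: complex_norm_square[symmetric])
    then have "a + (of_real s * e) *s b \<in> E" using s e by (intro in_disc) auto
    moreover have "dist (a + (of_real s * e) *s b) a = s" using s e nb by (simp add: dist_norm norm_vscale norm_mult)
    ultimately show "\<exists>x'\<in>E - {a}. x' \<noteq> a \<and> dist x' a < \<epsilon>"
      using s by (intro bexI[of _ "a + (of_real s * e) *s b"]) auto
  qed
  have False if r: "r > 0" and u: "psh_on (ball a r) u" and L: "Limsup (at a within (E - {a})) u < u a" for r u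
  proof -
    have fin: "u z < \<infinity>" if "z \<in> ball a r" for z using u that by (auto simp: psh_on_def)
    then have "u a < \<infinity>" using r by auto
    then obtain x where x: "u a = ereal x" using L by (cases "u a") auto
    obtain m where m: "Limsup (at a within (E - {a})) u < ereal m" "ereal m < ereal x"
      using ereal_dense2[OF L[unfolded x]] by auto
    from Limsup_lessD[OF m(1)] obtain d1 where d1: "d1 > 0" "\<And>z. z \<in> E \<Longrightarrow> z \<noteq> a \<Longrightarrow> dist z a < d1 \<Longrightarrow> u z < ereal m"
      by (auto simp: eventually_at)
    \<comment> \<open>A continuous weight supported on the arc Re (w cnj e) \<ge> 1/2, with \<kappa>
      as its mean. It allows a continuous majorant that is below x + \<eta> on that arc.\<close>
    define \<phi> where "\<phi> = (\<lambda>w. max 0 (Re (w * cnj e) - 1/2))"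
    have c\<phi>: "continuous_on A \<phi>" for A unfolding \<phi>_def by (intro continuous_intros)
    define \<kappa> where "\<kappa> = cmean \<phi> 0 1"
    have "e * cnj e = 1" using e by (simp add: complex_norm_square[symmetric])
    then have "\<phi> e > 0" unfolding \<phi>_def by (simp only:) simp
    then have \<kappa>: "\<kappa> > 0" unfolding \<kappa>_def using e by (intro cmean_pos[OF c\<phi>, where w = e]) (auto simp: \<phi>_def)
    \<comment> \<open>The submean inequality gives (x - m) \<kappa> \<le> \<eta> - \<eta> \<kappa> <
      \<eta>, which is impossible for half of (x - m) \<kappa>.\<close>
    define \<eta> where "\<eta> = (x - m) * \<kappa> / 2"
    have \<eta>: "\<eta> > 0" using \<kappa> m by (simp add: \<eta>_def)
    have "openin (top_of_set (ball a r)) {z \<in> ball a r. u z < ereal (x + \<eta>)}" using u by (auto simp: psh_on_def usc_on_def)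
    then have "open {z \<in> ball a r. u z < ereal (x + \<eta>)}" by (rule openin_open_trans) auto
    moreover have "a \<in> {z \<in> ball a r. u z < ereal (x + \<eta>)}" using r x \<eta> by auto
    ultimately obtain d2 where d2: "d2 > 0" "ball a d2 \<subseteq> {z \<in> ball a r. u z < ereal (x + \<eta>)}"
      using open_contains_ball by blast
    define s where "s = min (min d1 d2) \<rho> / 2"
    have s: "s > 0" "s < d1" "s < d2" "s \<le> \<rho>" using d1 d2 \<rho> by (auto simp: s_def)
    define D where "D = {t. a + t *s b \<in> ball a r}"
    have sub: "subharmonic_on D (\<lambda>t. u (a + t *s b))" using u by (simp add: psh_on_def D_def)
    have dst: "dist a (a + t *s b) = norm t" for t using nb by (simp add: dist_norm norm_vscale)
    have cb: "cball 0 s \<subseteq> D"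
    proof
      fix t :: complex assume "t \<in> cball 0 s"
      then have "a + t *s b \<in> ball a d2" using s dst[of t] by auto
      then show "t \<in> D" using d2 by (auto simp: D_def)
    qed
    define f where "f = (\<lambda>t. (x + \<eta>) + (- (x + \<eta> - m)) * \<phi> (t / of_real s))"
    have "u (a + 0 *s b) \<le> ereal (cmean f 0 s)"
    proof (rule subharmonic_le_cmean[OF sub s(1) cb])
      show "continuous_on (sphere 0 s) f" unfolding f_def \<phi>_def using s by (intro continuous_intros) auto
      fix t :: complex assume "t \<in> sphere 0 s"
      then have t: "norm t = s" by simp
      define w where "w = t / of_real s"
      have w: "norm w = 1" "t = of_real s * w" using t s by (auto simp: w_def norm_divide)
      show "u (a + t *s b) \<le> ereal (f t)"
      proof (cases "Re (w * cnj e) \<ge> 1/2")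
        case True
        have inE: "a + t *s b \<in> E" unfolding w(2) using s w True by (intro in_disc) auto
        have "a + t *s b \<noteq> a" using dst[of t] t s by auto
        then have "u (a + t *s b) \<le> ereal m" using d1(2)[OF inE] dst[of t] t s by (simp add: dist_commute less_imp_le)
        also have "m \<le> f t"
        proof -
          have "Re (w * cnj e) \<le> norm (w * cnj e)" by (rule complex_Re_le_cmod)
          then have "\<phi> w \<le> 1" using w e by (simp add: \<phi>_def norm_mult)
          then have "(x + \<eta> - m) * \<phi> w \<le> (x + \<eta> - m) * 1" using m \<eta> by (intro mult_left_mono) auto
          then show ?thesis by (simp add: f_def w_def algebra_simps)
        qed
        finally show ?thesis by simp
      next
        case False
        then have "\<phi> w = 0" unfolding \<phi>_def by linarith
        then have "f t = x + \<eta>" unfolding f_def w_def[symmetric] by simp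
        moreover have "a + t *s b \<in> ball a d2" using dst[of t] t s by auto
        then have "u (a + t *s b) \<le> ereal (x + \<eta>)" using d2 by auto
        ultimately show ?thesis by simp
      qed
    qed
    also have "cmean f 0 s = (x + \<eta>) + (- (x + \<eta> - m)) * cmean (\<lambda>t. \<phi> (t / of_real s)) 0 s"
    proof -
      have "continuous_on A (\<lambda>t. \<phi> (t / of_real s))" for A unfolding \<phi>_def using s by (intro continuous_intros) auto
      then show ?thesis unfolding f_def by (rule cmean_affine)
    qed
    also have "cmean (\<lambda>t. \<phi> (t / of_real s)) 0 s = \<kappa>" using s by (simp add: \<kappa>_def cmean_def)
    finally have "(x - m) * \<kappa> \<le> \<eta> - \<eta> * \<kappa>" using x by (simp add: algebra_simps)
    moreover have "\<eta> * \<kappa> > 0" using \<eta> \<kappa> by simp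
    ultimately show False using \<eta> by (simp add: \<eta>_def)
  qed
  then show ?thesis using lim by (auto simp: plurithin_at_def)
qed

section \<open>The compact set\<close>

text \<open>The positions are dictated by the penalty. For k \<ge> 1 the factor 100 gives ln (ctr k
  / 2) = ln 50 - 16^k, where 50 bounds the distances from points of K to centres in [0, 1]; and 16^j
  against the weight 1 / (2 * 32^j) is a summable loss.\<close>

definition ctr :: "nat \<Rightarrow> real" where
  "ctr j = (if j = 0 then 30 else 100 * exp (- (16^j)))"

text \<open>The exponent 12 * 32^j times the weight 1 / (2 * 32^j) is 6, an upper bound for ln 50
  and thus for the logarithm that the penalty has to cancel.\<close>

definition rad :: "nat \<Rightarrow> real" where
  "rad j = (if j = 0 then 1 else exp (- (12 * 32^j)))"

lemma ctr_pos: "ctr j > 0" and rad_pos: "rad j > 0"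
  by (auto simp: ctr_def rad_def)

lemma rad_le: "j \<ge> 1 \<Longrightarrow> rad j \<le> ctr j / 4"
proof -
  assume j: "j \<ge> 1"
  have "(16::real)^j \<le> 32^j" by (intro power_mono) auto
  moreover have "(0::real) \<le> 32^j" by simp
  ultimately have "(16::real)^j \<le> 12 * 32^j" by linarith
  then have "exp (- (12 * 32^j)) \<le> exp (- ((16::real)^j))" by simp
  then have "exp (- (12 * 32^j)) \<le> 25 * exp (- ((16::real)^j))" using exp_gt_zero[of "- ((16::real)^j)"] by linarith
  then show ?thesis using j by (simp add: rad_def ctr_def)
qed

lemma ctr_Suc: "j \<ge> 1 \<Longrightarrow> ctr (Suc j) \<le> ctr j / 100"
proof -
  assume j: "j \<ge> 1"
  have "(16::real)^1 \<le> 16^j" using j by (intro power_increasing) auto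
  then have "100 \<le> 1 + 15 * (16::real)^j" by simp
  also have "\<dots> \<le> exp (15 * (16::real)^j)" by (rule exp_ge_add_one_self)
  finally have "exp (- (15 * (16::real)^j)) \<le> 1 / 100" by (simp add: exp_minus divide_simps)
  then have "exp (- (16^j)) * exp (- (15 * (16::real)^j)) \<le> exp (- (16^j)) * (1/100)" by (intro mult_left_mono) auto
  moreover have "exp (- (16^j)) * exp (- (15 * (16::real)^j)) = exp (- (16^Suc j))" by (simp add: exp_add[symmetric])
  ultimately show ?thesis using j by (simp add: ctr_def)
qed

lemma ctr_1: "ctr 1 \<le> 1"
proof -
  have "(5::real)^4 \<le> exp 4 ^ 4" using exp_ge_add_one_self[of 4] by (intro power_mono) auto
  also have "exp 4 ^ 4 = exp (16::real)" by (simp add: exp_of_nat_mult[symmetric])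
  finally have "exp (- 16) \<le> (1/100::real)" by (simp add: exp_minus divide_simps)
  then show ?thesis by (simp add: ctr_def)
qed

lemma ctr_bound: "ctr (Suc j) \<le> (1/100)^j"
proof (induction j)
  case 0
  then show ?case using ctr_1 by simp
next
  case (Suc j)
  then show ?case using ctr_Suc[of "Suc j"] by simp
qed

lemma ctr_less: "1 \<le> k \<Longrightarrow> k < j \<Longrightarrow> ctr j \<le> ctr k / 100"
proof (induction j)
  case (Suc j)
  show ?case
  proof (cases "j = k")
    case False
    then have "ctr j \<le> ctr k / 100" using Suc by simp
    moreover have "ctr (Suc j) \<le> ctr j / 100" using Suc False by (intro ctr_Suc) auto
    ultimately show ?thesis using ctr_pos[of j] by linarith
  qed (use ctr_Suc Suc in auto)
qed simp

lemma ctr_le: "1 \<le> k \<Longrightarrow> k \<le> j \<Longrightarrow> ctr j \<le> ctr k"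
  using ctr_less[of k j] ctr_pos[of k] by (cases "k = j") auto

lemma ctr_le_1: "1 \<le> k \<Longrightarrow> ctr k \<le> 1"
  using ctr_le[of 1 k] ctr_1 by simp

lemma ctr_tendsto_0: "ctr \<longlonglongrightarrow> 0"
proof -
  have "(\<lambda>j. ctr (Suc j)) \<longlonglongrightarrow> 0"
  proof (rule tendsto_sandwich[of "\<lambda>_. 0"])
    show "(\<lambda>j. (1/100::real)^j) \<longlonglongrightarrow> 0" by (rule LIMSEQ_power_zero) simp
  qed (auto intro!: always_eventually ctr_bound less_imp_le[OF ctr_pos])
  then show ?thesis by (rule LIMSEQ_imp_Suc)
qed

abbreviation zdisc :: "nat \<Rightarrow> complex set" where
  "zdisc j \<equiv> cball (complex_of_real (ctr j)) (rad j)"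

definition zset :: "complex set" where
  "zset = insert 0 (\<Union>j. zdisc j)"

lemma zdisc_bounds:
  assumes "z \<in> zdisc j"
  shows "norm z \<le> ctr j + rad j" "Re z \<ge> ctr j - rad j"
proof -
  have d: "norm (z - of_real (ctr j)) \<le> rad j" using assms by (simp add: dist_norm norm_minus_commute)
  have "norm z \<le> norm (complex_of_real (ctr j)) + norm (z - of_real (ctr j))"
    using norm_triangle_ineq[of "complex_of_real (ctr j)" "z - of_real (ctr j)"] by simp
  then show "norm z \<le> ctr j + rad j" using d ctr_pos[of j] by simp
  have "\<bar>Re (z - of_real (ctr j))\<bar> \<le> rad j" using abs_Re_le_cmod[of "z - of_real (ctr j)"] d by linarith
  then show "Re z \<ge> ctr j - rad j" by (simp add: abs_le_iff)
qed

text \<open>Together with \<open>zdisc_outer\<close> this describes the gap below the k-th disc: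
  later discs stay within ctr k / 80 of the origin, earlier ones to the right of 3/4 ctr k. The
  point ctr k / 2 in the gap serves both as a pole and as a place of evaluation.\<close>

lemma zdisc_inner:
  assumes "1 \<le> k" "k < j" "z \<in> zdisc j"
  shows "norm z \<le> ctr k / 80" "Re z \<ge> 3/4 * ctr j" "norm z \<le> 5/4 * ctr j"
  using zdisc_bounds[OF assms(3)] ctr_less[of k j] rad_le[of j] assms by auto

lemma zdisc_outer:
  assumes "1 \<le> k" "j \<le> k" "z \<in> zdisc j"
  shows "Re z \<ge> 3/4 * ctr k"
proof (cases "j = 0")
  case True
  then have "Re z \<ge> 29" using zdisc_bounds[OF assms(3)] by (simp add: ctr_def rad_def)
  then show ?thesis using ctr_le_1[of k] assms by simp
next
  case False
  then show ?thesis using zdisc_bounds[OF assms(3)] rad_le[of j] ctr_le[of j k] assms by simp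
qed

lemma zset_norm: "z \<in> zset \<Longrightarrow> norm z \<le> 31"
proof -
  assume "z \<in> zset"
  then consider "z = 0" | j where "z \<in> zdisc j" by (auto simp: zset_def)
  then show ?thesis
  proof cases
    case 2
    show ?thesis
    proof (cases "j = 0")
      case True then show ?thesis using zdisc_bounds(1)[OF 2] by (simp add: ctr_def rad_def)
    next
      case False then show ?thesis using zdisc_bounds(1)[OF 2] rad_le[of j] ctr_le_1[of j] by simp
    qed
  qed auto
qed

text \<open>An intersection of closed sets T k, each made of the first discs and one disc about 0 of
  radius ctr k that swallows all others.\<close>

lemma closed_zset: "closed zset"
proof -
  define T where "T = (\<lambda>k. cball 0 (ctr k) \<union> (\<Union>j\<le>k. zdisc j))"
  have eq: "zset = (\<Inter>k\<in>{1..}. T k)"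
  proof (intro equalityI subsetI INT_I)
    fix z k assume z: "z \<in> zset" and k: "k \<in> {1::nat..}"
    show "z \<in> T k"
    proof (cases "z = 0")
      case True then show ?thesis using ctr_pos[of k] by (simp add: T_def)
    next
      case False
      then obtain j where j: "z \<in> zdisc j" using z by (auto simp: zset_def)
      show ?thesis
      proof (cases "j \<le> k")
        case True then show ?thesis using j by (auto simp: T_def)
      next
        case False
        then have "norm z \<le> ctr k / 80" using zdisc_inner(1)[of k j z] j k by auto
        then show ?thesis using ctr_pos[of k] by (simp add: T_def)
      qed
    qed
  next
    fix z assume z: "z \<in> (\<Inter>k\<in>{1..}. T k)"
    show "z \<in> zset"
    proof (rule ccontr)
      assume n: "z \<notin> zset"
      have "norm z \<le> ctr k" if "k \<ge> 1" for k
        using z n that by (auto simp: zset_def T_def dest!: bspec[of _ _ k])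
      then have "norm z \<le> 0" by (intro LIMSEQ_le_const[OF ctr_tendsto_0]) blast
      then show False using n by (simp add: zset_def)
    qed
  qed
  have "closed (T k)" for k unfolding T_def by (intro closed_Un closed_UN) auto
  then show ?thesis unfolding eq by (intro closed_INT ballI)
qed

text \<open>For \<open>w \<noteq> 1\<close> the second condition describes the disc of centre \<open>-h\<close> and radius \<open>h\<close>,
  where \<open>h = \<bar>1 - w\<bar>\<^sup>2 / 2\<close>.\<close>

definition horn :: "complex \<Rightarrow> complex \<Rightarrow> bool" where
  "horn w z \<longleftrightarrow> norm w \<ge> 1 \<and> (norm z)^2 + Re z * (norm (1 - w))^2 \<le> 0"

definition hornset :: "'n \<Rightarrow> 'n \<Rightarrow> (complex^'n) set" where
  "hornset i1 i2 = {z. norm (z $ i1 + 1) \<le> 2 \<and> (\<forall>i. i \<noteq> i1 \<and> i \<noteq> i2 \<longrightarrow> norm (z $ i) \<le> 1) \<and>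
     (z $ i2 \<in> zset \<or> horn (z $ i1) (z $ i2))}"

lemma horn_0: "horn w 0 \<longleftrightarrow> norm w \<ge> 1" by (simp add: horn_def)

lemma horn_disc: "horn w z \<longleftrightarrow> norm w \<ge> 1 \<and> norm (z + of_real ((norm (1 - w))^2 / 2)) \<le> (norm (1 - w))^2 / 2"
proof -
  define h where "h = (norm (1 - w))^2 / 2"
  have h: "h \<ge> 0" by (simp add: h_def)
  have "norm (z + of_real h) \<le> h \<longleftrightarrow> (norm (z + of_real h))^2 \<le> h^2"
    using h by (auto intro: power_mono dest: power2_le_imp_le)
  also have "(norm (z + of_real h))^2 = (norm z)^2 + 2 * h * Re z + h^2"
    unfolding cmod_power2 by (simp add: power2_eq_square algebra_simps)
  also have "2 * h * Re z = Re z * (norm (1 - w))^2" by (simp add: h_def)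
  finally have "norm (z + of_real h) \<le> h \<longleftrightarrow> (norm z)^2 + Re z * (norm (1 - w))^2 \<le> 0" by simp
  then show ?thesis by (simp only: horn_def h_def)
qed

lemma horn_bounds:
  assumes "horn w z" "norm (w + 1) \<le> 2"
  shows "norm z \<le> 16" "Re z \<le> 0" "norm (1 - w) \<le> 4" "norm w \<le> 3" "- Re z \<le> (norm (1 - w))^2"
proof -
  show 1: "norm (1 - w) \<le> 4" using norm_triangle_ineq4[of 2 "w + 1"] assms by simp
  show "norm w \<le> 3" using norm_triangle_ineq4[of "w + 1" 1] assms by simp
  define d where "d = (norm (1 - w))^2"
  have d: "0 \<le> d" "d \<le> 16" unfolding d_def using power_mono[OF 1, of 2] by auto
  have h: "(norm z)^2 + Re z * d \<le> 0" using assms by (simp add: horn_def d_def)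
  have a: "- Re z \<le> norm z" using abs_Re_le_cmod[of z] by linarith
  have "Re z * d \<le> 0" using h zero_le_power2[of "norm z"] by linarith
  show R: "Re z \<le> 0"
  proof (rule ccontr)
    assume "\<not> Re z \<le> 0"
    then have "0 < Re z" "0 \<le> Re z * d" using d by auto
    then have "(norm z)^2 \<le> 0" using h by linarith
    then show False using \<open>0 < Re z\<close> by simp
  qed
  have "norm z * norm z \<le> norm z * d"
    using h mult_right_mono[OF a d(1)] by (simp add: power2_eq_square)
  then have nd: "norm z \<le> d" using d by (cases "z = 0") auto
  then show "norm z \<le> 16" using d by simp
  show "- Re z \<le> (norm (1 - w))^2" using a nd by (simp add: d_def)
qed

section \<open>Compactness, non-plurithinness and non-pluripolarity of K\<close>

locale two_axes =
  fixes i1 i2 :: "'n::finite"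
  assumes ne: "i1 \<noteq> i2"
begin

abbreviation K :: "(complex^'n) set" where "K \<equiv> hornset i1 i2"

lemma K_coord_bound: "z \<in> K \<Longrightarrow> norm (z $ i) \<le> 31"
proof -
  assume z: "z \<in> K"
  have "norm (z $ i1) \<le> 3" using norm_triangle_ineq4[of "z $ i1 + 1" 1] z by (simp add: hornset_def)
  moreover have "norm (z $ i2) \<le> 31" using z zset_norm horn_bounds(1)[of "z $ i1" "z $ i2"] by (force simp: hornset_def)
  ultimately show ?thesis using z by (cases "i = i1"; cases "i = i2") (force simp: hornset_def)+
qed

lemma compact_K: "compact K"
proof -
  have "norm z \<le> 31 * CARD('n)" if "z \<in> K" for z
  proof -
    have "norm z \<le> (\<Sum>i\<in>UNIV. norm (z $ i))" unfolding norm_vec_def by (rule L2_set_le_sum) simp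
    also have "\<dots> \<le> (\<Sum>i\<in>(UNIV::'n set). 31)" by (intro sum_mono K_coord_bound that)
    finally show ?thesis by (simp add: mult.commute)
  qed
  then have "bounded K" by (auto simp: bounded_iff)
  moreover have "closed K"
  proof -
    have c: "continuous_on UNIV (\<lambda>z::complex^'n. z $ i)" for i by (intro continuous_intros)
    have "closed {z::complex^'n. norm (z $ i1 + 1) \<le> 2}" by (intro closed_Collect_le continuous_intros)
    moreover have "closed {z::complex^'n. i \<noteq> i1 \<and> i \<noteq> i2 \<longrightarrow> norm (z $ i) \<le> 1}" for i
      by (cases "i \<noteq> i1 \<and> i \<noteq> i2") (auto intro!: closed_Collect_le continuous_intros)
    then have "closed {z::complex^'n. \<forall>i. i \<noteq> i1 \<and> i \<noteq> i2 \<longrightarrow> norm (z $ i) \<le> 1}" by (rule closed_Collect_all)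
    moreover have "closed {z::complex^'n. z $ i2 \<in> zset}"
      using continuous_closed_vimage[OF closed_zset, of "\<lambda>z::complex^'n. z $ i2"] c[of i2]
      by (auto simp: vimage_def continuous_on_eq_continuous_at)
    moreover have "closed {z::complex^'n. horn (z $ i1) (z $ i2)}" unfolding horn_def
      by (intro closed_Collect_conj closed_Collect_le continuous_intros)
    ultimately show ?thesis unfolding hornset_def
      by (intro closed_Collect_conj closed_Collect_disj)
  qed
  ultimately show ?thesis by (simp add: compact_eq_bounded_closed)
qed

lemma zero_in_K: "0 \<in> K" by (simp add: hornset_def zset_def)

text \<open>Through a point with z2 in \<open>zset\<close> passes the whole disc |z1 + 1| \<le> 2 in
  the first direction. Any other point has z2 \<noteq> 0, hence z1 \<noteq> 1, and lies in a
  nondegenerate fibre disc of the horn.\<close>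

lemma nonplurithin_K: "nonplurithin_everywhere K"
  unfolding nonplurithin_everywhere_def
proof
  fix a :: "complex^'n" assume a: "a \<in> K"
  show "\<not> plurithin_at K a"
  proof (cases "a $ i2 \<in> zset")
    case True
    show ?thesis
    proof (rule not_plurithin_disc[where \<rho> = 2 and c = "-1" and i = i1])
      show "a $ i1 \<in> cball (-1) 2" using a norm_minus_commute[of "-1" "a $ i1"] by (simp add: hornset_def dist_norm)
      fix t assume "a $ i1 + t \<in> cball (- 1) 2"
      then have "norm (a $ i1 + t + 1) \<le> 2" using norm_minus_commute[of "-1" "a $ i1 + t"] by (simp add: dist_norm)
      then show "a + t *s axis i1 1 \<in> K" using a ne True by (auto simp: hornset_def axis_def)
    qed simp
  next
    case False
    then have h: "horn (a $ i1) (a $ i2)" using a by (simp add: hornset_def)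
    have nz: "a $ i2 \<noteq> 0" using False by (auto simp: zset_def)
    then have n1: "a $ i1 \<noteq> 1" using h by (auto simp: horn_def)
    define r where "r = (norm (1 - a $ i1))^2 / 2"
    show ?thesis
    proof (rule not_plurithin_disc[where \<rho> = r and c = "- of_real r" and i = i2])
      show "r > 0" using n1 by (simp add: r_def)
      show "a $ i2 \<in> cball (- of_real r) r" using h by (simp add: horn_disc r_def dist_norm norm_minus_commute add.commute)
      fix t assume "a $ i2 + t \<in> cball (- of_real r) r"
      then have "norm (a $ i2 + t + of_real r) \<le> r" using norm_minus_commute[of "- of_real r" "a $ i2 + t"] by (simp add: dist_norm)
      then have "horn (a $ i1) (a $ i2 + t)" using h unfolding horn_disc r_def by simp
      then show "a + t *s axis i2 1 \<in> K" using a ne by (auto simp: hornset_def axis_def)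
    qed
  qed
qed

lemma K_interior_disc:
  assumes a: "norm (a $ i1 + 1) \<le> 2" "\<And>i. i \<noteq> i1 \<Longrightarrow> i \<noteq> i2 \<Longrightarrow> norm (a $ i) \<le> 1" "a $ i2 \<in> zdisc j" and r: "r > 0"
  shows "\<exists>V. open V \<and> V \<noteq> {} \<and> V \<subseteq> K \<inter> ball a r"
proof -
  define U where "U = {z::complex^'n. norm (z $ i1 + 1) < 2 \<and> (\<forall>i. i \<noteq> i1 \<and> i \<noteq> i2 \<longrightarrow> norm (z $ i) < 1) \<and> norm (z $ i2 - of_real (ctr j)) < rad j}"
  define c :: "complex^'n" where "c = (\<chi> i. if i = i1 then -1 else if i = i2 then of_real (ctr j) else 0)"
  have opn: "open U"
  proof -
    have "open {z::complex^'n. i \<noteq> i1 \<and> i \<noteq> i2 \<longrightarrow> norm (z $ i) < 1}" for i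
      by (cases "i \<noteq> i1 \<and> i \<noteq> i2") (auto intro!: open_Collect_less continuous_intros)
    then have "open (\<Inter>i. {z::complex^'n. i \<noteq> i1 \<and> i \<noteq> i2 \<longrightarrow> norm (z $ i) < 1})" by (intro open_INT) auto
    moreover have "(\<Inter>i. {z::complex^'n. i \<noteq> i1 \<and> i \<noteq> i2 \<longrightarrow> norm (z $ i) < 1}) = {z. \<forall>i. i \<noteq> i1 \<and> i \<noteq> i2 \<longrightarrow> norm (z $ i) < 1}" by auto
    ultimately show ?thesis unfolding U_def
      by (intro open_Collect_conj open_Collect_less continuous_intros) auto
  qed
  have sub: "U \<subseteq> K" by (auto simp: U_def hornset_def zset_def dist_norm norm_minus_commute intro: less_imp_le)
  define s where "s = min 1 (r / (2 * (norm (c - a) + 1)))"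
  have s: "0 < s" "s \<le> 1" using r by (auto simp: s_def add_nonneg_pos)
  define z where "z = a + s *\<^sub>R (c - a)"
  have conv: "norm ((1 - s) *\<^sub>R x + s *\<^sub>R y) < R" if "norm x \<le> R" "norm y < R" for x y :: complex and R
  proof -
    have "norm ((1 - s) *\<^sub>R x + s *\<^sub>R y) \<le> (1 - s) * norm x + s * norm y"
      using norm_triangle_ineq[of "(1 - s) *\<^sub>R x" "s *\<^sub>R y"] s by simp
    also have "(1 - s) * norm x \<le> (1 - s) * R" using that s by (intro mult_left_mono) auto
    also have "s * norm y < s * R" using that s by simp
    finally show ?thesis by (simp add: algebra_simps)
  qed
  have zi: "z $ i = (1 - s) *\<^sub>R (a $ i) + s *\<^sub>R (c $ i)" for i
    unfolding z_def by (simp add: scaleR_diff_right scaleR_left_diff_distrib)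
  have shift: "z $ i + x = (1 - s) *\<^sub>R (a $ i + x) + s *\<^sub>R (c $ i + x)" for i x
    unfolding zi by (simp add: scaleR_conv_of_real algebra_simps)
  have "z \<in> U"
    unfolding U_def
  proof (intro CollectI conjI allI impI)
    have "z $ i1 + 1 = (1 - s) *\<^sub>R (a $ i1 + 1) + s *\<^sub>R 0" using shift[of i1 1] by (simp add: c_def)
    then show "norm (z $ i1 + 1) < 2" using conv[of "a $ i1 + 1" 2 0] a by simp
    have "z $ i2 - of_real (ctr j) = (1 - s) *\<^sub>R (a $ i2 - of_real (ctr j)) + s *\<^sub>R 0" using ne shift[of i2 "- of_real (ctr j)"] by (simp add: c_def)
    then show "norm (z $ i2 - of_real (ctr j)) < rad j" using conv[of "a $ i2 - of_real (ctr j)" "rad j" 0] a rad_pos[of j]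
      by (simp add: dist_norm norm_minus_commute)
    fix i assume i: "i \<noteq> i1 \<and> i \<noteq> i2"
    then have "z $ i = (1 - s) *\<^sub>R (a $ i) + s *\<^sub>R 0" using zi[of i] by (simp add: c_def)
    then show "norm (z $ i) < 1" using conv[of "a $ i" 1 0] a i by simp
  qed
  moreover have "dist a z < r"
  proof -
    have "dist a z = s * norm (c - a)" using s by (simp add: z_def dist_norm)
    also have "\<dots> \<le> r / (2 * (norm (c - a) + 1)) * norm (c - a)" by (intro mult_right_mono) (auto simp: s_def)
    also have "\<dots> = r / 2 * (norm (c - a) / (norm (c - a) + 1))" by simp
    also have "\<dots> \<le> r / 2 * 1"
    proof (rule mult_left_mono)
      have "norm (c - a) + 1 > 0" by (rule add_nonneg_pos) auto
      then show "norm (c - a) / (norm (c - a) + 1) \<le> 1" by (simp add: pos_divide_le_eq)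
    qed (use r in simp)
    finally show ?thesis using r by simp
  qed
  ultimately have "z \<in> U \<inter> ball a r" by simp
  then show ?thesis using opn sub by (intro exI[of _ "U \<inter> ball a r"]) auto
qed

text \<open>With w = 1 - z1 the crescent reads 2 Re w \<le> |w|^2 \<le> 4 Re w, and the fibre
  condition is homogeneous under w -> \<kappa> w, z2 -> \<kappa>^2 z2. Moving along such a scaling
  makes all inequalities strict.\<close>

lemma K_interior_horn:
  assumes a: "norm (a $ i1 + 1) \<le> 2" "\<And>i. i \<noteq> i1 \<Longrightarrow> i \<noteq> i2 \<Longrightarrow> norm (a $ i) \<le> 1" "horn (a $ i1) (a $ i2)"
    and nz: "a $ i2 \<noteq> 0" and r: "r > 0"
  shows "\<exists>V. open V \<and> V \<noteq> {} \<and> V \<subseteq> K \<inter> ball a r"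
proof -
  define U where "U = {z::complex^'n. norm (z $ i1 + 1) < 2 \<and> (\<forall>i. i \<noteq> i1 \<and> i \<noteq> i2 \<longrightarrow> norm (z $ i) < 1) \<and>
     1 < norm (z $ i1) \<and> (norm (z $ i2))^2 + Re (z $ i2) * (norm (1 - z $ i1))^2 < 0}"
  have opn: "open U"
  proof -
    have "open {z::complex^'n. i \<noteq> i1 \<and> i \<noteq> i2 \<longrightarrow> norm (z $ i) < 1}" for i
      by (cases "i \<noteq> i1 \<and> i \<noteq> i2") (auto intro!: open_Collect_less continuous_intros)
    then have "open (\<Inter>i. {z::complex^'n. i \<noteq> i1 \<and> i \<noteq> i2 \<longrightarrow> norm (z $ i) < 1})" by (intro open_INT) auto
    moreover have "(\<Inter>i. {z::complex^'n. i \<noteq> i1 \<and> i \<noteq> i2 \<longrightarrow> norm (z $ i) < 1}) = {z. \<forall>i. i \<noteq> i1 \<and> i \<noteq> i2 \<longrightarrow> norm (z $ i) < 1}" by auto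
    ultimately show ?thesis unfolding U_def
      by (intro open_Collect_conj open_Collect_less continuous_intros) auto
  qed
  have sub: "U \<subseteq> K" by (auto simp: U_def hornset_def horn_def less_imp_le)
  define w where "w = 1 - a $ i1"
  have w0: "w \<noteq> 0" using a(3) nz by (auto simp: w_def horn_def)
  have sq: "(norm (1 - k *\<^sub>R w))^2 = 1 - 2 * k * Re w + k^2 * (norm w)^2"
    "(norm (2 - k *\<^sub>R w))^2 = 4 - 4 * k * Re w + k^2 * (norm w)^2" for k
    unfolding cmod_power2 by (simp_all add: power2_eq_square algebra_simps)
  have "(norm (1 - 1 *\<^sub>R w))^2 \<ge> 1^2" using a(3) by (intro power_mono) (auto simp: w_def horn_def)
  then have q1: "2 * Re w \<le> (norm w)^2" unfolding sq by simp
  have "(norm (2 - 1 *\<^sub>R w))^2 \<le> 2^2" using a(1) by (intro power_mono) (auto simp: w_def add.commute)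
  then have q2: "(norm w)^2 \<le> 4 * Re w" unfolding sq by simp
  have Rw: "Re w > 0" proof -
    have "(norm w)^2 > 0" using w0 by simp
    then show ?thesis using q2 by linarith
  qed
  \<comment> \<open>Scale w down when it is closer to the outer circle |w|^2 = 4 Re w and up when it
    is closer to |w|^2 = 2 Re w; 3 Re w is the middle.\<close>
  define \<sigma> :: real where "\<sigma> = (if (norm w)^2 \<ge> 3 * Re w then -1 else 1)"
  define \<kappa> where "\<kappa> = (\<lambda>s. 1 + \<sigma> * s)"
  \<comment> \<open>The factor \<kappa>^2 keeps z2 in the scaled fibre disc, and 1 - s moves it
    strictly inside.\<close>
  define z :: "real \<Rightarrow> complex^'n" where "z = (\<lambda>s. \<chi> i. if i = i1 then 1 - (\<kappa> s) *\<^sub>R w else if i = i2 then ((\<kappa> s)^2 * (1 - s)) *\<^sub>R (a $ i2) else (1 - s) *\<^sub>R (a $ i))"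
  have zU: "z s \<in> U" if s: "0 < s" "s < 1/4" for s
  proof -
    have k: "\<kappa> s > 3/4" "\<kappa> s < 5/4" using s by (auto simp: \<kappa>_def \<sigma>_def)
    have k2: "2 * Re w < \<kappa> s * (norm w)^2"
    proof (cases "(norm w)^2 \<ge> 3 * Re w")
      case True
      have "2 * Re w < (3/4) * (3 * Re w)" using Rw by simp
      also have "\<dots> \<le> \<kappa> s * (norm w)^2" using True k Rw by (intro mult_mono) auto
      finally show ?thesis .
    next
      case False
      then have "(norm w)^2 < \<kappa> s * (norm w)^2" using s w0 by (simp add: \<kappa>_def \<sigma>_def)
      then show ?thesis using q1 by simp
    qed
    have k4: "\<kappa> s * (norm w)^2 < 4 * Re w"
    proof (cases "(norm w)^2 \<ge> 3 * Re w")
      case True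
      then have "\<kappa> s * (norm w)^2 < 1 * (norm w)^2" using s w0 by (intro mult_strict_right_mono) (auto simp: \<kappa>_def \<sigma>_def)
      then show ?thesis using q2 by simp
    next
      case False
      have "\<kappa> s * (norm w)^2 \<le> (5/4) * (3 * Re w)" using False k by (intro mult_mono) auto
      then show ?thesis using Rw by simp
    qed
    have "1 < norm (1 - \<kappa> s *\<^sub>R w)"
    proof (rule power2_less_imp_less)
      have "\<kappa> s * (2 * Re w) < \<kappa> s * (\<kappa> s * (norm w)^2)" using k2 k by (intro mult_strict_left_mono) auto
      then show "1^2 < (norm (1 - \<kappa> s *\<^sub>R w))^2" unfolding sq by (simp add: power2_eq_square mult.assoc)
    qed auto
    moreover have "norm (2 - \<kappa> s *\<^sub>R w) < 2"
    proof (rule power2_less_imp_less)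
      have "\<kappa> s * (\<kappa> s * (norm w)^2) < \<kappa> s * (4 * Re w)" using k4 k by (intro mult_strict_left_mono) auto
      then show "(norm (2 - \<kappa> s *\<^sub>R w))^2 < 2^2" unfolding sq by (simp add: power2_eq_square mult.assoc)
    qed auto
    moreover have "norm ((1 - s) *\<^sub>R (a $ i)) < 1" if "i \<noteq> i1" "i \<noteq> i2" for i
    proof -
      have "norm ((1 - s) *\<^sub>R (a $ i)) = (1 - s) * norm (a $ i)" using s by simp
      also have "\<dots> \<le> (1 - s) * 1" using a(2)[OF that] s by (intro mult_left_mono) auto
      also have "\<dots> < 1" using s by simp
      finally show ?thesis .
    qed
    moreover have "(norm (((\<kappa> s)^2 * (1 - s)) *\<^sub>R (a $ i2)))^2 + Re (((\<kappa> s)^2 * (1 - s)) *\<^sub>R (a $ i2)) * (norm (\<kappa> s *\<^sub>R w))^2 < 0"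
    proof -
      define \<mu> where "\<mu> = (\<kappa> s)^2 * (1 - s)"
      have \<mu>: "\<mu> > 0" "\<mu> < (\<kappa> s)^2" using s k by (auto simp: \<mu>_def)
      have "(norm (a $ i2))^2 \<le> - Re (a $ i2) * (norm w)^2" using a(3) by (simp add: horn_def w_def)
      then have "\<mu> * (\<kappa> s)^2 * (norm (a $ i2))^2 \<le> \<mu> * (\<kappa> s)^2 * (- Re (a $ i2) * (norm w)^2)" using \<mu> by (intro mult_left_mono) auto
      moreover have "\<mu> * (\<mu> * (norm (a $ i2))^2) < \<mu> * (\<kappa> s)^2 * (norm (a $ i2))^2" unfolding mult.assoc using \<mu> nz by (intro mult_strict_left_mono mult_strict_right_mono) auto
      moreover have "(norm (\<mu> *\<^sub>R (a $ i2)))^2 + Re (\<mu> *\<^sub>R (a $ i2)) * (norm (\<kappa> s *\<^sub>R w))^2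
          = \<mu> * (\<mu> * (norm (a $ i2))^2) - \<mu> * (\<kappa> s)^2 * (- Re (a $ i2) * (norm w)^2)"
        by (simp add: power_mult_distrib power2_eq_square mult_ac)
      ultimately show ?thesis unfolding \<mu>_def[symmetric] by linarith
    qed
    ultimately show ?thesis using ne by (simp add: U_def z_def)
  qed
  have "((\<lambda>s. z s) \<longlongrightarrow> z 0) (at_right 0)"
    unfolding z_def \<kappa>_def by (intro vec_tendstoI) (auto intro!: tendsto_eq_intros)
  moreover have "z 0 = a" by (simp add: z_def \<kappa>_def w_def vec_eq_iff)
  ultimately have "\<forall>\<^sub>F s in at_right 0. dist (z s) a < r" using r by (auto simp: tendsto_iff)
  moreover have "\<forall>\<^sub>F s in at_right 0. 0 < s \<and> s < (1/4::real)"
    unfolding eventually_at_right_field by (intro exI[of _ "1/4"]) auto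
  ultimately have "\<forall>\<^sub>F s in at_right 0. dist (z s) a < r \<and> (0 < s \<and> s < (1/4::real))" by (rule eventually_conj)
  from eventually_happens'[OF _ this] obtain s where "dist (z s) a < r" "0 < s" "s < 1/4"
    by (auto simp: trivial_limit_at_right_real)
  then have "z s \<in> U \<inter> ball a r" using zU by (simp add: dist_commute)
  then show ?thesis using opn sub by (intro exI[of _ "U \<inter> ball a r"]) auto
qed

lemma nonpluripolar_K: "nonpluripolar_everywhere K"
  unfolding nonpluripolar_everywhere_def
proof (intro ballI allI impI)
  fix a r assume a: "a \<in> K" and r: "(r::real) > 0"
  have box: "norm (a $ i1 + 1) \<le> 2" "\<And>i. i \<noteq> i1 \<Longrightarrow> i \<noteq> i2 \<Longrightarrow> norm (a $ i) \<le> 1" using a by (auto simp: hornset_def)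
  have "\<exists>V. open V \<and> V \<noteq> {} \<and> V \<subseteq> K \<inter> ball a r"
  proof (cases "a $ i2 = 0")
    \<comment> \<open>The horn has no interior near the points with z2 = 0 and |z1| < 1; there
      interior points of K are supplied by the small discs that accumulate at z2 = 0.\<close>
    case True
    have "\<forall>\<^sub>F j in sequentially. dist (ctr j) 0 < r / 2" by (rule tendstoD[OF ctr_tendsto_0]) (use r in simp)
    then obtain j where "dist (ctr j) 0 < r / 2" using eventually_happens'[OF sequentially_bot] by blast
    then have j: "ctr j < r / 2" by (simp add: dist_norm)
    define b where "b = a + of_real (ctr j) *s axis i2 1"
    have ab: "dist a b < r / 2" using j ctr_pos[of j] by (simp add: b_def dist_norm norm_vscale norm_axis_1)
    have "\<exists>V. open V \<and> V \<noteq> {} \<and> V \<subseteq> K \<inter> ball b (r/2)"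
    proof (rule K_interior_disc)
      show "b $ i2 \<in> zdisc j" using True rad_pos[of j] by (simp add: b_def less_imp_le)
    qed (use box ne r in \<open>auto simp: b_def axis_def\<close>)
    moreover have "ball b (r/2) \<subseteq> ball a r"
    proof
      fix x assume "x \<in> ball b (r/2)"
      then show "x \<in> ball a r" using ab dist_triangle[of a x b] by simp
    qed
    ultimately show ?thesis by (meson Int_mono order_refl order_trans)
  next
    case False
    then consider j where "a $ i2 \<in> zdisc j" | "horn (a $ i1) (a $ i2)" using a by (auto simp: hornset_def zset_def)
    then show ?thesis
    proof cases
      case 1 then show ?thesis using K_interior_disc[OF box _ r] by blast
    next
      case 2 then show ?thesis using K_interior_horn[OF box _ False r] by blast
    qed
  qed
  then show "\<not> pluripolar (K \<inter> ball a r)" using not_pluripolar_open by blast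
qed

end

section \<open>Uniform limits of polynomials\<close>

lemma complex_polynomial_const: "complex_polynomial (\<lambda>z::complex^'n. c)"
  unfolding complex_polynomial_def
  by (rule exI[of _ "{\<lambda>i. 0}"], rule exI[of _ "\<lambda>_. c"]) auto

lemma complex_polynomial_coord: "complex_polynomial (\<lambda>z::complex^'n. z $ j)"
proof -
  have "(\<Prod>i\<in>UNIV. (z $ i) ^ (if i = j then 1 else 0)) = z $ j" for z :: "complex^'n"
  proof -
    have "(\<Prod>i\<in>UNIV. (z $ i) ^ (if i = j then 1 else 0)) = (\<Prod>i\<in>UNIV. if i = j then z $ i else 1)"
      by (intro prod.cong) auto
    then show ?thesis by simp
  qed
  then show ?thesis unfolding complex_polynomial_def
    by (intro exI[of _ "{\<lambda>i. if i = j then 1 else 0}"] exI[of _ "\<lambda>_. 1"]) auto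
qed

lemma complex_polynomial_add:
  assumes "complex_polynomial p" "complex_polynomial q"
  shows "complex_polynomial (\<lambda>z::complex^'n. p z + q z)"
proof -
  obtain A c B d where p: "finite A" "p = (\<lambda>z. \<Sum>\<alpha>\<in>A. c \<alpha> * (\<Prod>i\<in>UNIV. (z $ i) ^ \<alpha> i))"
    and q: "finite B" "q = (\<lambda>z. \<Sum>\<alpha>\<in>B. d \<alpha> * (\<Prod>i\<in>UNIV. (z $ i) ^ \<alpha> i))"
    using assms unfolding complex_polynomial_def by blast
  define e where "e = (\<lambda>\<alpha>. (if \<alpha> \<in> A then c \<alpha> else 0) + (if \<alpha> \<in> B then d \<alpha> else 0))"
  have "p z + q z = (\<Sum>\<alpha>\<in>A \<union> B. e \<alpha> * (\<Prod>i\<in>UNIV. (z $ i) ^ \<alpha> i))" for z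
  proof -
    have "p z = (\<Sum>\<alpha>\<in>A \<union> B. (if \<alpha> \<in> A then c \<alpha> else 0) * (\<Prod>i\<in>UNIV. (z $ i) ^ \<alpha> i))"
      unfolding p(2) using p(1) q(1) by (intro sum.mono_neutral_cong_left) auto
    moreover have "q z = (\<Sum>\<alpha>\<in>A \<union> B. (if \<alpha> \<in> B then d \<alpha> else 0) * (\<Prod>i\<in>UNIV. (z $ i) ^ \<alpha> i))"
      unfolding q(2) using p(1) q(1) by (intro sum.mono_neutral_cong_left) auto
    ultimately show ?thesis by (simp add: e_def distrib_right sum.distrib)
  qed
  then show ?thesis unfolding complex_polynomial_def using p(1) q(1)
    by (intro exI[of _ "A \<union> B"] exI[of _ e]) auto
qed

lemma complex_polynomial_sum:
  "(\<And>i. i \<in> I \<Longrightarrow> complex_polynomial (f i)) \<Longrightarrow> complex_polynomial (\<lambda>z::complex^'n. \<Sum>i\<in>I. f i z)"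
  by (induction I rule: infinite_finite_induct) (auto intro: complex_polynomial_const complex_polynomial_add)

lemma complex_polynomial_monom_mult:
  assumes "complex_polynomial q"
  shows "complex_polynomial (\<lambda>z::complex^'n. (c * (\<Prod>i\<in>UNIV. (z $ i) ^ \<alpha> i)) * q z)"
proof -
  obtain B d where q: "finite B" "q = (\<lambda>z. \<Sum>\<beta>\<in>B. d \<beta> * (\<Prod>i\<in>UNIV. (z $ i) ^ \<beta> i))"
    using assms unfolding complex_polynomial_def by blast
  define sh where "sh = (\<lambda>\<beta> i. \<alpha> i + \<beta> i :: nat)"
  have inj: "inj_on sh B"
    by (rule inj_onI) (auto simp: sh_def fun_eq_iff)
  have "(c * (\<Prod>i\<in>UNIV. (z $ i) ^ \<alpha> i)) * q z = (\<Sum>\<gamma>\<in>sh ` B. (c * d (the_inv_into B sh \<gamma>)) * (\<Prod>i\<in>UNIV. (z $ i) ^ \<gamma> i))" for z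
  proof -
    have "(\<Sum>\<gamma>\<in>sh ` B. (c * d (the_inv_into B sh \<gamma>)) * (\<Prod>i\<in>UNIV. (z $ i) ^ \<gamma> i))
        = (\<Sum>\<beta>\<in>B. (c * d \<beta>) * (\<Prod>i\<in>UNIV. (z $ i) ^ sh \<beta> i))"
      by (subst sum.reindex[OF inj]) (simp add: the_inv_into_f_f[OF inj])
    also have "\<dots> = (c * (\<Prod>i\<in>UNIV. (z $ i) ^ \<alpha> i)) * q z"
      by (simp add: q(2) sum_distrib_left sh_def power_add prod.distrib mult_ac)
    finally show ?thesis by simp
  qed
  then show ?thesis unfolding complex_polynomial_def using q(1)
    by (intro exI[of _ "sh ` B"] exI[of _ "\<lambda>\<gamma>. c * d (the_inv_into B sh \<gamma>)"]) auto
qed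

lemma complex_polynomial_mult:
  assumes "complex_polynomial p" "complex_polynomial q"
  shows "complex_polynomial (\<lambda>z::complex^'n. p z * q z)"
proof -
  obtain A c where p: "finite A" "p = (\<lambda>z. \<Sum>\<alpha>\<in>A. c \<alpha> * (\<Prod>i\<in>UNIV. (z $ i) ^ \<alpha> i))"
    using assms unfolding complex_polynomial_def by blast
  have "complex_polynomial (\<lambda>z. \<Sum>\<alpha>\<in>A. (c \<alpha> * (\<Prod>i\<in>UNIV. (z $ i) ^ \<alpha> i)) * q z)"
    by (intro complex_polynomial_sum complex_polynomial_monom_mult assms)
  then show ?thesis by (simp add: p(2) sum_distrib_right)
qed

lemma complex_polynomial_continuous:
  assumes "complex_polynomial p" shows "continuous_on X p"
proof -
  obtain A c where p: "p = (\<lambda>z. \<Sum>\<alpha>\<in>A. c \<alpha> * (\<Prod>i\<in>UNIV. (z $ i) ^ \<alpha> i))"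
    using assms unfolding complex_polynomial_def by blast
  show ?thesis unfolding p by (intro continuous_intros)
qed

lemma polynomial_hull_le:
  assumes q: "q \<in> polynomial_hull K" and K: "K \<noteq> {}" and p: "complex_polynomial p"
    and le: "\<And>z. z \<in> K \<Longrightarrow> norm (p z) \<le> m"
  shows "norm (p q) \<le> m"
proof -
  have "norm (p q) \<le> (SUP w\<in>K. norm (p w))" using q p by (auto simp: polynomial_hull_def)
  also have "\<dots> \<le> m" using K le by (intro cSUP_least) auto
  finally show ?thesis .
qed

lemma subset_polynomial_hull:
  assumes "compact K" shows "K \<subseteq> polynomial_hull K"
proof -
  have "norm (p z) \<le> (SUP w\<in>K. norm (p w))" if "z \<in> K" "complex_polynomial p" for z p
  proof (rule cSUP_upper[OF that(1)])
    have "compact ((\<lambda>w. norm (p w)) ` K)"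
      by (intro compact_continuous_image continuous_on_norm complex_polynomial_continuous that assms)
    then show "bdd_above ((\<lambda>w. norm (p w)) ` K)" by (intro bounded_imp_bdd_above compact_imp_bounded)
  qed
  then show ?thesis by (auto simp: polynomial_hull_def)
qed

text \<open>Membership in the uniform closure P(X) of the polynomials. It is used with X = K and
  with X = K plus one point q of the hull, so that a limit can be evaluated at q.\<close>

definition pcl :: "(complex^'n) set \<Rightarrow> (complex^'n \<Rightarrow> complex) \<Rightarrow> bool" where
  "pcl X f \<longleftrightarrow> (\<forall>\<epsilon>>0. \<exists>p. complex_polynomial p \<and> (\<forall>z\<in>X. norm (f z - p z) < \<epsilon>))"

lemma pcl_polynomial: "complex_polynomial p \<Longrightarrow> pcl X p"
  by (auto simp: pcl_def intro!: exI[of _ p])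

lemma pcl_hull:
  assumes f: "pcl (insert q K) f" and q: "q \<in> polynomial_hull K" and K: "K \<noteq> {}"
    and le: "\<And>z. z \<in> K \<Longrightarrow> norm (f z) \<le> m"
  shows "norm (f q) \<le> m"
proof (rule field_le_epsilon)
  fix e :: real assume e: "e > 0"
  then have "e / 2 > 0" by simp
  then obtain p where p: "complex_polynomial p" "\<forall>z\<in>insert q K. norm (f z - p z) < e / 2"
    using f unfolding pcl_def by blast
  have "norm (p q) \<le> m + e / 2"
  proof (rule polynomial_hull_le[OF q K p(1)])
    fix z assume z: "z \<in> K"
    have "norm (p z) \<le> norm (f z) + norm (f z - p z)" using norm_triangle_ineq4[of "f z" "f z - p z"] by simp
    then show "norm (p z) \<le> m + e / 2" using le[OF z] p(2) z by force
  qed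
  moreover have "norm (f q) \<le> norm (p q) + norm (f q - p q)" using norm_triangle_ineq[of "p q" "f q - p q"] by simp
  moreover have "norm (f q - p q) < e / 2" using p by blast
  ultimately show "norm (f q) \<le> m + e" by linarith
qed

context
  fixes X :: "(complex^'n) set"
  assumes X: "compact X"
begin

lemma pcl_bounded: assumes "pcl X f" shows "\<exists>B>0. \<forall>z\<in>X. norm (f z) \<le> B"
proof -
  obtain p where p: "complex_polynomial p" "\<And>z. z \<in> X \<Longrightarrow> norm (f z - p z) < 1"
    using assms unfolding pcl_def by (metis zero_less_one)
  have "compact (p ` X)" by (intro compact_continuous_image complex_polynomial_continuous p X)
  then obtain B where B: "B > 0" "\<And>z. z \<in> X \<Longrightarrow> norm (p z) \<le> B"
    using compact_imp_bounded[of "p ` X"] by (auto simp: bounded_pos)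
  have "norm (f z) \<le> B + 1" if "z \<in> X" for z
    using norm_triangle_ineq[of "p z" "f z - p z"] B(2)[OF that] p(2)[OF that] by simp
  then show ?thesis using B by (intro exI[of _ "B + 1"]) auto
qed

lemma pcl_uniform_limit:
  assumes F: "\<And>n. pcl X (F n)" and lim: "uniform_limit X F f sequentially"
  shows "pcl X f"
  unfolding pcl_def
proof (intro allI impI)
  fix e :: real assume "e > 0"
  then have e: "e / 2 > 0" by simp
  then obtain n where n: "\<forall>z\<in>X. dist (F n z) (f z) < e / 2"
    using lim eventually_happens'[OF sequentially_bot] unfolding uniform_limit_iff by blast
  obtain p where p: "complex_polynomial p" "\<forall>z\<in>X. norm (F n z - p z) < e / 2"
    using F[of n] e unfolding pcl_def by blast
  have "norm (f z - p z) < e" if "z \<in> X" for z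
    using norm_triangle_ineq[of "f z - F n z" "F n z - p z"] n p that
    by (force simp: dist_norm norm_minus_commute)
  then show "\<exists>p. complex_polynomial p \<and> (\<forall>z\<in>X. norm (f z - p z) < e)" using p by blast
qed

lemma pcl_add: assumes "pcl X f" "pcl X g" shows "pcl X (\<lambda>z. f z + g z)"
  unfolding pcl_def
proof (intro allI impI)
  fix e :: real assume "e > 0"
  then have e: "e / 2 > 0" by simp
  obtain p q where p: "complex_polynomial p" "\<forall>z\<in>X. norm (f z - p z) < e / 2"
    and q: "complex_polynomial q" "\<forall>z\<in>X. norm (g z - q z) < e / 2"
    using assms e unfolding pcl_def by blast
  have "norm (f z + g z - (p z + q z)) < e" if "z \<in> X" for z
  proof -
    have "norm ((f z - p z) + (g z - q z)) < e / 2 + e / 2"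
      using p q that by (intro norm_add_less) auto
    then show ?thesis by (simp add: algebra_simps)
  qed
  then show "\<exists>p. complex_polynomial p \<and> (\<forall>z\<in>X. norm (f z + g z - p z) < e)"
    using complex_polynomial_add[OF p(1) q(1)] by blast
qed

lemma pcl_mult: assumes "pcl X f" "pcl X g" shows "pcl X (\<lambda>z. f z * g z)"
  unfolding pcl_def
proof (intro allI impI)
  fix e :: real assume e: "e > 0"
  obtain B where B: "B > 0" "\<And>z. z \<in> X \<Longrightarrow> norm (f z) \<le> B" using pcl_bounded[OF assms(1)] by blast
  have "e / (2 * B) > 0" using e B by simp
  then obtain q where q: "complex_polynomial q" "\<And>z. z \<in> X \<Longrightarrow> norm (g z - q z) < e / (2 * B)"
    using assms(2) unfolding pcl_def by blast
  obtain C where C: "C > 0" "\<And>z. z \<in> X \<Longrightarrow> norm (q z) \<le> C" using pcl_bounded[OF pcl_polynomial[OF q(1)]] by blast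
  have "e / (2 * C) > 0" using e C by simp
  then obtain p where p: "complex_polynomial p" "\<And>z. z \<in> X \<Longrightarrow> norm (f z - p z) < e / (2 * C)"
    using assms(1) unfolding pcl_def by blast
  have "norm (f z * g z - p z * q z) < e" if z: "z \<in> X" for z
  proof -
    have "f z * g z - p z * q z = f z * (g z - q z) + (f z - p z) * q z" by (simp add: algebra_simps)
    moreover have "norm (f z * (g z - q z)) < e / 2"
    proof -
      have "norm (f z * (g z - q z)) \<le> B * norm (g z - q z)" unfolding norm_mult using B(2)[OF z] by (intro mult_right_mono) auto
      also have "\<dots> < B * (e / (2 * B))" using q(2)[OF z] B by (intro mult_strict_left_mono) auto
      finally show ?thesis using B by simp
    qed
    moreover have "norm ((f z - p z) * q z) < e / 2"
    proof -
      have "norm ((f z - p z) * q z) \<le> norm (f z - p z) * C" unfolding norm_mult using C(2)[OF z] by (intro mult_left_mono) auto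
      also have "\<dots> < (e / (2 * C)) * C" using p(2)[OF z] C by (intro mult_strict_right_mono) auto
      finally show ?thesis using C by simp
    qed
    ultimately show ?thesis using norm_triangle_ineq[of "f z * (g z - q z)" "(f z - p z) * q z"] by simp
  qed
  then show "\<exists>p. complex_polynomial p \<and> (\<forall>z\<in>X. norm (f z * g z - p z) < e)"
    using complex_polynomial_mult[OF p(1) q(1)] by blast
qed

lemma pcl_const: "pcl X (\<lambda>z. c)" by (intro pcl_polynomial complex_polynomial_const)

lemma pcl_coord: "pcl X (\<lambda>z. z $ i)" by (intro pcl_polynomial complex_polynomial_coord)

lemma pcl_power: "pcl X f \<Longrightarrow> pcl X (\<lambda>z. f z ^ n)"
  by (induction n) (auto intro: pcl_const pcl_mult)

lemma pcl_sum: "(\<And>i. i \<in> I \<Longrightarrow> pcl X (f i)) \<Longrightarrow> pcl X (\<lambda>z. \<Sum>i\<in>I. f i z)"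
  by (induction I rule: infinite_finite_induct) (auto intro: pcl_const pcl_add)

lemma pcl_cong: "pcl X f \<Longrightarrow> (\<And>z. z \<in> X \<Longrightarrow> f z = g z) \<Longrightarrow> pcl X g"
  by (simp add: pcl_def)

lemma pcl_exp: assumes "pcl X f" shows "pcl X (\<lambda>z. exp (f z))"
proof -
  obtain B where B: "B > 0" "\<And>z. z \<in> X \<Longrightarrow> norm (f z) \<le> B" using pcl_bounded[OF assms] by blast
  have "uniform_limit X (\<lambda>n z. \<Sum>k<n. f z ^ k /\<^sub>R fact k) (\<lambda>z. \<Sum>k. f z ^ k /\<^sub>R fact k) sequentially"
  proof (rule Weierstrass_m_test)
    show "summable (\<lambda>n. B^n /\<^sub>R fact n)" by (rule summable_exp_generic)
    show "norm (f z ^ n /\<^sub>R fact n) \<le> B ^ n /\<^sub>R fact n" if "z \<in> X" for n z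
      using B that by (auto simp: norm_power intro!: mult_left_mono power_mono)
  qed
  moreover have "pcl X (\<lambda>z. \<Sum>k<n. f z ^ k /\<^sub>R fact k)" for n
    unfolding scaleR_conv_of_real by (intro pcl_sum pcl_mult pcl_const pcl_power assms)
  ultimately show ?thesis unfolding exp_def by (rule_tac pcl_uniform_limit)
qed

lemma pcl_geometric:
  assumes f: "pcl X f" and \<theta>: "\<theta> < 1" "\<And>z. z \<in> X \<Longrightarrow> norm (f z) \<le> \<theta>"
  shows "pcl X (\<lambda>z. 1 / (1 - f z))"
proof -
  have "uniform_limit X (\<lambda>n z. \<Sum>k<n. f z ^ k) (\<lambda>z. \<Sum>k. f z ^ k) sequentially"
  proof (rule Weierstrass_m_test)
    show "summable (\<lambda>n. (max 0 \<theta>)^n)" using \<theta> by (intro summable_geometric) auto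
    show "norm (f z ^ n) \<le> (max 0 \<theta>) ^ n" if "z \<in> X" for n z
      unfolding norm_power using \<theta>(2)[OF that] by (intro power_mono) auto
  qed
  then have "pcl X (\<lambda>z. \<Sum>k. f z ^ k)"
    by (rule pcl_uniform_limit[rotated]) (intro pcl_sum pcl_power f)
  then show ?thesis
  proof (rule pcl_cong)
    fix z assume "z \<in> X"
    then have "norm (f z) < 1" using \<theta> by (rule_tac le_less_trans)
    then show "(\<Sum>k. f z ^ k) = 1 / (1 - f z)" by (rule suminf_geometric)
  qed
qed

text \<open>Runge's pole pushing. A pole far out on the ray gives a geometric series in \<phi>, and
  moving it inward by at most half the distance between ray and C costs another geometric series
  with ratio at most 1/2.\<close>

lemma pcl_pole_ray:
  assumes \<phi>: "pcl X \<phi>" and C: "compact C" "\<phi> ` X \<subseteq> C" and d: "norm d = 1"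
    and ray: "\<And>t::real. t \<ge> 0 \<Longrightarrow> \<zeta> + of_real t * d \<notin> C"
  shows "pcl X (\<lambda>z. 1 / (\<phi> z - \<zeta>))"
proof -
  define R where "R = {z. Im ((z - \<zeta>) * cnj d) = 0 \<and> Re ((z - \<zeta>) * cnj d) \<ge> 0}"
  have dd: "d * cnj d = 1" using d by (simp add: complex_norm_square[symmetric])
  have Rpt: "\<zeta> + of_real t * d \<in> R" if "t \<ge> 0" for t
  proof -
    have "(\<zeta> + of_real t * d - \<zeta>) * cnj d = of_real t" using dd by simp
    then show ?thesis using that unfolding R_def mem_Collect_eq by (simp only:) simp
  qed
  have "closed R" unfolding R_def by (intro closed_Collect_conj closed_Collect_eq closed_Collect_le continuous_intros)
  moreover have "C \<inter> R = {}"
  proof -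
    have "z \<notin> C" if "z \<in> R" for z
    proof -
      have "(z - \<zeta>) * cnj d = of_real (Re ((z - \<zeta>) * cnj d))" using that by (intro complex_eqI) (auto simp: R_def)
      then have "(z - \<zeta>) * (cnj d * d) = of_real (Re ((z - \<zeta>) * cnj d)) * d" by (metis mult.assoc)
      then have "z = \<zeta> + of_real (Re ((z - \<zeta>) * cnj d)) * d" using dd by (simp add: mult.commute[of "cnj d"] algebra_simps)
      then show ?thesis using ray[of "Re ((z - \<zeta>) * cnj d)"] that by (metis (no_types, lifting) R_def mem_Collect_eq)
    qed
    then show ?thesis by auto
  qed
  ultimately obtain e where e: "e > 0" "\<And>x y. x \<in> C \<Longrightarrow> y \<in> R \<Longrightarrow> e \<le> dist x y"
    using separate_compact_closed[OF C(1)] by metis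
  obtain B where B: "B > 0" "\<And>z. z \<in> X \<Longrightarrow> norm (\<phi> z) \<le> B" using pcl_bounded[OF \<phi>] by blast
  define P where "P = (\<lambda>t::real. pcl X (\<lambda>z. 1 / (\<phi> z - (\<zeta> + of_real t * d))))"
  \<comment> \<open>Then the starting pole has modulus at least 2 B, twice the bound for
    \<phi>.\<close>
  define T where "T = 2 * B + norm \<zeta>"
  have base: "P T"
  proof -
    define w where "w = \<zeta> + of_real T * d"
    have nw: "norm w \<ge> 2 * B"
    proof -
      have "norm (of_real T * d) \<le> norm w + norm \<zeta>" using norm_triangle_ineq4[of w \<zeta>] by (simp add: w_def)
      moreover have "norm (of_real T * d) = T" using d B unfolding norm_mult norm_of_real by (simp add: T_def)
      ultimately show ?thesis by (simp add: T_def)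
    qed
    have "pcl X (\<lambda>z. (- 1 / w) * (1 / (1 - (1/w) * \<phi> z)))"
    proof (intro pcl_mult pcl_const pcl_geometric[where \<theta> = "1/2"] \<phi>)
      fix z assume "z \<in> X"
      then have "norm (1 / w * \<phi> z) \<le> B / (2 * B)" unfolding norm_mult norm_divide norm_one times_divide_eq_left mult_1
        using B nw by (intro frac_le) auto
      then show "norm (1 / w * \<phi> z) \<le> 1 / 2" using B by simp
    qed simp
    moreover have "(- 1 / w) * (1 / (1 - (1/w) * \<phi> z)) = 1 / (\<phi> z - w)" if "z \<in> X" for z
    proof -
      have "w \<noteq> 0" using nw B by auto
      moreover have "\<phi> z \<noteq> w" using B(2)[OF that] nw B(1) by auto
      ultimately show ?thesis by (simp add: field_simps)
    qed
    ultimately show ?thesis unfolding P_def w_def[symmetric] by (rule pcl_cong)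
  qed
  \<comment> \<open>Expand 1 / (\<phi> - w') in powers of (w' - w) / (\<phi> - w).\<close>
  have step: "P t'" if t: "P t" "0 \<le> t'" "t' \<le> t" "t - t' \<le> e / 2" for t t'
  proof -
    define w where "w = \<zeta> + of_real t * d"
    define w' where "w' = \<zeta> + of_real t' * d"
    have far: "norm (\<phi> z - w) \<ge> e" "norm (\<phi> z - w') \<ge> e" if "z \<in> X" for z
      using e(2)[of "\<phi> z" w] e(2)[of "\<phi> z" w'] Rpt[of t] Rpt[of t'] C that t by (auto simp: w_def w'_def dist_norm)
    have ww: "norm (w' - w) \<le> e / 2"
    proof -
      have "w' - w = of_real (t' - t) * d" by (simp add: w_def w'_def algebra_simps)
      then have "norm (w' - w) = \<bar>t' - t\<bar>" using d by (simp only: norm_mult norm_of_real mult_1_right)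
      then show ?thesis using t by simp
    qed
    have "pcl X (\<lambda>z. (1 / (\<phi> z - w)) * (1 / (1 - (w' - w) * (1 / (\<phi> z - w)))))"
    proof (intro pcl_mult pcl_const pcl_geometric[where \<theta> = "1/2"])
      show "pcl X (\<lambda>z. 1 / (\<phi> z - w))" "pcl X (\<lambda>z. 1 / (\<phi> z - w))" using t unfolding P_def w_def by auto
      fix z assume z: "z \<in> X"
      have "norm ((w' - w) * (1 / (\<phi> z - w))) = norm (w' - w) / norm (\<phi> z - w)" by (simp add: norm_mult norm_divide)
      also have "\<dots> \<le> (e / 2) / e" using far[OF z] ww e by (intro frac_le) auto
      finally show "norm ((w' - w) * (1 / (\<phi> z - w))) \<le> 1 / 2" using e by simp
    qed simp
    moreover have "(1 / (\<phi> z - w)) * (1 / (1 - (w' - w) * (1 / (\<phi> z - w)))) = 1 / (\<phi> z - w')" if "z \<in> X" for z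
    proof -
      have "\<phi> z - w \<noteq> 0" "\<phi> z - w' \<noteq> 0" using far[OF that] e by auto
      then show ?thesis by (simp add: field_simps)
    qed
    ultimately show ?thesis unfolding P_def w'_def[symmetric] by (rule pcl_cong)
  qed
  have T0: "T \<ge> 0" using B by (simp add: T_def)
  have "P (max 0 (T - real n * (e / 2)))" for n
  proof (induction n)
    case 0 then show ?case using base T0 by simp
  next
    case (Suc n)
    show ?case by (rule step[OF Suc]) (use e in \<open>auto simp: max_def algebra_simps\<close>)
  qed
  moreover obtain n where "T / (e / 2) \<le> real n" using real_arch_simple by blast
  then have "max 0 (T - real n * (e / 2)) = 0" using e by (simp add: field_simps max_def)
  ultimately have "P 0" by metis
  then show ?thesis by (simp add: P_def)
qed

text \<open>The fundamental theorem of algebra splits off one root at a time, so only simple poles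
  have to be approximated.\<close>

lemma pcl_inverse_poly:
  assumes \<phi>: "pcl X \<phi>"
  shows "p \<noteq> 0 \<Longrightarrow> (\<And>\<zeta>. poly p \<zeta> = 0 \<Longrightarrow> pcl X (\<lambda>z. 1 / (\<phi> z - \<zeta>))) \<Longrightarrow> pcl X (\<lambda>z. 1 / poly p (\<phi> z))"
proof (induction "degree p" arbitrary: p)
  case 0
  then obtain c where "p = [:c:]" by (metis degree_eq_zeroE)
  then show ?case by (simp add: pcl_const)
next
  case (Suc n)
  obtain \<zeta> where \<zeta>: "poly p \<zeta> = 0"
    using alg_closed_imp_poly_has_root[of p] Suc.hyps(2) by auto
  then obtain r where r: "p = [:-\<zeta>, 1:] * r" by (metis dvdE poly_eq_0_iff_dvd)
  then have "r \<noteq> 0" using Suc.prems by auto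
  then have "degree p = Suc (degree r)" unfolding r by (subst degree_mult_eq) auto
  then have "n = degree r" using Suc.hyps(2) by simp
  have "pcl X (\<lambda>z. 1 / poly r (\<phi> z))"
    by (rule Suc.hyps(1)) (use \<open>n = degree r\<close> \<open>r \<noteq> 0\<close> Suc.prems(2) r in auto)
  then have "pcl X (\<lambda>z. (1 / (\<phi> z - \<zeta>)) * (1 / poly r (\<phi> z)))"
    by (intro pcl_mult Suc.prems(2) \<zeta>)
  moreover have "(1 / (\<phi> z - \<zeta>)) * (1 / poly r (\<phi> z)) = 1 / poly p (\<phi> z)" for z by (simp add: r algebra_simps)
  ultimately show ?case by simp
qed

end

section \<open>Polynomial convexity\<close>

lemma Re_inverse_complex: "Re (1 / z) = Re z / (norm z)^2"
  by (simp add: Re_divide cmod_power2)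

text \<open>For G = 1 / (1 + s - w) and F = 1 / (z - s^2) the two claims are |G|^2 + Re F \<le> 0
  and Re G - 1/2 + s Re F \<le> 0. At s = 0 and w \<noteq> 1, z \<noteq> 0 they are exactly the two
  conditions of \<open>horn\<close>. The second alternative for z is the disc with diameter [0, s^2]
  without its far end; it covers 0 and the discs closer to 0 than the pole.\<close>

lemma pole_bounds:
  fixes w z :: complex
  assumes w: "norm (w + 1) \<le> 2" and s: "s > 0"
    and z: "horn w z \<or> (norm z)^2 \<le> s^2 * Re z \<and> norm z < s^2"
  shows "(norm (1 / (of_real (1 + s) - w)))^2 + Re (1 / (z - of_real (s^2))) \<le> 0"
    and "Re (1 / (of_real (1 + s) - w)) - 1/2 + s * Re (1 / (z - of_real (s^2))) \<le> 0"
proof -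
  define p where "p = 1 - Re w"
  define d where "d = (norm (1 - w))^2"
  define D where "D = (norm (of_real (1 + s) - w))^2"
  define E where "E = (norm (z - of_real (s^2)))^2"
  have p: "p \<ge> 0" using complex_Re_le_cmod[of "w + 1"] w by (simp add: p_def)
  have d: "d \<ge> 0" by (simp add: d_def)
  have D: "D = d + 2 * s * p + s^2"
    unfolding D_def d_def p_def cmod_power2 by (simp add: power2_eq_square algebra_simps)
  have "2 * s * p \<ge> 0" using p s by simp
  then have Dge: "D \<ge> d + s^2" using D by simp
  have s2: "s^2 > 0" using s by simp
  have Dpos: "D > 0" using Dge d s2 by linarith
  have G: "(norm (1 / (of_real (1 + s) - w)))^2 = 1 / D" by (simp add: D_def norm_divide power_divide)
  have ReG: "Re (1 / (of_real (1 + s) - w)) = (p + s) / D"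
    unfolding Re_inverse_complex D_def p_def by simp
  have ReF: "- Re (1 / (z - of_real (s^2))) = (s^2 - Re z) / E"
    unfolding Re_inverse_complex E_def by (simp add: minus_divide_left)
  have Eeq: "E = (norm z)^2 - 2 * s^2 * Re z + s^2 * s^2"
    unfolding E_def cmod_power2 by (simp add: power2_eq_square algebra_simps)
  have E0: "E \<ge> 0" by (simp add: E_def)
  from z have "(norm (1 / (of_real (1 + s) - w)))^2 + Re (1 / (z - of_real (s^2))) \<le> 0 \<and>
     Re (1 / (of_real (1 + s) - w)) - 1/2 + s * Re (1 / (z - of_real (s^2))) \<le> 0"
  proof
    \<comment> \<open>Shifting both poles enlarges |1 - w|^2 to at least d + s^2 in G and makes -Re
      F at least 1 / (d + s^2), so the two shifts match. The surplus s Re F absorbs the s in the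
      numerator of Re G.\<close>
    assume h: "horn w z"
    have Rz: "Re z \<le> 0" "- Re z \<le> d" using horn_bounds[OF h w] by (auto simp: d_def)
    have hz: "(norm z)^2 \<le> - Re z * d" using h by (simp add: horn_def d_def)
    have "s^2 * (d + Re z) \<ge> 0" using Rz s2 by simp
    then have Ele: "E \<le> (s^2 - Re z) * (d + s^2)" using hz by (simp add: Eeq algebra_simps)
    have Epos: "E > 0"
    proof -
      have "z \<noteq> of_real (s^2)" using Rz s2 by auto
      then show ?thesis by (simp add: E_def)
    qed
    have Fge: "- Re (1 / (z - of_real (s^2))) \<ge> 1 / (d + s^2)"
    proof -
      have "d + s^2 > 0" using d s2 by linarith
      then show ?thesis unfolding ReF using Ele Epos by (simp add: pos_le_divide_eq pos_divide_le_eq mult.commute)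
    qed
    have "1 / D \<le> 1 / (d + s^2)" using Dge d s2 by (intro divide_left_mono mult_pos_pos Dpos) (auto simp: add_nonneg_pos)
    then have 1: "(norm (1 / (of_real (1 + s) - w)))^2 + Re (1 / (z - of_real (s^2))) \<le> 0"
      unfolding G using Fge by linarith
    have "(norm w)^2 = 1 - 2 * p + d" unfolding d_def p_def cmod_power2 by (simp add: power2_eq_square algebra_simps)
    moreover have "(norm w)^2 \<ge> 1^2" using h by (intro power_mono) (auto simp: horn_def)
    ultimately have pd: "p \<le> d / 2" by simp
    have "(p + s) / D \<le> (d / 2 + s) / (d + s^2)"
      using pd Dge d s s2 p by (intro frac_le) (auto simp: add_nonneg_pos)
    also have "\<dots> \<le> 1/2 + s * (1 / (d + s^2))"
    proof -
      have "d + s^2 > 0" using d s2 by linarith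
      then have "(d / 2) / (d + s^2) \<le> 1/2" using s2 by (subst pos_divide_le_eq) auto
      then show ?thesis by (simp add: add_divide_distrib)
    qed
    also have "\<dots> \<le> 1/2 + s * (- Re (1 / (z - of_real (s^2))))" using Fge s by (intro add_left_mono mult_left_mono) auto
    finally show ?thesis using 1 unfolding ReG by simp
  next
    \<comment> \<open>Here -Re F is at least 1 / s^2 while |G| is at most 1 / s, so F dominates
      whatever w is.\<close>
    assume h: "(norm z)^2 \<le> s^2 * Re z \<and> norm z < s^2"
    have Rz: "Re z < s^2" using h complex_Re_le_cmod[of z] by linarith
    have Epos: "E > 0"
    proof -
      have "z \<noteq> of_real (s^2)" using Rz by auto
      then show ?thesis by (simp add: E_def)
    qed
    have "E \<le> (s^2 - Re z) * s^2" using h by (simp add: Eeq algebra_simps)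
    then have Fge: "1 / s^2 \<le> - Re (1 / (z - of_real (s^2)))"
      unfolding ReF using Epos s2 by (simp add: pos_le_divide_eq pos_divide_le_eq)
    have Ds: "D \<ge> s^2" using Dge d by linarith
    have "1 / D \<le> 1 / s^2" using Ds s2 Dpos by (intro divide_left_mono) auto
    then have 1: "(norm (1 / (of_real (1 + s) - w)))^2 + Re (1 / (z - of_real (s^2))) \<le> 0"
      unfolding G using Fge by linarith
    have "(norm (1 / (of_real (1 + s) - w)))^2 \<le> (1 / s)^2"
      unfolding G using \<open>1 / D \<le> 1 / s^2\<close> by (simp add: power_divide)
    then have "norm (1 / (of_real (1 + s) - w)) \<le> 1 / s" by (rule power2_le_imp_le) (use s in simp)
    then have "Re (1 / (of_real (1 + s) - w)) \<le> 1 / s"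
      using complex_Re_le_cmod[of "1 / (of_real (1 + s) - w)"] by linarith
    also have "1 / s = s * (1 / s^2)" using s by (simp add: power2_eq_square)
    also have "\<dots> \<le> s * (- Re (1 / (z - of_real (s^2))))" using Fge s by (intro mult_left_mono) auto
    finally show ?thesis using 1 by simp
  qed
  then show "(norm (1 / (of_real (1 + s) - w)))^2 + Re (1 / (z - of_real (s^2))) \<le> 0"
    "Re (1 / (of_real (1 + s) - w)) - 1/2 + s * Re (1 / (z - of_real (s^2))) \<le> 0" by auto
qed

lemma mem_cball_minus_one: "b \<in> cball (-1) r \<longleftrightarrow> norm (b + 1 :: complex) \<le> r"
  using norm_minus_commute[of "-1" b] by (simp add: dist_norm)

text \<open>A compact set containing all z2-coordinates of K. A fibre of the horn is a disc of
  centre -h and radius h with h = |1 - w|^2 / 2 \<le> 8, hence inside the disc of centre -8 and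
  radius 8.\<close>

definition baseset :: "complex set" where
  "baseset = cball (-8) 8 \<union> zset"

lemma compact_baseset: "compact baseset"
proof -
  have "bounded zset" using zset_norm by (auto simp: bounded_iff)
  then show ?thesis unfolding baseset_def by (intro compact_Un) (auto simp: compact_eq_bounded_closed closed_zset)
qed

text \<open>All constituents of \<open>baseset\<close> are discs centred on the real axis.\<close>

lemma baseset_vertical_ray:
  assumes "\<zeta> \<notin> baseset"
  obtains d where "norm d = 1" "\<And>t::real. t \<ge> 0 \<Longrightarrow> \<zeta> + of_real t * d \<notin> baseset"
proof -
  define d where "d = (if Im \<zeta> \<ge> 0 then \<i> else -\<i>)"
  have inc: "norm (\<zeta> - of_real x) \<le> norm (\<zeta> + of_real t * d - of_real x)" if "t \<ge> 0" for t x
  proof -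
    have "(Im \<zeta>)^2 \<le> (Im (\<zeta> + of_real t * d))^2"
    proof (cases "Im \<zeta> \<ge> 0")
      case True
      then show ?thesis using that by (intro power_mono) (auto simp: d_def)
    next
      case False
      then have "(- Im \<zeta>)^2 \<le> (- Im \<zeta> + t)^2" using that by (intro power_mono) auto
      also have "(- Im \<zeta> + t)^2 = (Im (\<zeta> + of_real t * d))^2"
        using False by (simp add: d_def power2_commute)
      finally show ?thesis by simp
    qed
    moreover have "Re d = 0" by (simp add: d_def)
    ultimately have "(norm (\<zeta> - of_real x))^2 \<le> (norm (\<zeta> + of_real t * d - of_real x))^2"
      unfolding cmod_power2 by simp
    then show ?thesis by (rule power2_le_imp_le) simp
  qed
  show ?thesis
  proof (rule that)
    show "norm d = 1" by (simp add: d_def)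
    fix t :: real assume t: "t \<ge> 0"
    have disc: "\<zeta> + of_real t * d \<notin> cball (of_real x) r" if "\<zeta> \<notin> cball (of_real x) r" for x r
      using inc[OF t, of x] that by (simp add: dist_norm norm_minus_commute)
    have "\<zeta> + of_real t * d \<notin> cball (of_real (-8)) 8" by (rule disc) (use assms in \<open>simp add: baseset_def\<close>)
    moreover have "\<zeta> + of_real t * d \<notin> zdisc j" for j by (rule disc) (use assms in \<open>auto simp: baseset_def zset_def\<close>)
    moreover have "\<zeta> + of_real t * d \<notin> cball (of_real 0) 0" by (rule disc) (use assms in \<open>auto simp: baseset_def zset_def\<close>)
    ultimately show "\<zeta> + of_real t * d \<notin> baseset" by (simp add: baseset_def zset_def)
  qed
qed

lemma horn_in_cball: assumes "horn w z" "norm (w + 1) \<le> 2" shows "z \<in> cball (-8) 8"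
proof -
  have d: "(norm (1 - w))^2 \<le> 16" using power_mono[OF horn_bounds(3)[OF assms], of 2] by simp
  have "(norm z)^2 \<le> - Re z * (norm (1 - w))^2" using assms by (simp add: horn_def)
  also have "\<dots> \<le> - Re z * 16" using d horn_bounds(2)[OF assms] by (intro mult_left_mono) auto
  finally have "(norm (z + 8))^2 \<le> 8^2" unfolding cmod_power2 by (simp add: power2_eq_square algebra_simps)
  then have "norm (z + 8) \<le> 8" by (rule power2_le_imp_le) simp
  then show ?thesis using norm_minus_commute[of "-8" z] by (simp add: dist_norm)
qed

context two_axes
begin

lemma K_baseset: "z \<in> K \<Longrightarrow> z $ i2 \<in> baseset"
  using horn_in_cball by (auto simp: hornset_def baseset_def)

lemma K_nonempty: "K \<noteq> {}" using zero_in_K by blast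

text \<open>The first two claims use coordinate polynomials. For the third, if q2 is outside
  \<open>baseset\<close>, a polynomial p approximates 1 / (z2 - q2) on K so well that (z2 - q2) p -
  1 is at most 1/2 on K, whereas it equals -1 at q.\<close>

lemma hull_box:
  assumes q: "q \<in> polynomial_hull K"
  shows "norm (q $ i1 + 1) \<le> 2" "\<And>i. i \<noteq> i1 \<Longrightarrow> i \<noteq> i2 \<Longrightarrow> norm (q $ i) \<le> 1" "q $ i2 \<in> baseset"
proof -
  show "norm (q $ i1 + 1) \<le> 2"
    by (rule polynomial_hull_le[OF q K_nonempty]) (auto simp: hornset_def intro: complex_polynomial_add complex_polynomial_coord complex_polynomial_const)
  show "norm (q $ i) \<le> 1" if "i \<noteq> i1" "i \<noteq> i2" for i
    by (rule polynomial_hull_le[OF q K_nonempty]) (use that in \<open>auto simp: hornset_def intro: complex_polynomial_coord\<close>)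
  show "q $ i2 \<in> baseset"
  proof (rule ccontr)
    assume "q $ i2 \<notin> baseset"
    then obtain d where d: "norm d = 1" "\<And>t::real. t \<ge> 0 \<Longrightarrow> q $ i2 + of_real t * d \<notin> baseset"
      using baseset_vertical_ray by blast
    have "pcl K (\<lambda>z. 1 / (z $ i2 - q $ i2))"
      by (rule pcl_pole_ray[OF compact_K pcl_coord[OF compact_K] compact_baseset _ d]) (use K_baseset in auto)
    moreover define C where "C = 31 + norm (q $ i2)"
    have C: "C > 0" by (simp add: C_def add_pos_nonneg)
    then have "1 / (2 * C) > 0" by simp
    ultimately obtain p where p: "complex_polynomial p" "\<And>z. z \<in> K \<Longrightarrow> norm (1 / (z $ i2 - q $ i2) - p z) < 1 / (2 * C)"
      unfolding pcl_def by blast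
    have "norm ((q $ i2 + (- (q $ i2))) * p q + (-1)) \<le> 1/2"
    proof (rule polynomial_hull_le[OF q K_nonempty, of "\<lambda>z. (z $ i2 + (- (q $ i2))) * p z + (-1)"])
      show "complex_polynomial (\<lambda>z. (z $ i2 + (- (q $ i2))) * p z + (-1))"
        by (intro complex_polynomial_add complex_polynomial_mult complex_polynomial_coord complex_polynomial_const p)
      fix z assume z: "z \<in> K"
      have ne0: "z $ i2 - q $ i2 \<noteq> 0" using K_baseset[OF z] \<open>q $ i2 \<notin> baseset\<close> by auto
      have "(z $ i2 + (- (q $ i2))) * p z + (-1) = - ((z $ i2 - q $ i2) * (1 / (z $ i2 - q $ i2) - p z))"
        using ne0 by (simp add: right_diff_distrib)
      then have "norm ((z $ i2 + (- (q $ i2))) * p z + (-1)) = norm (z $ i2 - q $ i2) * norm (1 / (z $ i2 - q $ i2) - p z)"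
        by (simp only: norm_minus_cancel norm_mult)
      also have "\<dots> \<le> C * (1 / (2 * C))"
        using norm_triangle_ineq4[of "z $ i2" "q $ i2"] K_coord_bound[OF z, of i2] p(2)[OF z] C
        by (intro mult_mono) (auto simp: C_def)
      finally show "norm ((z $ i2 + (- (q $ i2))) * p z + (-1)) \<le> 1/2" using C by simp
    qed
    then show False by simp
  qed
qed

text \<open>The sign of Re f is known only near the horn, not on the discs up to index k. The factor
  1 / (1 + y^N) tends to 1 on the part with |y| \<le> \<theta> < 1 and to 0 on the part with |y|
  \<ge> \<Theta> > 1, so in the limit those discs drop out of the hull inequality for exp f.\<close>

lemma hull_cutoff:
  assumes q: "q \<in> polynomial_hull K" "q $ i2 \<in> cball (-8) 8" and k: "k \<ge> 1"
    and f: "pcl (insert q K) f"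
    and neg: "\<And>z. z \<in> K \<Longrightarrow> z $ i2 = 0 \<or> horn (z $ i1) (z $ i2) \<or> (\<exists>j>k. z $ i2 \<in> zdisc j) \<Longrightarrow> Re (f z) \<le> 0"
  shows "Re (f q) \<le> 0"
proof -
  define X where "X = insert q K"
  have X: "compact X" unfolding X_def by (rule compact_insert[OF compact_K])
  have base: "z $ i2 \<in> baseset" if "z \<in> X" for z
    using that K_baseset hull_box(3)[OF q(1)] by (auto simp: X_def)
  define \<sigma> where "\<sigma> = ctr k / 2"
  have \<sigma>: "\<sigma> > 0" using ctr_pos[of k] by (simp add: \<sigma>_def)
  \<comment> \<open>The circle of centre -8 and radius \<rho> crosses the positive axis at ctr k /
    2, in the gap between the (k+1)-st and the k-th disc.\<close>
  define \<rho> where "\<rho> = 8 + \<sigma>"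
  define \<theta> where "\<theta> = (8 + ctr k / 80) / \<rho>"
  define \<Theta> where "\<Theta> = (8 + 3/4 * ctr k) / \<rho>"
  have \<rho>: "\<rho> > 0" using \<sigma> by (simp add: \<rho>_def)
  have \<theta>: "0 < \<theta>" "\<theta> < 1" using \<rho> ctr_pos[of k] by (auto simp: \<theta>_def \<rho>_def \<sigma>_def add_pos_pos)
  have \<Theta>: "1 < \<Theta>" using \<rho> ctr_pos[of k] by (auto simp: \<Theta>_def \<rho>_def \<sigma>_def)
  define y where "y = (\<lambda>z::complex. (z + 8) / of_real \<rho>)"
  have ny: "norm (y z) = norm (z + 8) / \<rho>" for z using \<rho> by (simp add: y_def norm_divide)
  have near: "norm (y z) \<le> \<theta>" if "z = 0 \<or> z \<in> cball (-8) 8 \<or> (\<exists>j>k. z \<in> zdisc j)" for z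
  proof -
    have "norm (z + 8) \<le> 8 + ctr k / 80"
    proof -
      have c8: "norm (z + 8) \<le> 8" if "z \<in> cball (-8) 8"
        using that norm_minus_commute[of "-8" z] by (simp add: dist_norm)
      have inn: "norm (z + 8) \<le> 8 + ctr k / 80" if "j > k" "z \<in> zdisc j" for j
        using zdisc_inner(1)[OF k that] norm_triangle_ineq[of z 8] by simp
      show ?thesis using that c8 inn ctr_pos[of k] by auto
    qed
    then show ?thesis unfolding ny \<theta>_def using \<rho> by (intro divide_right_mono) auto
  qed
  have far: "norm (y z) \<ge> \<Theta>" if "j \<le> k" "z \<in> zdisc j" for z j
  proof -
    have "Re (z + 8) \<le> norm (z + 8)" by (rule complex_Re_le_cmod)
    then have "8 + 3/4 * ctr k \<le> norm (z + 8)" using zdisc_outer[OF k that] by simp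
    then show ?thesis unfolding ny \<Theta>_def using \<rho> by (intro divide_right_mono) auto
  qed
  have dich: "(z = (0::complex) \<or> z \<in> cball (-8) 8 \<or> (\<exists>j>k. z \<in> zdisc j)) \<or> (\<exists>j\<le>k. z \<in> zdisc j)" if "z \<in> baseset" for z
    using that by (auto simp: baseset_def zset_def) (meson not_le)+
  have ny1: "norm (y z) \<noteq> 1" if "z \<in> baseset" for z
    using dich[OF that] near[of z] far[of _ z] \<theta> \<Theta> by fastforce
  define cut where "cut = (\<lambda>N z. 1 / (1 + y (z $ i2) ^ N))"
  have pcut: "pcl X (cut N)" if N: "N \<ge> 1" for N
  proof -
    \<comment> \<open>The zeros of P lie on |y| = 1, a circle that misses \<open>baseset\<close>;
      hence every pole of the cutoff can be pushed to infinity along a vertical ray.\<close>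
    define P :: "complex poly" where "P = [:1:] + [:8 / of_real \<rho>, 1 / of_real \<rho>:] ^ N"
    have P: "poly P z = 1 + y z ^ N" for z
      by (simp add: P_def y_def add_divide_distrib add.commute)
    have root: "norm (y z) = 1" if "poly P z = 0" for z
    proof -
      have "y z ^ N = - 1" using that unfolding P by (simp add: add_eq_0_iff)
      then have "norm (y z) ^ N = 1" by (metis norm_power norm_minus_cancel norm_one)
      then show ?thesis using N power_eq_imp_eq_base[of "norm (y z)" N 1] by simp
    qed
    have "poly P (- 8) \<noteq> 0" using N by (simp add: P y_def zero_power)
    then have "P \<noteq> 0" by auto
    have "pcl X (\<lambda>z. 1 / poly P (z $ i2))"
    proof (rule pcl_inverse_poly[OF X pcl_coord[OF X] \<open>P \<noteq> 0\<close>])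
      fix \<zeta> assume "poly P \<zeta> = 0"
      then have "\<zeta> \<notin> baseset" using root ny1 by blast
      then obtain d where d: "norm d = 1" "\<And>t::real. t \<ge> 0 \<Longrightarrow> \<zeta> + of_real t * d \<notin> baseset"
        using baseset_vertical_ray by blast
      show "pcl X (\<lambda>z. 1 / (z $ i2 - \<zeta>))"
        by (rule pcl_pole_ray[OF X pcl_coord[OF X] compact_baseset _ d]) (use base in auto)
    qed
    then show ?thesis by (simp add: P cut_def)
  qed
  have "pcl X f" using f by (simp add: X_def)
  then have pe: "pcl X (\<lambda>z. exp (f z))" by (rule pcl_exp[OF X])
  obtain C where C: "C > 0" "\<And>z. z \<in> X \<Longrightarrow> norm (exp (f z)) \<le> C" using pcl_bounded[OF X pe] by blast
  have lo: "1 - t ^ N \<le> norm (1 + w ^ N)" "norm (1 + w ^ N) \<le> 1 + t ^ N" if "norm w \<le> t" for w :: complex and t N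
  proof -
    have "norm (w ^ N) \<le> t ^ N" unfolding norm_power using that by (intro power_mono) auto
    then show "1 - t ^ N \<le> norm (1 + w ^ N)" "norm (1 + w ^ N) \<le> 1 + t ^ N"
      using norm_triangle_ineq[of 1 "w ^ N"] norm_triangle_ineq4[of "1 + w ^ N" "w ^ N"] by auto
  qed
  have hi: "t ^ N - 1 \<le> norm (1 + w ^ N)" if "t \<le> norm w" "0 \<le> t" for w :: complex and t N
  proof -
    have "t ^ N \<le> norm (w ^ N)" unfolding norm_power using that by (intro power_mono) auto
    then show ?thesis using norm_triangle_ineq4[of "1 + w ^ N" 1] by simp
  qed
  have main: "exp (Re (f q)) \<le> (1 + \<theta> ^ N) * max (1 / (1 - \<theta> ^ N)) (C / (\<Theta> ^ N - 1))" if N: "N \<ge> 1" for N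
  proof -
    have tN: "\<theta> ^ N < 1" "\<Theta> ^ N > 1" using \<theta> \<Theta> N by (auto simp: power_less_one_iff)
    have "pcl (insert q K) (\<lambda>z. cut N z * exp (f z))" unfolding X_def[symmetric] by (intro pcl_mult[OF X] pcut pe N)
    then have "norm (cut N q * exp (f q)) \<le> max (1 / (1 - \<theta> ^ N)) (C / (\<Theta> ^ N - 1))"
    proof (rule pcl_hull[OF _ q(1) K_nonempty])
      fix z assume z: "z \<in> K"
      then have zX: "z \<in> X" by (simp add: X_def)
      consider "z $ i2 = 0 \<or> horn (z $ i1) (z $ i2) \<or> (\<exists>j>k. z $ i2 \<in> zdisc j)" | j where "j \<le> k" "z $ i2 \<in> zdisc j"
        using z by (auto simp: hornset_def zset_def) (meson not_le)+
      then show "norm (cut N z * exp (f z)) \<le> max (1 / (1 - \<theta> ^ N)) (C / (\<Theta> ^ N - 1))"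
      proof cases
        case 1
        then have "Re (f z) \<le> 0" by (rule neg[OF z])
        then have e: "norm (exp (f z)) \<le> 1" by simp
        have "z $ i2 = 0 \<or> z $ i2 \<in> cball (-8) 8 \<or> (\<exists>j>k. z $ i2 \<in> zdisc j)"
          using 1 horn_in_cball[of "z $ i1" "z $ i2"] z by (auto simp: hornset_def)
        then have "norm (y (z $ i2)) \<le> \<theta>" by (rule near)
        from lo(1)[OF this, of N] have "norm (cut N z) \<le> 1 / (1 - \<theta> ^ N)"
          unfolding cut_def norm_divide norm_one using tN by (intro divide_left_mono mult_pos_pos) auto
        then have "norm (cut N z * exp (f z)) \<le> 1 / (1 - \<theta> ^ N) * 1" unfolding norm_mult using e tN by (intro mult_mono) auto
        then show ?thesis by simp
      next
        case 2
        have "norm (y (z $ i2)) \<ge> \<Theta>" by (rule far[OF 2])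
        from hi[OF this, of N] have "norm (cut N z) \<le> 1 / (\<Theta> ^ N - 1)"
          unfolding cut_def norm_divide norm_one using tN \<Theta> by (intro divide_left_mono mult_pos_pos) auto
        then have "norm (cut N z * exp (f z)) \<le> 1 / (\<Theta> ^ N - 1) * C" unfolding norm_mult using C(2)[OF zX] tN by (intro mult_mono) auto
        then show ?thesis by simp
      qed
    qed
    moreover have "exp (Re (f q)) / (1 + \<theta> ^ N) \<le> norm (cut N q * exp (f q))"
    proof -
      have yq: "norm (y (q $ i2)) \<le> \<theta>" using q(2) by (intro near) auto
      have "norm (1 + y (q $ i2) ^ N) > 0" using lo(1)[OF yq, of N] tN by linarith
      then have "1 / (1 + \<theta> ^ N) \<le> norm (cut N q)"
        unfolding cut_def norm_divide norm_one using lo(2)[OF yq, of N] \<theta>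
        by (intro divide_left_mono mult_pos_pos) (auto simp: add_pos_pos)
      then have "1 / (1 + \<theta> ^ N) * norm (exp (f q)) \<le> norm (cut N q) * norm (exp (f q))" by (intro mult_right_mono) auto
      then show ?thesis by (simp add: norm_mult)
    qed
    ultimately have "exp (Re (f q)) / (1 + \<theta> ^ N) \<le> max (1 / (1 - \<theta> ^ N)) (C / (\<Theta> ^ N - 1))" by linarith
    moreover have "1 + \<theta> ^ N > 0" using \<theta> by (simp add: add_pos_pos)
    ultimately show ?thesis by (simp add: pos_divide_le_eq mult.commute)
  qed
  have lim1: "(\<lambda>N. \<theta> ^ N) \<longlonglongrightarrow> 0" using \<theta> by (auto intro: LIMSEQ_power_zero)
  have "(\<lambda>N. (1 / \<Theta>) ^ N) \<longlonglongrightarrow> 0" using \<Theta> by (intro LIMSEQ_power_zero) simp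
  then have "(\<lambda>N. C * (1 / \<Theta>) ^ N / (1 - (1 / \<Theta>) ^ N)) \<longlonglongrightarrow> C * 0 / (1 - 0)"
    by (intro tendsto_divide tendsto_mult tendsto_diff tendsto_const) auto
  moreover have "C * (1 / \<Theta>) ^ N / (1 - (1 / \<Theta>) ^ N) = C / (\<Theta> ^ N - 1)" for N
    using \<Theta> by (simp add: power_one_over divide_simps)
  ultimately have lim2: "(\<lambda>N. C / (\<Theta> ^ N - 1)) \<longlonglongrightarrow> 0" by simp
  have "(\<lambda>N. (1 + \<theta> ^ N) * max (1 / (1 - \<theta> ^ N)) (C / (\<Theta> ^ N - 1))) \<longlonglongrightarrow> (1 + 0) * max (1 / (1 - 0)) 0"
    by (intro tendsto_mult tendsto_add tendsto_const tendsto_max tendsto_divide tendsto_diff lim1 lim2) simp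
  then have "exp (Re (f q)) \<le> (1 + 0) * max (1 / (1 - 0)) 0"
    by (rule LIMSEQ_le_const) (use main in blast)
  then show ?thesis by simp
qed

lemma polynomially_convex_K: "polynomially_convex K"
  unfolding polynomially_convex_def
proof (intro equalityI subset_polynomial_hull compact_K subsetI)
  fix q assume q: "q \<in> polynomial_hull K"
  note box = hull_box[OF q]
  show "q \<in> K"
  proof (cases "q $ i2 \<in> zset")
    case True
    then show ?thesis using box by (auto simp: hornset_def)
  next
    case False
    then have q8: "q $ i2 \<in> cball (-8) 8" and q0: "q $ i2 \<noteq> 0" using box by (auto simp: baseset_def zset_def)
    define X where "X = insert q K"
    have X: "compact X" unfolding X_def by (rule compact_insert[OF compact_K])
    \<comment> \<open>The pole s^2 = ctr k / 2 lies in the gap after the k-th disc, and s tends to 0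
      with k.\<close>
    define s where "s = (\<lambda>k. sqrt (ctr k / 2))"
    have s: "s k > 0" "(s k)^2 = ctr k / 2" for k using ctr_pos[of k] by (auto simp: s_def)
    define G where "G = (\<lambda>k (z::complex^'n). 1 / (of_real (1 + s k) - z $ i1))"
    define F where "F = (\<lambda>k (z::complex^'n). 1 / (z $ i2 - of_real ((s k)^2)))"
    have pG: "pcl X (G k)" for k
    proof -
      have "pcl X (\<lambda>z. 1 / (z $ i1 - of_real (1 + s k)))"
      proof (rule pcl_pole_ray[OF X pcl_coord[OF X], where C = "cball (-1) 2" and d = 1])
        show "(\<lambda>z. z $ i1) ` X \<subseteq> cball (-1) 2"
          using box(1) unfolding mem_cball_minus_one image_subset_iff by (auto simp: X_def hornset_def)
        fix t :: real assume "t \<ge> 0"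
        then show "complex_of_real (1 + s k) + of_real t * 1 \<notin> cball (-1) 2"
          using s(1)[of k] complex_Re_le_cmod[of "of_real (1 + s k) + of_real t * 1 + 1"]
          by (simp only: mem_cball_minus_one not_le) simp
      qed auto
      then have "pcl X (\<lambda>z. (-1) * (1 / (z $ i1 - of_real (1 + s k))))" by (intro pcl_mult pcl_const X)
      moreover have "(-1) * (1 / (z $ i1 - of_real (1 + s k))) = G k z" for z
        unfolding G_def by (metis minus_diff_eq minus_divide_right mult_minus1)
      ultimately show ?thesis by simp
    qed
    have not_base: "of_real ((s k)^2) \<notin> baseset" if k: "k \<ge> 1" for k
    proof
      assume "of_real ((s k)^2) \<in> baseset"
      then have "complex_of_real (ctr k / 2) \<in> baseset" unfolding s(2) .
      moreover have "complex_of_real (ctr k / 2) \<notin> cball (-8) 8"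
        using ctr_pos[of k] complex_Re_le_cmod[of "of_real (ctr k / 2) + 8"] norm_minus_commute[of "-8" "complex_of_real (ctr k / 2)"]
        by (auto simp: dist_norm)
      moreover have "complex_of_real (ctr k / 2) \<notin> zdisc j" for j
      proof
        assume j: "complex_of_real (ctr k / 2) \<in> zdisc j"
        show False
        proof (cases "j \<le> k")
          case True
          then show False using zdisc_outer[OF k True j] ctr_pos[of k] by simp
        next
          case False
          then have "norm (complex_of_real (ctr k / 2)) \<le> ctr k / 80" using zdisc_inner(1)[OF k _ j] by simp
          then show False using ctr_pos[of k] by (simp only: norm_of_real)
        qed
      qed
      ultimately show False using ctr_pos[of k] by (auto simp: baseset_def zset_def)
    qed
    have pF: "pcl X (F k)" if k: "k \<ge> 1" for k
    proof -
      obtain d where d: "norm d = 1" "\<And>t::real. t \<ge> 0 \<Longrightarrow> of_real ((s k)^2) + of_real t * d \<notin> baseset"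
        using baseset_vertical_ray[OF not_base[OF k]] by blast
      show ?thesis unfolding F_def
        by (rule pcl_pole_ray[OF X pcl_coord[OF X] compact_baseset _ d]) (use K_baseset box in \<open>auto simp: X_def\<close>)
    qed
    have bounds: "(norm (G k z))^2 + Re (F k z) \<le> 0" "Re (G k z) - 1/2 + s k * Re (F k z) \<le> 0"
      if k: "k \<ge> 1" and z: "z \<in> K" "z $ i2 = 0 \<or> horn (z $ i1) (z $ i2) \<or> (\<exists>j>k. z $ i2 \<in> zdisc j)" for k z
    proof -
      have "horn (z $ i1) (z $ i2) \<or> (norm (z $ i2))^2 \<le> (s k)^2 * Re (z $ i2) \<and> norm (z $ i2) < (s k)^2"
        using z(2)
      proof (elim disjE exE conjE)
        assume "z $ i2 = 0" then show ?thesis using ctr_pos[of k] by (simp add: s)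
      next
        fix j assume j: "j > k" "z $ i2 \<in> zdisc j"
        note in3 = zdisc_inner[OF k j]
        have "(norm (z $ i2))^2 \<le> (ctr k / 80) * (5/4 * ctr j)"
          unfolding power2_eq_square using in3 ctr_pos[of k] by (intro mult_mono) auto
        also have "\<dots> \<le> (ctr k / 2) * (3/4 * ctr j)" using ctr_pos[of k] ctr_pos[of j] by simp
        also have "\<dots> \<le> (ctr k / 2) * Re (z $ i2)" using in3 ctr_pos[of k] by (intro mult_left_mono) auto
        finally show ?thesis using in3 ctr_pos[of k] by (simp add: s)
      qed auto
      moreover have "norm (z $ i1 + 1) \<le> 2" using z by (simp add: hornset_def)
      ultimately show "(norm (G k z))^2 + Re (F k z) \<le> 0" "Re (G k z) - 1/2 + s k * Re (F k z) \<le> 0"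
        unfolding G_def F_def using pole_bounds[of "z $ i1" "s k" "z $ i2"] s(1)[of k] by blast+
    qed
    have s0: "s \<longlonglongrightarrow> 0"
    proof -
      have "(\<lambda>k. sqrt (ctr k / 2)) \<longlonglongrightarrow> sqrt (0 / 2)" by (intro tendsto_intros ctr_tendsto_0) auto
      then show ?thesis by (simp add: s_def[abs_def])
    qed
    have A: "Re (G k q) - 1/2 + s k * Re (F k q) \<le> 0" if k: "k \<ge> 1" for k
    proof -
      have "Re (G k q + (-1/2) + of_real (s k) * F k q) \<le> 0"
      proof (rule hull_cutoff[OF q q8 k])
        show "pcl (insert q K) (\<lambda>z. G k z + (-1/2) + of_real (s k) * F k z)"
          unfolding X_def[symmetric] by (intro pcl_add pcl_mult pcl_const pG pF k X)
        fix z assume "z \<in> K" "z $ i2 = 0 \<or> horn (z $ i1) (z $ i2) \<or> (\<exists>j>k. z $ i2 \<in> zdisc j)"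
        from bounds(2)[OF k this] show "Re (G k z + (-1/2) + of_real (s k) * F k z) \<le> 0" by simp
      qed
      then show ?thesis by simp
    qed
    have Bd: "(norm (G k q))^2 + Re (F k q) \<le> 0" if k: "k \<ge> 1" for k
    proof -
      \<comment> \<open>|G|^2 is not the real part of a holomorphic function. It is replaced by its
        tangent 2 Re (cnj c G) - |c|^2, which lies below it everywhere and agrees with it at
        q.\<close>
      define c where "c = G k q"
      have sqd: "Re (2 * cnj c * g) - (norm c)^2 \<le> (norm g)^2" for g
      proof -
        have "0 \<le> (norm (g - c))^2" by simp
        also have "\<dots> = (norm g)^2 - Re (2 * cnj c * g) + (norm c)^2"
          unfolding cmod_power2 by (simp add: power2_eq_square algebra_simps)
        finally show ?thesis by simp
      qed
      have "Re (2 * cnj c * G k q + (- of_real ((norm c)^2)) + F k q) \<le> 0"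
      proof (rule hull_cutoff[OF q q8 k])
        show "pcl (insert q K) (\<lambda>z. 2 * cnj c * G k z + (- of_real ((norm c)^2)) + F k z)"
          unfolding X_def[symmetric] by (intro pcl_add pcl_mult pcl_const pG pF k X)
        fix z assume "z \<in> K" "z $ i2 = 0 \<or> horn (z $ i1) (z $ i2) \<or> (\<exists>j>k. z $ i2 \<in> zdisc j)"
        from bounds(1)[OF k this] sqd[of "G k z"]
        show "Re (2 * cnj c * G k z + (- of_real ((norm c)^2)) + F k z) \<le> 0" by simp
      qed
      moreover have "Re (2 * cnj c * c) = 2 * (norm c)^2" unfolding cmod_power2 by (simp add: power2_eq_square)
      ultimately show ?thesis unfolding c_def by simp
    qed
    \<comment> \<open>By contradiction, since |q1| < 1 guarantees q1 \<noteq> 1 and the limit of G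
      exists. It gives Re (1 / (1 - q1)) \<le> 1/2, the same as |q1| \<ge> 1.\<close>
    have "norm (q $ i1) \<ge> 1"
    proof (rule ccontr)
      assume n: "\<not> norm (q $ i1) \<ge> 1"
      then have q1: "q $ i1 \<noteq> 1" by auto
      have "(\<lambda>k. Re (G k q) - 1/2 + s k * Re (F k q)) \<longlonglongrightarrow> Re (1 / (of_real (1 + 0) - q $ i1)) - 1/2 + 0 * Re (1 / (q $ i2 - of_real (0^2)))"
        unfolding G_def F_def using q0 q1 by (intro tendsto_intros s0) auto
      then have "Re (1 / (of_real (1 + 0) - q $ i1)) - 1/2 + 0 * Re (1 / (q $ i2 - of_real (0^2))) \<le> 0"
        by (rule LIMSEQ_le_const2) (use A in blast)
      then have "Re (1 / (1 - q $ i1)) \<le> 1/2" by simp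
      then have "Re (1 - q $ i1) / (norm (1 - q $ i1))^2 \<le> 1/2" by (simp only: Re_inverse_complex)
      moreover have "(norm (1 - q $ i1))^2 > 0" using q1 by simp
      ultimately have "2 * Re (1 - q $ i1) \<le> (norm (1 - q $ i1))^2" by (simp add: pos_divide_le_eq)
      then have "1^2 \<le> (norm (q $ i1))^2" unfolding cmod_power2 by (simp add: power2_eq_square algebra_simps)
      then have "1 \<le> norm (q $ i1)" by (rule power2_le_imp_le) simp
      then show False using n by simp
    qed
    moreover have "(norm (q $ i2))^2 + Re (q $ i2) * (norm (1 - q $ i1))^2 \<le> 0"
    proof -
      \<comment> \<open>The denominators are cleared before the limit, because q1 = 1 is still
        possible here.\<close>
      have B: "(norm (q $ i2 - of_real ((s k)^2)))^2 + Re (q $ i2 - of_real ((s k)^2)) * (norm (of_real (1 + s k) - q $ i1))^2 \<le> 0"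
        if k: "k \<ge> 1" for k
      proof -
        define D where "D = (norm (of_real (1 + s k) - q $ i1))^2"
        define E where "E = (norm (q $ i2 - of_real ((s k)^2)))^2"
        have "q $ i2 \<noteq> of_real ((s k)^2)" using not_base[OF k] box(3) by auto
        then have E: "E > 0" by (simp add: E_def)
        have "Re (of_real (1 + s k) - q $ i1) > 0" using s(1)[of k] complex_Re_le_cmod[of "q $ i1 + 1"] box(1) by simp
        then have "of_real (1 + s k) - q $ i1 \<noteq> 0" by (metis less_irrefl zero_complex.sel(1))
        then have D: "D > 0" unfolding D_def by (simp only: zero_less_power2 norm_eq_zero not_False_eq_True)
        have "1 / D + Re (q $ i2 - of_real ((s k)^2)) / E \<le> 0"
          using Bd[OF k] unfolding G_def F_def Re_inverse_complex D_def E_def by (simp only: norm_divide norm_one power_divide one_power2)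
        then have "(1 / D + Re (q $ i2 - of_real ((s k)^2)) / E) * (D * E) \<le> 0" using D E by (intro mult_nonpos_nonneg) auto
        moreover have "(1 / D + r / E) * (D * E) = E + r * D" for r using D E by (simp add: field_simps)
        ultimately show ?thesis unfolding D_def[symmetric] E_def[symmetric] by simp
      qed
      have "(\<lambda>k. (norm (q $ i2 - of_real ((s k)^2)))^2 + Re (q $ i2 - of_real ((s k)^2)) * (norm (of_real (1 + s k) - q $ i1))^2)
         \<longlonglongrightarrow> (norm (q $ i2 - of_real (0^2)))^2 + Re (q $ i2 - of_real (0^2)) * (norm (of_real (1 + 0) - q $ i1))^2"
        by (intro tendsto_intros s0)
      then have "(norm (q $ i2 - of_real (0^2)))^2 + Re (q $ i2 - of_real (0^2)) * (norm (of_real (1 + 0) - q $ i1))^2 \<le> 0"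
        by (rule LIMSEQ_le_const2) (use B in blast)
      then show ?thesis by simp
    qed
    ultimately have "horn (q $ i1) (q $ i2)" by (simp add: horn_def)
    then show ?thesis using box by (auto simp: hornset_def)
  qed
qed

end

section \<open>Vanishing of the extremal function\<close>

lemma max_0_ln: "(x::real) \<ge> 0 \<Longrightarrow> max 0 (ln x) = ln (max 1 x)"
proof (cases "x \<le> 1")
  case True
  moreover assume "x \<ge> 0"
  ultimately have "ln x \<le> 0" by (cases "x = 0") auto
  then show ?thesis using True by (simp add: max_def)
qed (auto simp: max_def)

lemma max_0_ln_le: "(x::real) \<ge> 0 \<Longrightarrow> max 0 (ln x) \<le> max 0 (x - 1)"
  using ln_le_minus_one[of x] by (cases "x = 0") auto

lemma lelong_const: "\<delta> \<ge> 0 \<Longrightarrow> (\<lambda>z::complex^'n. ereal c) \<in> lelong \<delta>"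
proof -
  assume d: "\<delta> \<ge> 0"
  have "c \<le> \<delta> * log_plus (norm z) + c" for z :: "complex^'n" using d log_plus_nonneg[of "norm z"] by simp
  then show ?thesis using cpsh_imp_psh[OF cpsh_const, of c] by (auto simp: lelong_def intro!: exI[of _ c])
qed

lemma extremal_le:
  assumes "\<And>u. u \<in> lelong \<delta> \<Longrightarrow> (\<And>w. w \<in> K \<Longrightarrow> u w \<le> ereal (\<psi> w)) \<Longrightarrow> u z \<le> x"
  shows "extremal \<delta> K \<psi> z \<le> x"
  unfolding extremal_def using assms by (intro SUP_least) blast

lemma extremal_ge:
  assumes "u \<in> lelong \<delta>" "\<And>w. w \<in> K \<Longrightarrow> u w \<le> ereal (\<psi> w)"
  shows "u z \<le> extremal \<delta> K \<psi> z"
  unfolding extremal_def using assms by (intro SUP_upper2) auto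

lemma extremal_reg_zeroI:
  assumes "\<And>e::real. e > 0 \<Longrightarrow> \<forall>\<^sub>F z in nhds w. extremal 1 K (\<lambda>_. 0) z \<le> ereal e"
  shows "extremal_reg 1 K (\<lambda>_. 0) w = 0"
proof (rule antisym)
  show "extremal_reg 1 K (\<lambda>_. 0) w \<le> 0"
    unfolding extremal_reg_def usc_reg_def
    by (rule ereal_le_epsilon2) (use Limsup_bounded[OF assms] in simp)
  have "ereal 0 \<le> extremal 1 K (\<lambda>_. 0) z" for z
    by (rule extremal_ge[OF lelong_const]) auto
  then show "0 \<le> extremal_reg 1 K (\<lambda>_. 0) w"
    unfolding extremal_reg_def usc_reg_def by (intro le_Limsup) (auto simp: zero_ereal_def)
qed

text \<open>A polydisc inside K bounds all competitors by one continuous function. This is why the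
  bound holds on a whole neighbourhood, as the regularization demands.\<close>

lemma extremal_box:
  fixes w c :: "complex^'n"
  assumes \<rho>: "\<And>i. \<rho> i > 0" and box: "\<And>z. (\<And>i. norm (z $ i - c $ i) \<le> \<rho> i) \<Longrightarrow> z \<in> K"
    and w: "(\<Sum>i\<in>UNIV. max 0 (ln (norm (w $ i - c $ i) / \<rho> i))) < e"
  shows "\<forall>\<^sub>F z in nhds w. extremal 1 K (\<lambda>_. 0) z \<le> ereal e"
proof -
  define \<Phi> where "\<Phi> = (\<lambda>z::complex^'n. \<Sum>i\<in>UNIV. max 0 (ln (norm (z $ i - c $ i) / \<rho> i)))"
  have eq: "\<Phi> = (\<lambda>z. \<Sum>i\<in>UNIV. ln (max 1 (norm (z $ i - c $ i) / \<rho> i)))"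
    unfolding \<Phi>_def using \<rho> by (intro ext sum.cong refl max_0_ln) (simp add: less_imp_le)
  have "continuous_on UNIV \<Phi>" unfolding eq using \<rho>
    by (intro continuous_on_sum continuous_on_ln continuous_on_max continuous_on_divide continuous_on_norm continuous_on_diff continuous_on_const continuous_on_component continuous_on_id) (auto simp: less_imp_neq[THEN not_sym])
  then have "isCont \<Phi> w" by (simp add: continuous_on_eq_continuous_at)
  then have "(\<Phi> \<longlongrightarrow> \<Phi> w) (nhds w)" by (simp add: isCont_def tendsto_nhds_iff)
  then have "\<forall>\<^sub>F z in nhds w. \<Phi> z < e" by (rule order_tendstoD(2)) (use w in \<open>simp add: \<Phi>_def\<close>)
  then show ?thesis
  proof eventually_elim
    case (elim z)
    show ?case
    proof (rule extremal_le)
      fix u assume u: "u \<in> lelong 1" "\<And>w. w \<in> K \<Longrightarrow> u w \<le> ereal 0"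
      have "u z \<le> ereal (0 + 1 * (\<Sum>i\<in>UNIV. max 0 (ln (norm (z $ i - c $ i) / \<rho> i))))"
        by (rule lelong_bernstein_walsh_polydisc[OF u(1)]) (use \<rho> box u in auto)
      also have "\<dots> \<le> ereal e" using elim by (simp add: \<Phi>_def)
      finally show "u z \<le> ereal e" .
    qed
  qed
qed

text \<open>If |w| > 1, take a small disc on the segment from w to -1; if |w| = 1, one on the ray
  from 0 through w. At the cusp w = 1 no disc fits into the crescent, so that point needs a separate
  argument.\<close>

lemma crescent_disc:
  fixes w :: complex
  assumes w: "norm w \<ge> 1" "norm (w + 1) \<le> 2" "w \<noteq> 1" and W: "open W" "w \<in> W"
  obtains c \<rho> where "\<rho> > 0" "w \<in> cball c \<rho>" "cball c \<rho> \<subseteq> W" "\<And>z. z \<in> cball c \<rho> \<Longrightarrow> norm z \<ge> 1 \<and> norm (z + 1) \<le> 2"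
proof (cases "norm w > 1")
  case True
  have "open (W \<inter> {z. norm z > 1})" by (intro open_Int W open_Collect_less continuous_intros)
  then obtain r where r: "r > 0" "ball w r \<subseteq> W \<inter> {z. norm z > 1}" using W True open_contains_ball by blast
  define s where "s = min 1 (r / 4)"
  have s: "0 < s" "s \<le> 1" "s \<le> r / 4" using r by (auto simp: s_def)
  have w1: "norm (w + 1) > 0" using True by (metis norm_minus_cancel norm_one less_irrefl zero_less_norm_iff add_eq_0_iff2)
  define \<rho> where "\<rho> = s / 2 * norm (w + 1)"
  define c where "c = w - of_real (s/2) * (w + 1)"
  have cw: "norm (w - c) = \<rho>" using s by (simp add: c_def \<rho>_def norm_mult)
  have \<rho>r: "2 * \<rho> < r"
  proof -
    have "2 * \<rho> \<le> s * 2" unfolding \<rho>_def using w s by simp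
    then show ?thesis using s r by simp
  qed
  show ?thesis
  proof (rule that)
    show "\<rho> > 0" using s w1 by (simp add: \<rho>_def)
    show "w \<in> cball c \<rho>" using cw by (simp add: dist_norm norm_minus_commute)
    have sub: "cball c \<rho> \<subseteq> ball w r"
    proof
      fix z assume "z \<in> cball c \<rho>"
      then show "z \<in> ball w r" using cw \<rho>r norm_triangle_ineq[of "w - c" "c - z"] by (simp add: dist_norm)
    qed
    then show "cball c \<rho> \<subseteq> W" using r by blast
    fix z assume z: "z \<in> cball c \<rho>"
    have "norm z > 1" using z sub r by auto
    moreover have "norm (z + 1) \<le> 2"
    proof -
      have "norm (c + 1) = (1 - s/2) * norm (w + 1)"
      proof -
        have "c + 1 = of_real (1 - s/2) * (w + 1)" by (simp add: c_def algebra_simps)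
        then show ?thesis using s by (simp only: norm_mult norm_of_real; simp)
      qed
      moreover have "norm (z + 1) \<le> norm (z - c) + norm (c + 1)" using norm_triangle_ineq[of "z - c" "c + 1"] by simp
      moreover have "norm (z - c) \<le> \<rho>" using z by (simp add: dist_norm norm_minus_commute)
      ultimately have "norm (z + 1) \<le> norm (w + 1)" by (simp add: \<rho>_def algebra_simps)
      then show ?thesis using w by simp
    qed
    ultimately show "norm z \<ge> 1 \<and> norm (z + 1) \<le> 2" by simp
  qed
next
  case False
  then have nw: "norm w = 1" using w by simp
  have "norm (w + 1) < 2"
  proof (rule power2_less_imp_less)
    have n: "(Re w)^2 + (Im w)^2 = 1" using nw by (metis cmod_power2 one_power2)
    have "Re w < 1"
    proof (rule ccontr)
      assume "\<not> Re w < 1"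
      then have "Re w = 1" using complex_Re_le_cmod[of w] nw by simp
      then have "Im w = 0" using n by simp
      then show False using \<open>Re w = 1\<close> w by (simp add: complex_eq_iff)
    qed
    then show "(norm (w + 1))^2 < 2^2" unfolding cmod_power2 using n by (simp add: power2_eq_square algebra_simps)
  qed simp
  moreover have "open (W \<inter> {z. norm (z + 1) < 2})" by (intro open_Int W open_Collect_less continuous_intros)
  ultimately obtain r where r: "r > 0" "ball w r \<subseteq> W \<inter> {z. norm (z + 1) < 2}" using W open_contains_ball by blast
  define s where "s = r / 4"
  have s: "s > 0" using r by (simp add: s_def)
  define c where "c = w + of_real s * w"
  have cw: "norm (w - c) = s" using s nw by (simp add: c_def norm_mult)
  show ?thesis
  proof (rule that)
    show "s > 0" by fact
    show "w \<in> cball c s" using cw by (simp add: dist_norm norm_minus_commute)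
    have sub: "cball c s \<subseteq> ball w r"
    proof
      fix z assume "z \<in> cball c s"
      then show "z \<in> ball w r" using cw s norm_triangle_ineq[of "w - c" "c - z"] r(1) by (simp add: dist_norm s_def)
    qed
    then show "cball c s \<subseteq> W" using r by blast
    fix z assume z: "z \<in> cball c s"
    have "norm c = 1 + s"
    proof -
      have "c = of_real (1 + s) * w" by (simp add: c_def algebra_simps)
      then show ?thesis using nw s by (simp only: norm_mult norm_of_real; simp)
    qed
    moreover have "norm c \<le> norm (c - z) + norm z" using norm_triangle_ineq[of "c - z" z] by simp
    ultimately have "norm z \<ge> 1" using z by (simp add: dist_norm)
    moreover have "z \<in> W \<inter> {z. norm (z + 1) < 2}" using z sub r(2) by blast
    ultimately show "norm z \<ge> 1 \<and> norm (z + 1) \<le> 2" by simp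
  qed
qed

context two_axes
begin

lemma box_sum: "(\<Sum>i\<in>UNIV. f i) = f i1 + f i2 + (\<Sum>i\<in>UNIV - {i1, i2}. (f i :: real))"
proof -
  have "(\<Sum>i\<in>UNIV. f i) = (\<Sum>i\<in>UNIV - {i1, i2}. f i) + (\<Sum>i\<in>{i1, i2}. f i)"
    by (rule sum.subset_diff) auto
  then show ?thesis using ne by simp
qed

lemma sum_tail_0:
  assumes "\<And>i. i \<noteq> i1 \<Longrightarrow> i \<noteq> i2 \<Longrightarrow> norm (w $ i) \<le> 1"
  shows "(\<Sum>i\<in>UNIV - {i1, i2}. max 0 (ln (norm (w $ i)))) = 0"
proof (rule sum.neutral, rule ballI)
  fix i assume "i \<in> UNIV - {i1, i2}"
  then have "norm (w $ i) \<le> 1" using assms by auto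
  then show "max 0 (ln (norm (w $ i))) = 0" by (simp add: max_0_ln)
qed

lemma regular_disc:
  assumes w: "w \<in> K" "w $ i2 \<in> zdisc j"
  shows "extremal_reg 1 K (\<lambda>_. 0) w = 0"
proof (rule extremal_reg_zeroI)
  fix e :: real assume e: "e > 0"
  define c :: "complex^'n" where "c = (\<chi> i. if i = i1 then -1 else if i = i2 then of_real (ctr j) else 0)"
  define \<rho> where "\<rho> = (\<lambda>i. if i = i1 then 2 else if i = i2 then rad j else 1)"
  show "\<forall>\<^sub>F z in nhds w. extremal 1 K (\<lambda>_. 0) z \<le> ereal e"
  proof (rule extremal_box)
    show "\<rho> i > 0" for i using rad_pos[of j] by (simp add: \<rho>_def)
    fix z :: "complex^'n" assume z: "\<And>i. norm (z $ i - c $ i) \<le> \<rho> i"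
    have "norm (z $ i1 + 1) \<le> 2" using z[of i1] by (simp add: c_def \<rho>_def)
    moreover have "z $ i2 \<in> zdisc j" using z[of i2] ne by (simp add: c_def \<rho>_def dist_norm norm_minus_commute)
    moreover have "norm (z $ i) \<le> 1" if "i \<noteq> i1" "i \<noteq> i2" for i using z[of i] that by (simp add: c_def \<rho>_def)
    ultimately show "z \<in> K" by (auto simp: hornset_def zset_def)
  next
    have a: "max 0 (ln (norm (w $ i - c $ i) / \<rho> i)) = 0" for i
    proof -
      have "norm (w $ i - c $ i) \<le> \<rho> i" using w by (auto simp: c_def \<rho>_def hornset_def dist_norm norm_minus_commute)
      moreover have "\<rho> i > 0" using rad_pos[of j] by (simp add: \<rho>_def)
      ultimately show ?thesis by (simp add: max_0_ln)
    qed
    show "(\<Sum>i\<in>UNIV. max 0 (ln (norm (w $ i - c $ i) / \<rho> i))) < e" unfolding a using e by simp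
  qed
qed

lemma horn_mono:
  assumes "norm t \<ge> 1" "h \<le> (norm (1 - t))^2 / 2" "norm (z + of_real h) \<le> h"
  shows "horn t z"
proof -
  define g where "g = (norm (1 - t))^2 / 2"
  have "z + of_real g = (z + of_real h) + of_real (g - h)" by simp
  then have "norm (z + of_real g) \<le> norm (z + of_real h) + norm (complex_of_real (g - h))"
    by (metis norm_triangle_ineq)
  also have "norm (complex_of_real (g - h)) = g - h" using assms by (simp only: norm_of_real g_def; simp)
  finally have "norm (z + of_real g) \<le> g" using assms by simp
  then show ?thesis using assms unfolding horn_disc g_def by blast
qed

text \<open>A polydisc in K needs one fibre disc valid for all nearby z1, so the radius h over w is
  reduced to m. The point w may then be slightly outside the polydisc, at a small logarithmic
  cost.\<close>

lemma regular_horn: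
  assumes w: "w \<in> K" "horn (w $ i1) (w $ i2)" "w $ i1 \<noteq> 1"
  shows "extremal_reg 1 K (\<lambda>_. 0) w = 0"
proof (rule extremal_reg_zeroI)
  fix e :: real assume e: "e > 0"
  define h where "h = (norm (1 - w $ i1))^2 / 2"
  have h: "h > 0" using w by (simp add: h_def)
  \<comment> \<open>Chosen so that 2 h - m = m (1 + e / 2): the distance of w2 from the new centre
    exceeds m by a factor at most 1 + e / 2.\<close>
  define m where "m = h / (1 + e / 4)"
  have m: "0 < m" "m < h" using h e by (auto simp: m_def divide_less_eq)
  define W :: "complex set" where "W = {t. m < (norm (1 - t))^2 / 2}"
  have W: "open W" unfolding W_def by (intro open_Collect_less continuous_intros) auto
  have wW: "w $ i1 \<in> W" using m by (simp add: W_def h_def)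
  have w': "norm (w $ i1) \<ge> 1" "norm (w $ i1 + 1) \<le> 2" using w by (auto simp: hornset_def horn_def)
  obtain c0 r where r: "r > 0" "w $ i1 \<in> cball c0 r" "cball c0 r \<subseteq> W"
    "\<And>z. z \<in> cball c0 r \<Longrightarrow> norm z \<ge> 1 \<and> norm (z + 1) \<le> 2"
    by (rule crescent_disc[OF w' w(3) W wW]) (rule that)
  define c :: "complex^'n" where "c = (\<chi> i. if i = i1 then c0 else if i = i2 then - of_real m else 0)"
  define \<rho> where "\<rho> = (\<lambda>i. if i = i1 then r else if i = i2 then m else 1)"
  show "\<forall>\<^sub>F z in nhds w. extremal 1 K (\<lambda>_. 0) z \<le> ereal e"
  proof (rule extremal_box)
    show "\<rho> i > 0" for i using r m by (simp add: \<rho>_def)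
    fix z :: "complex^'n" assume z: "\<And>i. norm (z $ i - c $ i) \<le> \<rho> i"
    have z1: "z $ i1 \<in> cball c0 r" using z[of i1] by (simp add: c_def \<rho>_def dist_norm norm_minus_commute)
    have z2: "norm (z $ i2 + of_real m) \<le> m" using z[of i2] ne by (simp add: c_def \<rho>_def)
    have "horn (z $ i1) (z $ i2)" using r(3,4) z1 by (intro horn_mono[OF _ _ z2]) (auto simp: W_def)
    moreover have "norm (z $ i) \<le> 1" if "i \<noteq> i1" "i \<noteq> i2" for i using z[of i] that by (simp add: c_def \<rho>_def)
    ultimately show "z \<in> K" using r(4)[OF z1] by (auto simp: hornset_def)
  next
    have 1: "max 0 (ln (norm (w $ i1 - c $ i1) / \<rho> i1)) = 0"
    proof -
      have "norm (w $ i1 - c0) \<le> r" using r by (simp add: dist_norm norm_minus_commute)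
      then show ?thesis using r by (simp add: max_0_ln c_def \<rho>_def)
    qed
    have 2: "max 0 (ln (norm (w $ i2 - c $ i2) / \<rho> i2)) \<le> e / 2"
    proof -
      have "w $ i2 + of_real m = (w $ i2 + of_real h) + of_real (m - h)" by simp
      then have "norm (w $ i2 + of_real m) \<le> norm (w $ i2 + of_real h) + norm (complex_of_real (m - h))"
        by (metis norm_triangle_ineq)
      also have "norm (complex_of_real (m - h)) = h - m" using m by (simp only: norm_of_real; simp)
      also have "norm (w $ i2 + of_real h) \<le> h" using w by (simp add: horn_disc h_def)
      finally have "norm (w $ i2 + of_real m) \<le> 2 * h - m" by simp
      moreover have hm: "h = m * (1 + e / 4)" using e by (simp add: m_def add_nonneg_eq_0_iff)
      ultimately have "norm (w $ i2 + of_real m) \<le> m * (1 + e / 2)" by (simp add: algebra_simps)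
      then have "norm (w $ i2 + of_real m) / m \<le> 1 + e / 2" using m by (simp add: divide_le_eq mult.commute)
      then have "max 0 (ln (norm (w $ i2 + of_real m) / m)) \<le> e / 2"
        using max_0_ln_le[of "norm (w $ i2 + of_real m) / m"] m e by simp
      then show ?thesis using ne by (simp add: c_def \<rho>_def)
    qed
    have "(\<Sum>i\<in>UNIV - {i1, i2}. max 0 (ln (norm (w $ i - c $ i) / \<rho> i))) = (\<Sum>i\<in>UNIV - {i1, i2}. max 0 (ln (norm (w $ i))))"
      by (intro sum.cong) (auto simp: c_def \<rho>_def)
    also have "\<dots> = 0" by (rule sum_tail_0) (use w in \<open>auto simp: hornset_def\<close>)
    finally show "(\<Sum>i\<in>UNIV. max 0 (ln (norm (w $ i - c $ i) / \<rho> i))) < e"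
      using 1 2 e by (simp add: box_sum)
  qed
qed

text \<open>Above the points \<open>(t, 0)\<close> the set has the thick fibres of the horn only for \<open>\<bar>t\<bar> \<ge> 1\<close>, and these
  degenerate at \<open>t = 1\<close>. The polar point \<open>1\<close> is absorbed by \<open>\<epsilon> ln (4 / \<bar>t - 1\<bar>)\<close>.\<close>

definition fibre_bound :: "real \<Rightarrow> complex^'n \<Rightarrow> real" where
  "fibre_bound \<eta> z = ln (1 + 2 * norm (z $ i2) / \<eta>^2) + (\<Sum>i\<in>UNIV - {i1, i2}. max 0 (ln (norm (z $ i))))"

definition slice :: "complex^'n \<Rightarrow> complex \<Rightarrow> complex^'n" where
  "slice z t = (z - (z $ i1) *s axis i1 1) + t *s axis i1 1"

lemma slice_nth: "slice z t $ i = (if i = i1 then t else z $ i)"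
  by (simp add: slice_def axis_def)

lemma slice_self: "slice z (z $ i1) = z"
  by (simp add: vec_eq_iff slice_nth)

section \<open>Estimates along the first coordinate, with the other coordinates fixed\<close>

context
  fixes u :: "complex^'n \<Rightarrow> ereal"
  assumes u: "u \<in> lelong 1" "\<And>w. w \<in> K \<Longrightarrow> u w \<le> 0"
begin

text \<open>Bernstein-Walsh in all variables but the first, over the fibre of the horn at t. Away
  from the cusp this fibre has radius at least \<eta>^2 / 2.\<close>

lemma slice_crescent:
  assumes t: "norm t \<ge> 1" "norm (t + 1) \<le> 2" "norm (t - 1) \<ge> \<eta>" and \<eta>: "\<eta> > 0"
  shows "u (slice z t) \<le> ereal (fibre_bound \<eta> z)"
proof -
  define h where "h = (norm (1 - t))^2 / 2"
  have "\<eta>^2 \<le> (norm (1 - t))^2" using t \<eta> by (intro power_mono) (auto simp: norm_minus_commute)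
  then have h: "h \<ge> \<eta>^2 / 2" "h > 0" using \<eta> zero_less_power[of \<eta> 2] by (auto simp: h_def)
  define c where "c = (\<lambda>i. if i = i2 then - of_real h else 0 :: complex)"
  define \<rho> where "\<rho> = (\<lambda>i. if i = i2 then h else 1)"
  have "u (slice z t) \<le> ereal (0 + 1 * (\<Sum>i\<in>UNIV - {i1}. max 0 (ln (norm (slice z t $ i - c i) / \<rho> i))))"
  proof (rule lelong_bernstein_walsh_polydisc[OF u(1)])
    show "\<rho> i > 0" for i using h by (simp add: \<rho>_def)
    fix w :: "complex^'n"
    assume w: "\<And>i. i \<in> UNIV - {i1} \<Longrightarrow> norm (w $ i - c i) \<le> \<rho> i" "\<And>i. i \<notin> UNIV - {i1} \<Longrightarrow> w $ i = slice z t $ i"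
    have w1: "w $ i1 = t" using w(2)[of i1] by (simp add: slice_nth)
    have "norm (w $ i2 + of_real h) \<le> h" using w(1)[of i2] ne by (simp add: c_def \<rho>_def)
    then have "horn (w $ i1) (w $ i2)" unfolding w1 horn_disc h_def using t by simp
    moreover have "norm (w $ i) \<le> 1" if "i \<noteq> i1" "i \<noteq> i2" for i using w(1)[of i] that by (simp add: c_def \<rho>_def)
    ultimately have "w \<in> K" using t w1 by (auto simp: hornset_def)
    then show "u w \<le> ereal 0" using u(2) by (simp add: zero_ereal_def)
  qed auto
  also have "(\<Sum>i\<in>UNIV - {i1}. max 0 (ln (norm (slice z t $ i - c i) / \<rho> i)))
      = max 0 (ln (norm (z $ i2 + of_real h) / h)) + (\<Sum>i\<in>UNIV - {i1} - {i2}. max 0 (ln (norm (slice z t $ i - c i) / \<rho> i)))"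
    using ne by (subst sum.remove[of _ i2]) (auto simp: slice_nth c_def \<rho>_def)
  also have "(\<Sum>i\<in>UNIV - {i1} - {i2}. max 0 (ln (norm (slice z t $ i - c i) / \<rho> i))) = (\<Sum>i\<in>UNIV - {i1, i2}. max 0 (ln (norm (z $ i))))"
    by (intro sum.cong) (auto simp: slice_nth c_def \<rho>_def)
  finally have 1: "u (slice z t) \<le> ereal (max 0 (ln (norm (z $ i2 + of_real h) / h)) + (\<Sum>i\<in>UNIV - {i1, i2}. max 0 (ln (norm (z $ i)))))"
    by simp
  have "norm (z $ i2 + of_real h) \<le> norm (z $ i2) + h" using norm_triangle_ineq[of "z $ i2" "of_real h"] h by simp
  then have "norm (z $ i2 + of_real h) / h \<le> norm (z $ i2) / h + 1" using h by (simp add: divide_simps)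
  also have "norm (z $ i2) / h \<le> norm (z $ i2) / (\<eta>^2 / 2)" using h \<eta> by (intro divide_left_mono) auto
  finally have "norm (z $ i2 + of_real h) / h \<le> 1 + 2 * norm (z $ i2) / \<eta>^2" by (simp add: mult.commute)
  then have "max 1 (norm (z $ i2 + of_real h) / h) \<le> 1 + 2 * norm (z $ i2) / \<eta>^2" by simp
  then have "ln (max 1 (norm (z $ i2 + of_real h) / h)) \<le> ln (1 + 2 * norm (z $ i2) / \<eta>^2)" by (intro ln_mono) auto
  then have "max 0 (ln (norm (z $ i2 + of_real h) / h)) \<le> ln (1 + 2 * norm (z $ i2) / \<eta>^2)"
    using h by (subst max_0_ln) auto
  then show ?thesis using 1 by (intro order_trans[OF 1]) (simp add: fibre_bound_def)
qed

text \<open>A crude bound near the cusp from the unit disc around 30: the first variable costs at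
  most 1, the second at most ln 31 \<le> 30, and 33 leaves slack.\<close>

lemma slice_near:
  assumes t: "norm (t - 1) \<le> 1" and z: "norm (z $ i2) \<le> 1"
  shows "u (slice z t) \<le> ereal (fibre_bound \<eta> z + 33)"
proof -
  define c where "c = (\<lambda>i. if i = i1 then -1 else if i = i2 then 30 else 0 :: complex)"
  define \<rho> where "\<rho> = (\<lambda>i. if i = i1 then 2 else 1 :: real)"
  have "u (slice z t) \<le> ereal (0 + 1 * (\<Sum>i\<in>UNIV. max 0 (ln (norm (slice z t $ i - c i) / \<rho> i))))"
  proof (rule lelong_bernstein_walsh_polydisc[OF u(1)])
    show "\<rho> i > 0" for i by (simp add: \<rho>_def)
    fix w :: "complex^'n"
    assume w: "\<And>i. i \<in> UNIV \<Longrightarrow> norm (w $ i - c i) \<le> \<rho> i"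
    have "norm (w $ i1 + 1) \<le> 2" using w[of i1] by (simp add: c_def \<rho>_def)
    moreover have "w $ i2 \<in> zdisc 0" using w[of i2] ne by (simp add: c_def \<rho>_def ctr_def rad_def dist_norm norm_minus_commute)
    moreover have "norm (w $ i) \<le> 1" if "i \<noteq> i1" "i \<noteq> i2" for i using w[of i] that by (simp add: c_def \<rho>_def)
    ultimately have "w \<in> K" by (auto simp: hornset_def zset_def)
    then show "u w \<le> ereal 0" using u(2) by (simp add: zero_ereal_def)
  qed auto
  also have "(\<Sum>i\<in>UNIV. max 0 (ln (norm (slice z t $ i - c i) / \<rho> i)))
      = max 0 (ln (norm (t + 1) / 2)) + max 0 (ln (norm (z $ i2 - 30))) + (\<Sum>i\<in>UNIV - {i1, i2}. max 0 (ln (norm (slice z t $ i - c i) / \<rho> i)))"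
    unfolding box_sum using ne by (simp add: slice_nth c_def \<rho>_def)
  also have "(\<Sum>i\<in>UNIV - {i1, i2}. max 0 (ln (norm (slice z t $ i - c i) / \<rho> i))) = (\<Sum>i\<in>UNIV - {i1, i2}. max 0 (ln (norm (z $ i))))"
    by (intro sum.cong) (auto simp: slice_nth c_def \<rho>_def)
  finally have 1: "u (slice z t) \<le> ereal (max 0 (ln (norm (t + 1) / 2)) + max 0 (ln (norm (z $ i2 - 30))) + (\<Sum>i\<in>UNIV - {i1, i2}. max 0 (ln (norm (z $ i)))))"
    by simp
  have "norm (t + 1) \<le> 3" using t norm_triangle_ineq[of "t - 1" 2] by (simp add: add.commute)
  then have 2: "max 0 (ln (norm (t + 1) / 2)) \<le> 1" using max_0_ln_le[of "norm (t + 1) / 2"] by simp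
  have "norm (z $ i2 - 30) \<le> 31" using z norm_triangle_ineq4[of "z $ i2" 30] by simp
  then have 3: "max 0 (ln (norm (z $ i2 - 30))) \<le> 30" using max_0_ln_le[of "norm (z $ i2 - 30)"] by simp
  have "ln (1 + 2 * norm (z $ i2) / \<eta>^2) \<ge> 0" by simp
  then have "max 0 (ln (norm (t + 1) / 2)) + max 0 (ln (norm (z $ i2 - 30))) + (\<Sum>i\<in>UNIV - {i1, i2}. max 0 (ln (norm (z $ i)))) \<le> fibre_bound \<eta> z + 33"
    unfolding fibre_bound_def using 2 3 by linarith
  then show ?thesis by (intro order_trans[OF 1]) (simp only: ereal_less_eq)
qed

context
  fixes \<epsilon> \<eta> :: real
  assumes \<epsilon>: "0 < \<epsilon>" "\<epsilon> \<le> 1" and \<eta>: "\<eta> = 4 * exp (- (33 / \<epsilon>))"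
begin

text \<open>The radius \<eta> is the one at which the pole \<epsilon> ln (4 / |t - 1|) reaches 33,
  the crude bound. Inside it the pole alone dominates, outside it the fibres are thick
  enough.\<close>

lemma eta_bounds: "0 < \<eta>" "\<eta> < 1" "\<epsilon> * ln (4 / \<eta>) = 33"
proof -
  show "0 < \<eta>" by (simp add: \<eta>)
  have "33 \<le> 33 / \<epsilon>" using \<epsilon> by (simp add: pos_le_divide_eq)
  then have "1 + 33 \<le> exp (33 / \<epsilon>)" using exp_ge_add_one_self[of "33 / \<epsilon>"] by linarith
  then show "\<eta> < 1" unfolding \<eta> by (simp add: exp_minus divide_simps)
  have "4 / \<eta> = exp (33 / \<epsilon>)" unfolding \<eta> by (simp add: exp_minus divide_simps)
  then show "\<epsilon> * ln (4 / \<eta>) = 33" using \<epsilon> by simp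
qed

lemma eps_ln_ge:
  assumes "t \<noteq> 1" "norm (t - 1) \<le> \<eta>" shows "\<epsilon> * ln (4 / norm (t - 1)) \<ge> 33"
proof -
  have "4 / \<eta> \<le> 4 / norm (t - 1)" using assms eta_bounds by (intro divide_left_mono) auto
  then have "ln (4 / \<eta>) \<le> ln (4 / norm (t - 1))" using eta_bounds by (intro ln_mono) auto
  then have "\<epsilon> * ln (4 / \<eta>) \<le> \<epsilon> * ln (4 / norm (t - 1))" using \<epsilon> by (intro mult_left_mono) auto
  then show ?thesis using eta_bounds by simp
qed

lemma slice_subharmonic: "subharmonic_on UNIV (\<lambda>t. u (slice z t))"
  unfolding slice_def by (rule lelong_subharmonic_line[OF u(1)])

lemma slice_small:
  assumes z: "norm (z $ i2) \<le> 1" and t: "t \<noteq> 1" "norm (t - 1) \<le> \<eta>" and r: "r \<ge> 0"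
  shows "u (slice z t) \<le> ereal (fibre_bound \<eta> z + r + \<epsilon> * ln (4 / norm (t - 1)))"
proof -
  have "u (slice z t) \<le> ereal (fibre_bound \<eta> z + 33)" using t eta_bounds by (intro slice_near z) auto
  also have "\<dots> \<le> ereal (fibre_bound \<eta> z + r + \<epsilon> * ln (4 / norm (t - 1)))" using eps_ln_ge[OF t] r by simp
  finally show ?thesis .
qed

text \<open>Maximum principle on the unit disc minus a small disc at 1: on |t| = 1 the fibres of the
  horn are available, and near 1 the pole takes over.\<close>

lemma slice_inner:
  assumes z: "norm (z $ i2) \<le> 1" and s: "norm s < 1"
  shows "u (slice z s) \<le> ereal (fibre_bound \<eta> z + \<epsilon> * ln (4 / norm (s - 1)))"
proof (cases "norm (s - 1) \<le> \<eta>")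
  case True
  have "s \<noteq> 1" using s by auto
  then show ?thesis using slice_small[OF z _ True, of 0] by simp
next
  case False
  define \<Omega> where "\<Omega> = ball 0 1 - cball (1::complex) \<eta>"
  have op: "open \<Omega>" unfolding \<Omega>_def by (intro open_Diff) auto
  have clos: "closure \<Omega> \<subseteq> cball 0 1 - ball 1 \<eta>" unfolding \<Omega>_def
    by (rule closure_minimal) (auto intro: closed_Diff)
  define g where "g = (\<lambda>t::complex. (fibre_bound \<eta> z + \<epsilon> * ln 4) + (- \<epsilon>) * ln (norm (t - 1)) + 0 * ln (norm (t - 1)))"
  have geq: "g t = fibre_bound \<eta> z + \<epsilon> * ln (4 / norm (t - 1))" if "t \<noteq> 1" for t
    using that by (simp add: g_def ln_div algebra_simps)
  have "u (slice z s) \<le> ereal (g s)"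
  proof (rule maximum_principle_ln[OF slice_subharmonic op _ _ _ g_def])
    show "bounded \<Omega>" unfolding \<Omega>_def by (intro bounded_subset[OF bounded_ball]) auto
    show "1 \<notin> closure \<Omega>" "1 \<notin> closure \<Omega>" using clos eta_bounds by auto
    show "s \<in> \<Omega>" using s False by (simp add: \<Omega>_def dist_norm norm_minus_commute)
    fix t assume "t \<in> frontier \<Omega>"
    then have t: "t \<in> cball 0 1 - ball 1 \<eta>" "t \<notin> \<Omega>" using clos op by (auto simp: frontier_def interior_open)
    have t1: "norm (t - 1) \<ge> \<eta>" using t(1) by (simp add: dist_norm norm_minus_commute)
    then have tn: "t \<noteq> 1" using eta_bounds by auto
    consider "norm t = 1" | "norm (t - 1) \<le> \<eta>" using t by (auto simp: \<Omega>_def dist_norm norm_minus_commute)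
    then show "u (slice z t) \<le> ereal (g t)"
    proof cases
      case 1
      have "norm (t + 1) \<le> 2" "norm (t - 1) \<le> 2" using 1 norm_triangle_ineq[of t 1] norm_triangle_ineq4[of t 1] by auto
      then have "u (slice z t) \<le> ereal (fibre_bound \<eta> z)" using 1 t1 eta_bounds by (intro slice_crescent) auto
      also have "fibre_bound \<eta> z \<le> g t"
      proof -
        have "1 \<le> 4 / norm (t - 1)" using \<open>norm (t - 1) \<le> 2\<close> tn by (simp add: divide_simps)
        then have "ln (4 / norm (t - 1)) \<ge> 0" by simp
        then show ?thesis unfolding geq[OF tn] using \<epsilon> by simp
      qed
      finally show ?thesis by simp
    next
      case 2
      then show ?thesis unfolding geq[OF tn] using slice_small[OF z tn, of 0] by simp
    qed
  qed
  moreover have "s \<noteq> 1" using s by auto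
  ultimately show ?thesis by (simp add: geq)
qed

text \<open>Needed because a neighbourhood of the cusp also contains points outside the disc |t + 1|
  \<le> 2. The maximum principle is applied to a large disc with that disc and a small disc at 1
  removed.\<close>

lemma slice_outer:
  assumes z: "norm (z $ i2) \<le> 1" and s: "norm (s + 1) > 2"
  shows "u (slice z s) \<le> ereal (fibre_bound \<eta> z + (1 + 2 * \<epsilon>) * ln (norm (s + 1) / 2) + \<epsilon> * ln (4 / norm (s - 1)))"
proof (cases "norm (s - 1) \<le> \<eta>")
  case True
  have "s \<noteq> 1" using s by auto
  then show ?thesis using slice_small[OF z _ True, of "(1 + 2 * \<epsilon>) * ln (norm (s + 1) / 2)"] \<epsilon> s by simp
next
  case False
  obtain C where C: "\<And>t. u (slice z t) \<le> ereal (1 * ln (1 + norm t) + C)"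
    using lelong_line_growth[OF u(1), of "z - (z $ i1) *s axis i1 1" "axis i1 1"] unfolding slice_def by auto
  define \<kappa> where "\<kappa> = fibre_bound \<eta> z"
  have "\<forall>\<^sub>F r in at_top. (1 + \<epsilon>) * ln (1 + r) + C \<le> \<kappa> + (1 + 2 * \<epsilon>) * (ln (r - 1) - ln 2) + \<epsilon> * ln 4"
    using \<epsilon> by real_asymp
  moreover have "\<forall>\<^sub>F r::real in at_top. r > norm s + 4" by (rule eventually_gt_at_top)
  ultimately have "\<forall>\<^sub>F r in at_top. (1 + \<epsilon>) * ln (1 + r) + C \<le> \<kappa> + (1 + 2 * \<epsilon>) * (ln (r - 1) - ln 2) + \<epsilon> * ln 4 \<and> r > norm s + 4"
    by (rule eventually_conj)
  then obtain R where R: "(1 + \<epsilon>) * ln (1 + R) + C \<le> \<kappa> + (1 + 2 * \<epsilon>) * (ln (R - 1) - ln 2) + \<epsilon> * ln 4" "R > norm s + 4"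
    by (auto simp: eventually_at_top_linorder)
  have R4: "R > 4" using R(2) norm_ge_zero[of s] by linarith
  define \<Omega> where "\<Omega> = ball 0 R - (cball (-1) 2 \<union> cball (1::complex) \<eta>)"
  have op: "open \<Omega>" unfolding \<Omega>_def by (intro open_Diff closed_Un) auto
  have clos: "closure \<Omega> \<subseteq> cball 0 R - (ball (-1) 2 \<union> ball 1 \<eta>)" unfolding \<Omega>_def
    by (rule closure_minimal) (auto intro!: closed_Diff open_Un)
  \<comment> \<open>The logarithm at -1 has coefficient 1 + 2 \<epsilon> and the pole at 1 has
    -\<epsilon>; the net slope 1 + \<epsilon> beats the growth of u on |t| = R for the R chosen
    above.\<close>
  define g where "g = (\<lambda>t::complex. (\<kappa> - (1 + 2 * \<epsilon>) * ln 2 + \<epsilon> * ln 4) + (1 + 2 * \<epsilon>) * ln (norm (t - (-1))) + (- \<epsilon>) * ln (norm (t - 1)))"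
  have geq: "g t = \<kappa> + (1 + 2 * \<epsilon>) * ln (norm (t + 1) / 2) + \<epsilon> * ln (4 / norm (t - 1))" if "t \<noteq> 1" "t \<noteq> -1" for t
  proof -
    have "t + 1 \<noteq> 0" using that(2) by (metis add_eq_0_iff2)
    then show ?thesis using that by (simp add: g_def ln_div algebra_simps)
  qed
  have "u (slice z s) \<le> ereal (g s)"
  proof (rule maximum_principle_ln[OF slice_subharmonic op _ _ _ g_def])
    show "bounded \<Omega>" unfolding \<Omega>_def by (intro bounded_subset[OF bounded_ball]) auto
    show "- 1 \<notin> closure \<Omega>" "1 \<notin> closure \<Omega>" using clos eta_bounds by auto
    show "s \<in> \<Omega>" using s False R norm_minus_commute[of "-1" s] by (simp add: \<Omega>_def dist_norm norm_minus_commute)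
    fix t assume "t \<in> frontier \<Omega>"
    then have t: "t \<in> cball 0 R - (ball (-1) 2 \<union> ball 1 \<eta>)" "t \<notin> \<Omega>" using clos op by (auto simp: frontier_def interior_open)
    have nt: "dist (-1) t = norm (t + 1)" using norm_minus_commute[of "-1" t] by (simp add: dist_norm)
    have t1: "norm (t - 1) \<ge> \<eta>" "norm (t + 1) \<ge> 2" using t(1) nt by (auto simp: dist_norm norm_minus_commute)
    then have tn: "t \<noteq> 1" "t \<noteq> -1" using eta_bounds by auto
    have l0: "(1 + 2 * \<epsilon>) * ln (norm (t + 1) / 2) \<ge> 0" using t1 \<epsilon> by simp
    consider "norm t = R" | "norm (t + 1) = 2" | "norm (t - 1) \<le> \<eta>" using t nt by (auto simp: \<Omega>_def dist_norm norm_minus_commute)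
    then show "u (slice z t) \<le> ereal (g t)"
    proof cases
      case 1
      have a: "norm (t - 1) \<le> 1 + R" "R - 1 \<le> norm (t + 1)"
        using 1 norm_triangle_ineq4[of t 1] norm_triangle_ineq4[of "t + 1" 1] by auto
      have "u (slice z t) \<le> ereal (ln (1 + R) + C)" using C[of t] 1 by simp
      also have "ln (1 + R) + C \<le> \<kappa> + (1 + 2 * \<epsilon>) * (ln (R - 1) - ln 2) + \<epsilon> * ln 4 - \<epsilon> * ln (1 + R)"
        using R(1) by (simp add: algebra_simps)
      also have "\<dots> \<le> g t"
      proof -
        have "(1 + 2 * \<epsilon>) * ln (R - 1) \<le> (1 + 2 * \<epsilon>) * ln (norm (t + 1))" using a R4 \<epsilon> by (intro mult_left_mono ln_mono) auto
        moreover have "\<epsilon> * ln (norm (t - 1)) \<le> \<epsilon> * ln (1 + R)" using a tn \<epsilon> by (intro mult_left_mono ln_mono) auto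
        ultimately show ?thesis by (simp add: g_def algebra_simps)
      qed
      finally show ?thesis by simp
    next
      case 2
      have n1: "norm t \<ge> 1" using 2 norm_triangle_ineq[of t 1] by simp
      have n4: "norm (t - 1) \<le> 4" using 2 norm_triangle_ineq4[of "t + 1" 2] by simp
      have "u (slice z t) \<le> ereal \<kappa>" unfolding \<kappa>_def using 2 t1 n1 eta_bounds by (intro slice_crescent) auto
      also have "\<kappa> \<le> g t"
      proof -
        have "1 \<le> 4 / norm (t - 1)" using n4 tn by (simp add: divide_simps)
        then have "ln (4 / norm (t - 1)) \<ge> 0" by simp
        then show ?thesis unfolding geq[OF tn] using \<epsilon> l0 by simp
      qed
      finally show ?thesis by simp
    next
      case 3
      then show ?thesis unfolding geq[OF tn] \<kappa>_def using slice_small[OF z tn(1) 3 l0] by simp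
    qed
  qed
  moreover have "s \<noteq> 1" "s \<noteq> -1" using s by auto
  ultimately show ?thesis by (simp add: geq \<kappa>_def)
qed

lemma slice_all:
  assumes z: "norm (z $ i2) \<le> 1" and t: "norm (t - 1) \<le> 1" "t \<noteq> 1"
  shows "u (slice z t) \<le> ereal (fibre_bound \<eta> z + (1 + 2 * \<epsilon>) * max 0 (ln (norm (t + 1) / 2)) + \<epsilon> * ln (4 / norm (t - 1)))"
proof -
  have m0: "(1 + 2 * \<epsilon>) * max 0 (ln (norm (t + 1) / 2)) \<ge> 0" using \<epsilon> by simp
  have "1 \<le> 4 / norm (t - 1)" using t by (simp add: divide_simps)
  then have l0: "\<epsilon> * ln (4 / norm (t - 1)) \<ge> 0" using \<epsilon> by simp
  consider "norm (t - 1) \<le> \<eta>" | "norm t < 1" | "norm (t + 1) > 2" | "norm t \<ge> 1" "norm (t + 1) \<le> 2" "norm (t - 1) \<ge> \<eta>" by linarith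
  then show ?thesis
  proof cases
    case 1
    show ?thesis by (rule slice_small[OF z t(2) 1 m0])
  next
    case 2
    have "u (slice z t) \<le> ereal (fibre_bound \<eta> z + \<epsilon> * ln (4 / norm (t - 1)))" by (rule slice_inner[OF z 2])
    then show ?thesis using m0 by (rule_tac order_trans) auto
  next
    case 3
    have "(1 + 2 * \<epsilon>) * ln (norm (t + 1) / 2) \<le> (1 + 2 * \<epsilon>) * max 0 (ln (norm (t + 1) / 2))"
      using \<epsilon> by (intro mult_left_mono) auto
    then show ?thesis by (intro order_trans[OF slice_outer[OF z 3]]) simp
  next
    case 4
    have "u (slice z t) \<le> ereal (fibre_bound \<eta> z)" using 4 eta_bounds by (intro slice_crescent) auto
    then show ?thesis using m0 l0 by (rule_tac order_trans) auto
  qed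
qed

text \<open>The slice bounds blow up at t = 1 but only logarithmically. Averaging over the circle of
  radius r around z1, which encloses 1, replaces ln |t - 1| by ln r. The term 3 r is (1 + 2
  \<epsilon>) r with \<epsilon> \<le> 1.\<close>

lemma bound_at_cusp:
  assumes z: "norm (z $ i2) \<le> 1" and r: "r > 0" "r \<le> 1/2" and z1: "norm (z $ i1 - 1) < r"
  shows "u z \<le> ereal (fibre_bound \<eta> z + 3 * r + \<epsilon> * ln (4 / r))"
proof -
  define f where "f = (\<lambda>t::complex. (fibre_bound \<eta> z + 3 * r + \<epsilon> * ln 4) + (- \<epsilon>) * ln (norm (t - 1)))"
  have tn: "t \<noteq> 1" if "t \<in> sphere (z $ i1) r" for t
    using that z1 by (auto simp: dist_norm)
  have "u (slice z (z $ i1)) \<le> ereal (cmean f (z $ i1) r)"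
  proof (rule subharmonic_le_cmean[OF slice_subharmonic r(1)])
    show "continuous_on (sphere (z $ i1) r) f" unfolding f_def using tn by (intro continuous_intros) auto
    fix t assume t: "t \<in> sphere (z $ i1) r"
    have "norm (t - 1) \<le> norm (t - z $ i1) + norm (z $ i1 - 1)" using norm_triangle_ineq[of "t - z $ i1" "z $ i1 - 1"] by simp
    then have t2: "norm (t - 1) \<le> 2 * r" using t z1 by (simp add: dist_norm norm_minus_commute)
    have "u (slice z t) \<le> ereal (fibre_bound \<eta> z + (1 + 2 * \<epsilon>) * max 0 (ln (norm (t + 1) / 2)) + \<epsilon> * ln (4 / norm (t - 1)))"
      using t2 r tn[OF t] by (intro slice_all z) auto
    also have "\<dots> \<le> ereal (f t)"
    proof -
      have "norm (t + 1) \<le> norm (t - 1) + 2" using norm_triangle_ineq[of "t - 1" 2] by (simp add: add.commute)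
      then have "max 0 (ln (norm (t + 1) / 2)) \<le> r" using max_0_ln_le[of "norm (t + 1) / 2"] t2 r by simp
      then have "(1 + 2 * \<epsilon>) * max 0 (ln (norm (t + 1) / 2)) \<le> 3 * r" using \<epsilon> r by (intro mult_mono) auto
      moreover have "\<epsilon> * ln (4 / norm (t - 1)) = \<epsilon> * ln 4 - \<epsilon> * ln (norm (t - 1))"
        using tn[OF t] by (simp add: ln_div algebra_simps)
      ultimately show ?thesis by (simp add: f_def)
    qed
    finally show "u (slice z t) \<le> ereal (f t)" .
  qed simp
  also have "cmean f (z $ i1) r = (fibre_bound \<eta> z + 3 * r + \<epsilon> * ln 4) + (- \<epsilon>) * ln r"
  proof -
    have "continuous_on (sphere (z $ i1) \<bar>r\<bar>) (\<lambda>t. ln (norm (t - 1)))" using tn r by (intro continuous_intros) auto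
    then show ?thesis unfolding f_def by (simp only: cmean_affine cmean_ln_dist(2)[OF r(1) z1])
  qed
  also have "\<dots> = fibre_bound \<eta> z + 3 * r + \<epsilon> * ln (4 / r)" using r by (simp add: ln_div algebra_simps)
  finally show ?thesis by (simp add: slice_self)
qed

end

end

lemma fibre_bound_tendsto:
  assumes w: "w \<in> K" "w $ i2 = 0" and \<eta>: "\<eta> > 0" and e: "e > 0"
  shows "\<forall>\<^sub>F z in nhds w. fibre_bound \<eta> z < e"
proof -
  have eq: "fibre_bound \<eta> = (\<lambda>z. ln (1 + 2 * norm (z $ i2) / \<eta>^2) + (\<Sum>i\<in>UNIV - {i1, i2}. ln (max 1 (norm (z $ i)))))"
    by (simp add: fibre_bound_def fun_eq_iff max_0_ln)
  have nz: "1 + 2 * norm (z $ i2) / \<eta>^2 \<noteq> 0" for z :: "complex^'n"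
  proof -
    have "0 \<le> 2 * norm (z $ i2) / \<eta>^2" by simp
    then show ?thesis by linarith
  qed
  have "continuous_on UNIV (fibre_bound \<eta>)" unfolding eq using \<eta> nz
    by (intro continuous_on_add continuous_on_sum continuous_on_ln continuous_on_max continuous_on_divide continuous_on_mult
         continuous_on_norm continuous_on_const continuous_on_component continuous_on_id) auto
  then have "isCont (fibre_bound \<eta>) w" by (simp add: continuous_on_eq_continuous_at)
  then have "(fibre_bound \<eta> \<longlongrightarrow> fibre_bound \<eta> w) (nhds w)" by (simp add: isCont_def tendsto_nhds_iff)
  moreover have "fibre_bound \<eta> w = 0" using w sum_tail_0[of w] by (auto simp: fibre_bound_def hornset_def)
  ultimately show ?thesis using e by (intro order_tendstoD(2)) auto
qed

lemma eventually_coord: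
  fixes w :: "complex^'n"
  assumes "r > 0" shows "\<forall>\<^sub>F z in nhds w. norm (z $ i - w $ i) < r"
proof -
  have "\<forall>\<^sub>F z in nhds w. dist z w < r" using assms by (auto simp: eventually_nhds_metric)
  then show ?thesis
  proof eventually_elim
    case (elim z)
    have "norm ((z - w) $ i) \<le> norm (z - w)" by (rule Finite_Cartesian_Product.norm_nth_le)
    then show ?case using elim by (simp add: dist_norm)
  qed
qed

text \<open>The order of choices matters: a fixed radius r or distance m from the cusp, next
  \<epsilon> depending on it, then \<eta> depending on \<epsilon>. Only afterwards is the
  neighbourhood of w shrunk, and \<open>fibre_bound\<close> with this fixed \<eta> tends to 0
  there.\<close>

lemma regular_flat:
  assumes w: "w \<in> K" "w $ i2 = 0" and w1: "norm (w $ i1) < 1 \<or> w $ i1 = 1"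
  shows "extremal_reg 1 K (\<lambda>_. 0) w = 0"
proof (rule extremal_reg_zeroI)
  fix e :: real assume e: "e > 0"
  have i2: "\<forall>\<^sub>F z in nhds w. norm (z $ i2) < 1" using eventually_coord[of 1 i2 w] w by simp
  show "\<forall>\<^sub>F z in nhds w. extremal 1 K (\<lambda>_. 0) z \<le> ereal e"
  proof (cases "w $ i1 = 1")
    case True
    define r where "r = min (1/2) (e / 12)"
    have r: "0 < r" "r \<le> 1/2" "3 * r \<le> e / 4" using e by (auto simp: r_def)
    have L: "ln (4 / r) > 0" using r by simp
    \<comment> \<open>This makes the averaged pole \<epsilon> ln (4 / r) at most e / 4.\<close>
    define \<epsilon> where "\<epsilon> = min 1 (e / (4 * ln (4 / r)))"
    have \<epsilon>: "0 < \<epsilon>" "\<epsilon> \<le> 1" using e L by (auto simp: \<epsilon>_def)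
    have "\<epsilon> * ln (4 / r) \<le> e / (4 * ln (4 / r)) * ln (4 / r)" using L by (intro mult_right_mono) (auto simp: \<epsilon>_def)
    then have \<epsilon>2: "\<epsilon> * ln (4 / r) \<le> e / 4" using L by simp
    define \<eta> where "\<eta> = 4 * exp (- (33 / \<epsilon>))"
    have "\<forall>\<^sub>F z in nhds w. fibre_bound \<eta> z < e / 2" using e by (intro fibre_bound_tendsto w) (auto simp: \<eta>_def)
    moreover have "\<forall>\<^sub>F z in nhds w. norm (z $ i1 - w $ i1) < r" by (rule eventually_coord[OF r(1)])
    ultimately show ?thesis using i2
    proof eventually_elim
      case (elim z)
      show ?case
      proof (rule extremal_le)
        fix u assume u: "u \<in> lelong 1" "\<And>w. w \<in> K \<Longrightarrow> u w \<le> ereal 0"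
        have "u z \<le> ereal (fibre_bound \<eta> z + 3 * r + \<epsilon> * ln (4 / r))"
          using bound_at_cusp[OF u(1) _ \<epsilon> \<eta>_def _ r(1,2), of z] u(2) elim True by (simp add: zero_ereal_def)
        also have "\<dots> \<le> ereal e" using elim \<epsilon>2 r by simp
        finally show "u z \<le> ereal e" .
      qed
    qed
  next
    case False
    then have n1: "norm (w $ i1) < 1" using w1 by simp
    define m where "m = (1 - norm (w $ i1)) / 2"
    have m: "0 < m" "m \<le> 1/2" using n1 by (auto simp: m_def)
    have L: "ln (4 / m) > 0" using m by simp
    define \<epsilon> where "\<epsilon> = min 1 (e / (4 * ln (4 / m)))"
    have \<epsilon>: "0 < \<epsilon>" "\<epsilon> \<le> 1" using e L by (auto simp: \<epsilon>_def)
    have "\<epsilon> * ln (4 / m) \<le> e / (4 * ln (4 / m)) * ln (4 / m)" using L by (intro mult_right_mono) (auto simp: \<epsilon>_def)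
    then have \<epsilon>2: "\<epsilon> * ln (4 / m) \<le> e / 4" using L by simp
    define \<eta> where "\<eta> = 4 * exp (- (33 / \<epsilon>))"
    have "\<forall>\<^sub>F z in nhds w. fibre_bound \<eta> z < e / 2" using e by (intro fibre_bound_tendsto w) (auto simp: \<eta>_def)
    moreover have "\<forall>\<^sub>F z in nhds w. norm (z $ i1 - w $ i1) < m" by (rule eventually_coord[OF m(1)])
    ultimately show ?thesis using i2
    proof eventually_elim
      case (elim z)
      have nz: "norm (z $ i1) \<le> 1 - m"
        using elim norm_triangle_ineq[of "z $ i1 - w $ i1" "w $ i1"] by (simp add: m_def field_simps)
      have "m \<le> norm (z $ i1 - 1)" using nz norm_triangle_ineq4[of "z $ i1" "z $ i1 - 1"] by simp
      then have "4 / norm (z $ i1 - 1) \<le> 4 / m" using m by (intro divide_left_mono mult_pos_pos) auto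
      moreover have "z $ i1 \<noteq> 1" using nz m by auto
      ultimately have "ln (4 / norm (z $ i1 - 1)) \<le> ln (4 / m)" using m by (intro ln_mono) auto
      then have l: "\<epsilon> * ln (4 / norm (z $ i1 - 1)) \<le> \<epsilon> * ln (4 / m)" using \<epsilon> by (intro mult_left_mono) auto
      show ?case
      proof (rule extremal_le)
        fix u assume u: "u \<in> lelong 1" "\<And>w. w \<in> K \<Longrightarrow> u w \<le> ereal 0"
        have "u (slice z (z $ i1)) \<le> ereal (fibre_bound \<eta> z + \<epsilon> * ln (4 / norm (z $ i1 - 1)))"
          using slice_inner[OF u(1) _ \<epsilon> \<eta>_def, of z "z $ i1"] u(2) elim nz m by (simp add: zero_ereal_def)
        also have "\<dots> \<le> ereal e" using elim \<epsilon>2 l e by simp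
        finally show "u z \<le> ereal e" by (simp add: slice_self)
      qed
    qed
  qed
qed

lemma regular_K:
  assumes w: "w \<in> K"
  shows "extremal_reg 1 K (\<lambda>_. 0) w = 0"
proof -
  consider j where "w $ i2 \<in> zdisc j" | "horn (w $ i1) (w $ i2)" "w $ i1 \<noteq> 1" | "w $ i2 = 0" "norm (w $ i1) < 1 \<or> w $ i1 = 1"
  proof (cases "w $ i2 = 0")
    case True
    then show ?thesis using that(2,3) horn_0[of "w $ i1"] by (metis not_le)
  next
    case False
    then consider j where "w $ i2 \<in> zdisc j" | "horn (w $ i1) (w $ i2)" using w by (auto simp: hornset_def zset_def)
    then show ?thesis
    proof cases
      case 2
      then have "w $ i1 \<noteq> 1" using False by (auto simp: horn_def)
      then show ?thesis using 2 that(2) by blast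
    qed (use that(1) in blast)
  qed
  then show ?thesis using regular_disc regular_horn regular_flat w by metis
qed

end

section \<open>Right derivative of the weighted extremal functions\<close>

text \<open>Continuous members of the Lelong classes. Their indices add up, so the index \<tau> + h
  can be distributed over the summands of a competitor.\<close>

definition clel :: "real \<Rightarrow> (complex^'n \<Rightarrow> real) \<Rightarrow> bool" where
  "clel \<delta> f \<longleftrightarrow> cpsh f \<and> (\<exists>C. \<forall>z. f z \<le> \<delta> * log_plus (norm z) + C)"

lemma clel_lelong: "clel \<delta> f \<Longrightarrow> (\<lambda>z. ereal (f z)) \<in> lelong \<delta>"
  using cpsh_imp_psh by (auto simp: clel_def lelong_def)

lemma clel_mono: "clel \<delta> f \<Longrightarrow> \<delta> \<le> \<delta>' \<Longrightarrow> clel \<delta>' f"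
proof -
  assume f: "clel \<delta> f" and d: "\<delta> \<le> \<delta>'"
  then obtain C where C: "\<And>z. f z \<le> \<delta> * log_plus (norm z) + C" by (auto simp: clel_def)
  have "f z \<le> \<delta>' * log_plus (norm z) + C" for z
    using C[of z] mult_right_mono[OF d log_plus_nonneg[of "norm z"]] by simp
  then show ?thesis using f by (auto simp: clel_def)
qed

lemma clel_const: "clel 0 (\<lambda>z. c)"
  by (auto simp: clel_def cpsh_const)

lemma clel_add: "clel \<delta> f \<Longrightarrow> clel \<delta>' g \<Longrightarrow> clel (\<delta> + \<delta>') (\<lambda>z. f z + g z)"
proof -
  assume f: "clel \<delta> f" and g: "clel \<delta>' g"
  obtain C D where "\<And>z. f z \<le> \<delta> * log_plus (norm z) + C" "\<And>z. g z \<le> \<delta>' * log_plus (norm z) + D"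
    using f g by (auto simp: clel_def)
  then have "f z + g z \<le> (\<delta> + \<delta>') * log_plus (norm z) + (C + D)" for z
    by (smt (verit) distrib_right)
  then show ?thesis using f g by (auto simp: clel_def intro: cpsh_add)
qed

lemma clel_cmult: "clel \<delta> f \<Longrightarrow> c \<ge> 0 \<Longrightarrow> clel (c * \<delta>) (\<lambda>z. c * f z)"
proof -
  assume f: "clel \<delta> f" and c: "c \<ge> 0"
  obtain C where C: "\<And>z. f z \<le> \<delta> * log_plus (norm z) + C" using f by (auto simp: clel_def)
  have "c * f z \<le> (c * \<delta>) * log_plus (norm z) + c * C" for z
    using mult_left_mono[OF C[of z] c] by (simp add: algebra_simps)
  then show ?thesis using f c by (auto simp: clel_def intro: cpsh_cmult)
qed

lemma clel_sum: "finite A \<Longrightarrow> (\<And>i. i \<in> A \<Longrightarrow> clel (d i) (f i)) \<Longrightarrow> clel (\<Sum>i\<in>A. d i) (\<lambda>z. \<Sum>i\<in>A. f i z)"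
  by (induction A rule: finite_induct) (auto intro: clel_const clel_add)

lemma clel_logreg:
  fixes p :: "complex^'n"
  assumes e: "e > 0"
  shows "clel 1 (logreg e {i} p)"
proof -
  define A where "A = 1 + e + norm (p $ i)"
  have A: "A > 0" using e by (simp add: A_def add_pos_nonneg)
  have "logreg e {i} p z \<le> 1 * log_plus (norm z) + (ln 2 + ln A)" for z
  proof -
    have zi: "norm (z $ i) \<le> norm z" by (rule Finite_Cartesian_Product.norm_nth_le)
    have le: "e + norm (z $ i - p $ i) \<le> (1 + norm z) * A"
    proof -
      have "norm (z $ i - p $ i) \<le> norm z + norm (p $ i)" using norm_triangle_ineq4[of "z $ i" "p $ i"] zi by simp
      moreover have "(1 + norm z) * A = 1 + e + norm (p $ i) + norm z + norm z * (e + norm (p $ i))" by (simp add: A_def algebra_simps)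
      moreover have "norm z * (e + norm (p $ i)) \<ge> 0" using e by simp
      ultimately show ?thesis by linarith
    qed
    have "e^2 + (norm (z $ i - p $ i))^2 \<le> (e + norm (z $ i - p $ i))^2" using e by (simp add: power2_eq_square algebra_simps)
    also have "\<dots> \<le> ((1 + norm z) * A)^2" using le e by (intro power_mono) auto
    finally have "ln (e^2 + (norm (z $ i - p $ i))^2) \<le> ln (((1 + norm z) * A)^2)"
      using e by (intro ln_mono) (auto simp: add_pos_nonneg)
    also have "\<dots> = 2 * (ln (1 + norm z) + ln A)"
      using A by (subst ln_realpow) (auto simp: add_pos_nonneg ln_mult_pos)
    finally have "logreg e {i} p z \<le> ln (1 + norm z) + ln A" by (simp add: logreg_def)
    then show ?thesis using ln_one_plus_le_log_plus[of "norm z"] by simp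
  qed
  then show ?thesis using e cpsh_logreg[of e "{i}" p] by (auto simp: clel_def)
qed

lemma clel_logweight: "\<tau> \<ge> 0 \<Longrightarrow> clel \<tau> (logweight \<tau> p)"
  using lelong_logweight[of \<tau> p] cpsh_logweight[of \<tau> p] by (auto simp: clel_def lelong_plus_def lelong_def)

text \<open>The constant of the theorem enters only through being positive and at most 1: 3^8 = 6561
  \<le> 8192 = 2^4 * 2^9 \<le> 2^4 e^9.\<close>

lemma ln_numeric: "ln (50::real) \<le> 6" "ln (30::real) \<ge> 3" "ln (4::real) \<le> 2"
  "(8 * ln 3 - 4 * ln 2) / 9 \<le> (1::real)" "(8 * ln 3 - 4 * ln 2) / 9 > (0::real)"
proof -
  have e2: "(2::real) \<le> exp 1" using exp_ge_add_one_self[of 1] by simp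
  have pw: "(2::real)^n \<le> exp (real n)" for n
    using power_mono[OF e2, of n] by (simp add: exp_of_nat_mult[symmetric])
  show "ln (50::real) \<le> 6" using pw[of 6] ln_mono[of 50 "exp 6"] by simp
  show "ln (4::real) \<le> 2" using pw[of 2] ln_mono[of 4 "exp 2"] by simp
  have "exp (3::real) = exp 1 ^ 3" by (simp add: exp_of_nat_mult[symmetric])
  also have "\<dots> \<le> 3^3" using exp_le by (intro power_mono) auto
  finally have "exp 3 \<le> (30::real)" by simp
  then show "ln (30::real) \<ge> 3" by (subst ln_ge_iff) auto
  have "(3::real)^8 \<le> 2^4 * 2^9" by simp
  also have "\<dots> \<le> 2^4 * exp (real 9)" using pw[of 9] by (intro mult_left_mono) auto
  finally have "ln ((3::real)^8) \<le> ln (2^4 * exp (real 9))" by (intro ln_mono) auto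
  also have "\<dots> = ln (2^4) + 9" by (subst ln_mult_pos) auto
  also have "ln ((2::real)^4) = 4 * ln 2" by (subst ln_realpow) auto
  finally have "ln ((3::real)^8) \<le> 4 * ln 2 + 9" .
  moreover have "ln ((3::real)^8) = 8 * ln 3" by (subst ln_realpow) auto
  ultimately have "8 * ln 3 \<le> 4 * ln 2 + (9::real)" by (simp only:)
  then show "(8 * ln 3 - 4 * ln 2) / 9 \<le> (1::real)" by simp
  have "ln (2::real) < ln 3" "ln (2::real) > 0" by simp_all
  then have "0 < 8 * ln 3 - 4 * ln (2::real)" by linarith
  then show "(8 * ln 3 - 4 * ln 2) / 9 > (0::real)" by (rule divide_pos_pos) simp
qed

lemma Limsup_nhds_continuous:
  fixes f :: "'a::t2_space \<Rightarrow> real"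
  assumes "isCont f z" shows "Limsup (nhds z) (\<lambda>z. ereal (f z)) = ereal (f z)"
  by (rule lim_imp_Limsup) (use assms in \<open>auto simp: isCont_def tendsto_nhds_iff\<close>)

section \<open>Weighted extremal functions and their dependence on \<delta>\<close>

context two_axes
begin

definition pt :: "real \<Rightarrow> complex^'n" where "pt x = axis i2 (of_real x)"

abbreviation V :: "real \<Rightarrow> real \<Rightarrow> complex^'n \<Rightarrow> ereal" where
  "V \<tau> \<delta> \<equiv> extremal \<delta> K (logweight \<tau> (pt 30))"

abbreviation F :: "real \<Rightarrow> real \<Rightarrow> complex^'n \<Rightarrow> ereal" where
  "F \<tau> \<delta> \<equiv> extremal_reg \<delta> K (logweight \<tau> (pt 30))"

lemma pt_nth: "pt x $ i = (if i = i2 then of_real x else 0)"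
  by (simp add: pt_def axis_def)

lemma norm_pt: "norm (pt x) = \<bar>x\<bar>"
proof -
  have "pt x = of_real x *s axis i2 1" by (simp add: pt_def vec_eq_iff axis_def)
  then show ?thesis by (simp add: norm_vscale norm_axis_1)
qed

lemma ball_subset_K:
  assumes "norm (z - pt 30) \<le> 1" shows "z \<in> K"
proof -
  have c: "norm (z $ i - pt 30 $ i) \<le> 1" for i
    using Finite_Cartesian_Product.norm_nth_le[of "z - pt 30" i] assms by simp
  have "norm (z $ i1 + 1) \<le> 2" using c[of i1] ne norm_triangle_ineq[of "z $ i1" 1] by (simp add: pt_nth)
  moreover have "z $ i2 \<in> zdisc 0" using c[of i2] by (simp add: pt_nth ctr_def rad_def dist_norm norm_minus_commute)
  moreover have "norm (z $ i) \<le> 1" if "i \<noteq> i1" "i \<noteq> i2" for i using c[of i] that by (simp add: pt_nth)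
  ultimately show ?thesis by (auto simp: hornset_def zset_def)
qed

context
  fixes \<tau> :: real assumes \<tau>: "\<tau> > 0"
begin

lemma weight_cont: "isCont (logweight \<tau> (pt 30)) z"
  using cpsh_continuous[OF cpsh_logweight[of \<tau> "pt 30"], of UNIV] \<tau> by (simp add: continuous_on_eq_continuous_at)

lemma weight_0: "logweight \<tau> (pt 30) 0 = \<tau> * ln 30"
  by (subst logweight_far) (simp_all add: norm_pt)

text \<open>The unit ball around p = \<open>pt 30\<close> lies in K, and the weight is at most 0 on
  it. Bernstein-Walsh on the complex line through p and z gives the rest.\<close>

lemma competitor_bound:
  assumes u: "u \<in> lelong \<delta>" "\<And>w. w \<in> K \<Longrightarrow> u w \<le> ereal (logweight \<tau> (pt 30) w)" and \<delta>: "\<delta> \<ge> 0"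
    and z: "norm (z - pt 30) \<ge> 1"
  shows "u z \<le> ereal (\<delta> * ln (norm (z - pt 30)))"
proof -
  define r where "r = norm (z - pt 30)"
  define b where "b = of_real (1 / r) *s (z - pt 30)"
  have r: "r \<ge> 1" using z by (simp add: r_def)
  have nb: "norm b = 1" using r unfolding b_def norm_vscale r_def[symmetric] by (simp add: norm_divide)
  have zz: "z = pt 30 + of_real r *s b" using r by (simp add: b_def vec_eq_iff)
  have inner: "u (pt 30 + t *s b) \<le> ereal 0" if t: "t \<in> cball 0 1" for t
  proof -
    have n: "norm (pt 30 + t *s b - pt 30) \<le> 1" using t nb by (simp add: norm_vscale)
    then have "(norm (pt 30 + t *s b - pt 30))^2 \<le> 1" by (simp add: abs_square_le_1)
    then have "logcut ((norm (pt 30 + t *s b - pt 30))^2) \<le> logcut 1" by (rule logcut(6))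
    also have "logcut 1 = 0" by (simp add: logcut(2))
    finally have "logweight \<tau> (pt 30) (pt 30 + t *s b) \<le> 0" using \<tau> by (simp add: logweight_def mult_nonneg_nonpos)
    then show ?thesis using u(2)[OF ball_subset_K[OF n]] by (metis ereal_less_eq(3) order_trans)
  qed
  have "u (pt 30 + of_real r *s b) \<le> ereal (0 + \<delta> * max 0 (ln (norm (of_real r - (0::complex)) / 1)))"
    by (rule lelong_bernstein_walsh_line[OF u(1) \<delta> zero_less_one inner])
  then have "u (pt 30 + of_real r *s b) \<le> ereal (\<delta> * max 0 (ln r))" using r by simp
  then show ?thesis using r by (simp add: zz[symmetric] r_def[symmetric] max_def)
qed

lemma V_le: "\<delta> \<ge> 0 \<Longrightarrow> norm (z - pt 30) \<ge> 1 \<Longrightarrow> V \<tau> \<delta> z \<le> ereal (\<delta> * ln (norm (z - pt 30)))"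
  by (rule extremal_le) (rule competitor_bound)

lemma V_ge: "\<delta> \<ge> \<tau> \<Longrightarrow> V \<tau> \<delta> z \<ge> ereal (logweight \<tau> (pt 30) z)"
proof -
  assume "\<delta> \<ge> \<tau>"
  then have "(\<lambda>z. ereal (logweight \<tau> (pt 30) z)) \<in> lelong \<delta>"
    using \<tau> by (intro clel_lelong clel_mono[OF clel_logweight]) auto
  then show ?thesis by (rule extremal_ge) simp
qed

lemma V_on_K: "z \<in> K \<Longrightarrow> V \<tau> \<delta> z \<le> ereal (logweight \<tau> (pt 30) z)"
  by (rule extremal_le) blast

lemma V_eq: "V \<tau> \<tau> z = ereal (logweight \<tau> (pt 30) z)"
proof (rule antisym)
  show "V \<tau> \<tau> z \<le> ereal (logweight \<tau> (pt 30) z)"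
  proof (cases "norm (z - pt 30) \<ge> 1")
    case True
    then show ?thesis using V_le[of \<tau> z] \<tau> by (simp add: logweight_far)
  next
    case False
    then show ?thesis by (intro V_on_K ball_subset_K) simp
  qed
qed (rule V_ge, simp)

lemma F_eq: "F \<tau> \<tau> z = ereal (logweight \<tau> (pt 30) z)"
proof -
  have "V \<tau> \<tau> = (\<lambda>z. ereal (logweight \<tau> (pt 30) z))" using V_eq by (rule ext)
  then show ?thesis unfolding extremal_reg_def usc_reg_def using Limsup_nhds_continuous[OF weight_cont] by simp
qed

text \<open>Below \<tau> the origin is the witness: competitors are at most \<delta> ln 30 there,
  strictly less than the weight \<tau> ln 30. From \<tau> on the weight itself is a
  competitor.\<close>

lemma Lambda_K: "Lambda K (logweight \<tau> (pt 30)) = {\<tau>..}"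
proof (intro equalityI subsetI)
  fix \<delta> assume d: "\<delta> \<in> Lambda K (logweight \<tau> (pt 30))"
  show "\<delta> \<in> {\<tau>..}"
  proof (rule ccontr)
    assume "\<delta> \<notin> {\<tau>..}"
    then have dt: "\<delta> < \<tau>" by simp
    have d0: "\<delta> > 0" and eq: "V \<tau> \<delta> 0 = ereal (\<tau> * ln 30)"
      using d zero_in_K by (auto simp: Lambda_def weight_0)
    have "V \<tau> \<delta> 0 \<le> ereal (\<delta> * ln 30)" using V_le[of \<delta> 0] d0 by (simp add: norm_pt)
    moreover have "\<delta> * ln 30 < \<tau> * ln 30" using dt by (intro mult_strict_right_mono) auto
    ultimately show False using eq by simp
  qed
next
  fix \<delta> assume "\<delta> \<in> {\<tau>..}"
  then have d: "\<delta> \<ge> \<tau>" by simp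
  then show "\<delta> \<in> Lambda K (logweight \<tau> (pt 30))"
    unfolding Lambda_def using \<tau> V_ge[OF d] V_on_K by (auto intro!: antisym)
qed

lemma F_bounds:
  assumes h: "h > 0"
  shows "F \<tau> (\<tau> + h) 0 \<le> ereal ((\<tau> + h) * ln 30)" "F \<tau> (\<tau> + h) 0 \<ge> ereal (\<tau> * ln 30)"
proof -
  have c: "isCont (\<lambda>z::complex^'n. (\<tau> + h) * ln (norm (z - pt 30))) 0"
    by (intro continuous_intros) (auto simp: norm_pt pt_def)
  have ev: "\<forall>\<^sub>F z in nhds (0::complex^'n). V \<tau> (\<tau> + h) z \<le> ereal ((\<tau> + h) * ln (norm (z - pt 30)))"
  proof -
    have "\<forall>\<^sub>F z in nhds (0::complex^'n). dist z 0 < 1" unfolding eventually_nhds_metric by (intro exI[of _ 1]) auto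
    then show ?thesis
    proof eventually_elim
      case (elim z)
      have "norm (pt 30) \<le> norm z + norm (z - pt 30)" using norm_triangle_ineq4[of z "z - pt 30"] by simp
      then have "norm (z - pt 30) \<ge> 1" using elim by (simp add: norm_pt)
      then show ?case using \<tau> h by (intro V_le) auto
    qed
  qed
  have "F \<tau> (\<tau> + h) 0 \<le> Limsup (nhds 0) (\<lambda>z. ereal ((\<tau> + h) * ln (norm (z - pt 30))))"
    unfolding extremal_reg_def usc_reg_def by (rule Limsup_mono[OF ev])
  also have "\<dots> = ereal ((\<tau> + h) * ln 30)" using Limsup_nhds_continuous[OF c] by (simp add: norm_pt)
  finally show "F \<tau> (\<tau> + h) 0 \<le> ereal ((\<tau> + h) * ln 30)" .
  have "ereal (\<tau> * ln 30) = Limsup (nhds 0) (\<lambda>z. ereal (logweight \<tau> (pt 30) z))"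
    using Limsup_nhds_continuous[OF weight_cont, of 0] by (simp add: weight_0)
  also have "\<dots> \<le> F \<tau> (\<tau> + h) 0" unfolding extremal_reg_def usc_reg_def
    by (rule Limsup_mono) (use V_ge h in auto)
  finally show "F \<tau> (\<tau> + h) 0 \<ge> ereal (\<tau> * ln 30)" .
qed

definition gain :: "real \<Rightarrow> real" where "gain h = real_of_ereal (F \<tau> (\<tau> + h) 0) - \<tau> * ln 30"

lemma F_gain: "h > 0 \<Longrightarrow> F \<tau> (\<tau> + h) 0 = ereal (\<tau> * ln 30 + gain h)"
  using F_bounds[of h] by (cases "F \<tau> (\<tau> + h) 0") (auto simp: gain_def)

lemma F_mono: "\<tau> \<le> \<delta> \<Longrightarrow> \<delta> \<le> \<delta>' \<Longrightarrow> F \<tau> \<delta> z \<le> F \<tau> \<delta>' z"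
proof -
  assume d: "\<tau> \<le> \<delta>" "\<delta> \<le> \<delta>'"
  have "lelong \<delta> \<subseteq> (lelong \<delta>' :: (complex^'n \<Rightarrow> ereal) set)"
  proof
    fix u :: "complex^'n \<Rightarrow> ereal" assume u: "u \<in> lelong \<delta>"
    then obtain C where C: "\<And>z. u z \<le> ereal (\<delta> * log_plus (norm z) + C)" by (auto simp: lelong_def)
    have "u z \<le> ereal (\<delta>' * log_plus (norm z) + C)" for z
      using C[of z] mult_right_mono[OF d(2) log_plus_nonneg[of "norm z"]] by (rule_tac order_trans) auto
    then show "u \<in> lelong \<delta>'" using u by (auto simp: lelong_def)
  qed
  then have "V \<tau> \<delta> z \<le> V \<tau> \<delta>' z" for z unfolding extremal_def by (intro SUP_subset_mono) auto
  then show ?thesis unfolding extremal_reg_def usc_reg_def by (intro Limsup_mono always_eventually) auto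
qed

text \<open>The extremal function is concave in \<open>\<delta>\<close>. Regularization does not preserve this in general, but here
  one end of the segment is the continuous function \<open>V_\<tau> = \<psi>\<close>.\<close>

lemma gain_concave:
  assumes h: "0 < h" "h < h'"
  shows "gain h' / h' \<le> gain h / h"
proof -
  define l where "l = h / h'"
  have l: "0 < l" "l < 1" "l * h' = h" using h by (auto simp: l_def)
  define \<Psi> where "\<Psi> = logweight \<tau> (pt 30 :: complex^'n)"
  \<comment> \<open>The combination has index (1 - l) \<tau> + l (\<tau> + h') = \<tau> + h, and it
    stays below the weight on K.\<close>
  have comp: "ereal ((1 - l) * \<Psi> z) + ereal l * u z \<le> V \<tau> (\<tau> + h) z"
    if u: "u \<in> lelong (\<tau> + h')" "\<And>w. w \<in> K \<Longrightarrow> u w \<le> ereal (\<Psi> w)" for u z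
  proof (rule extremal_ge[where u = "\<lambda>z. ereal ((1 - l) * \<Psi> z) + ereal l * u z"])
    obtain C1 where C1: "\<And>z. \<Psi> z \<le> \<tau> * log_plus (norm z) + C1"
      using clel_logweight[of \<tau> "pt 30"] \<tau> by (auto simp: clel_def \<Psi>_def)
    obtain C2 where C2: "\<And>z. u z \<le> ereal ((\<tau> + h') * log_plus (norm z) + C2)" using u(1) by (auto simp: lelong_def)
    have "ereal ((1 - l) * \<Psi> z) + ereal l * u z \<le> ereal ((\<tau> + h) * log_plus (norm z) + ((1 - l) * C1 + l * C2))" for z
    proof -
      have "ereal l * u z \<le> ereal l * ereal ((\<tau> + h') * log_plus (norm z) + C2)" using C2 l by (intro ereal_mult_left_mono) auto
      moreover have "(1 - l) * \<Psi> z \<le> (1 - l) * (\<tau> * log_plus (norm z) + C1)" using C1 l by (intro mult_left_mono) auto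
      ultimately have "ereal ((1 - l) * \<Psi> z) + ereal l * u z \<le> ereal ((1 - l) * (\<tau> * log_plus (norm z) + C1)) + ereal (l * ((\<tau> + h') * log_plus (norm z) + C2))"
        by (intro add_mono) auto
      also have "\<dots> = ereal ((\<tau> + l * h') * log_plus (norm z) + ((1 - l) * C1 + l * C2))" by (simp add: algebra_simps)
      finally show ?thesis using l(3) by simp
    qed
    moreover have "psh_on UNIV (\<lambda>z. ereal ((1 - l) * \<Psi> z) + ereal l * u z)"
      using u(1) l \<tau> unfolding \<Psi>_def by (intro psh_add_cpsh cpsh_cmult cpsh_logweight) (auto simp: lelong_def)
    ultimately show "(\<lambda>z. ereal ((1 - l) * \<Psi> z) + ereal l * u z) \<in> lelong (\<tau> + h)" by (auto simp: lelong_def)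
    fix w assume "w \<in> K"
    then have "ereal l * u w \<le> ereal l * ereal (\<Psi> w)" using u(2) l by (intro ereal_mult_left_mono) auto
    then have "ereal ((1 - l) * \<Psi> w) + ereal l * u w \<le> ereal ((1 - l) * \<Psi> w) + ereal (l * \<Psi> w)" by (intro add_mono) auto
    also have "\<dots> = ereal (\<Psi> w)" by (simp add: algebra_simps)
    finally show "ereal ((1 - l) * \<Psi> w) + ereal l * u w \<le> ereal (logweight \<tau> (pt 30) w)" by (simp add: \<Psi>_def)
  qed
  have P0: "\<Psi> 0 = \<tau> * ln 30" by (simp add: \<Psi>_def weight_0)
  \<comment> \<open>Near 0 the function V for \<tau> + h is below \<Psi> 0 + gain h + d, and
    continuity keeps \<Psi> above \<Psi> 0 - d. Solving the inequality of \<open>comp\<close> for u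
    bounds V for \<tau> + h' on a neighbourhood, hence also its regularization.\<close>
  have main: "l * gain h' \<le> gain h + 2 * d" if d: "d > 0" for d
  proof -
    have e1: "\<forall>\<^sub>F z in nhds 0. V \<tau> (\<tau> + h) z < ereal (\<Psi> 0 + gain h + d)"
      by (rule Limsup_lessD) (use F_gain[OF h(1)] d in \<open>simp add: extremal_reg_def usc_reg_def P0\<close>)
    have "(\<Psi> \<longlongrightarrow> \<Psi> 0) (nhds 0)" using weight_cont[of 0] by (simp add: \<Psi>_def isCont_def tendsto_nhds_iff)
    then have e2: "\<forall>\<^sub>F z in nhds 0. \<Psi> z > \<Psi> 0 - d" by (rule order_tendstoD(1)) (use d in simp)
    from e1 e2 have "\<forall>\<^sub>F z in nhds 0. V \<tau> (\<tau> + h') z \<le> ereal (\<Psi> 0 + (gain h + 2 * d) / l)"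
    proof eventually_elim
      case (elim z)
      show ?case
      proof (rule extremal_le)
        fix u assume u: "u \<in> lelong (\<tau> + h')" "\<And>w. w \<in> K \<Longrightarrow> u w \<le> ereal (logweight \<tau> (pt 30) w)"
        have *: "ereal ((1 - l) * \<Psi> z) + ereal l * u z < ereal (\<Psi> 0 + gain h + d)"
          using comp[OF u(1), of z] u(2) elim(1) by (simp add: \<Psi>_def)
        show "u z \<le> ereal (\<Psi> 0 + (gain h + 2 * d) / l)"
        proof (cases "u z")
          case (real x)
          then have "(1 - l) * \<Psi> z + l * x < \<Psi> 0 + gain h + d" using * by simp
          moreover have "(1 - l) * (\<Psi> 0 - d) \<le> (1 - l) * \<Psi> z" using elim(2) l by (intro mult_left_mono) auto
          moreover have "(1 - l) * (\<Psi> 0 - d) = \<Psi> 0 - d - l * \<Psi> 0 + l * d" by (simp add: algebra_simps)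
          moreover have "l * d \<ge> 0" using l d by simp
          ultimately have "l * x \<le> l * \<Psi> 0 + (gain h + 2 * d)" by linarith
          then have "x \<le> \<Psi> 0 + (gain h + 2 * d) / l" using l by (simp add: field_simps)
          then show ?thesis using real by simp
        next
          case PInf
          then show ?thesis using * l by simp
        qed simp
      qed
    qed
    then have "F \<tau> (\<tau> + h') 0 \<le> ereal (\<Psi> 0 + (gain h + 2 * d) / l)"
      unfolding extremal_reg_def usc_reg_def by (rule Limsup_bounded)
    then have "gain h' \<le> (gain h + 2 * d) / l" using F_gain[of h'] h by (simp add: P0)
    then show ?thesis using l by (simp add: field_simps)
  qed
  have "l * gain h' \<le> gain h"
  proof (rule field_le_epsilon)
    fix e :: real assume "e > 0"
    then show "l * gain h' \<le> gain h + e" using main[of "e / 2"] by simp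
  qed
  then show ?thesis using h by (simp add: l_def field_simps)
qed

end

section \<open>Logarithmic poles in z2 and the penalty\<close>

definition lg :: "real \<Rightarrow> real \<Rightarrow> complex^'n \<Rightarrow> real" where
  "lg e b = logreg e {i2} (pt b)"

lemma lg_eq: "lg e b z = ln (e^2 + (norm (z $ i2 - of_real b))^2) / 2"
  by (simp add: lg_def logreg_def pt_nth)

lemma lg_le:
  assumes e: "e > 0" and "e^2 + (norm (z $ i2 - of_real b))^2 \<le> R^2" "R > 0"
  shows "lg e b z \<le> ln R"
proof -
  have "ln (e^2 + (norm (z $ i2 - of_real b))^2) \<le> ln (R^2)"
    using assms by (intro ln_mono) (auto simp: add_pos_nonneg)
  also have "\<dots> = 2 * ln R" using assms by (subst ln_realpow) auto
  finally show ?thesis by (simp add: lg_eq)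
qed

lemma lg_ge:
  assumes "norm (z $ i2 - of_real b) \<ge> R" "R > 0"
  shows "ln R \<le> lg e b z"
proof -
  have "R^2 \<le> (norm (z $ i2 - of_real b))^2" using assms by (intro power_mono) auto
  also have "\<dots> \<le> e^2 + (norm (z $ i2 - of_real b))^2" by simp
  finally have "ln (R^2) \<le> ln (e^2 + (norm (z $ i2 - of_real b))^2)" using assms by (intro ln_mono) auto
  moreover have "ln (R^2) = 2 * ln R" using assms by (subst ln_realpow) auto
  ultimately show ?thesis by (simp add: lg_eq)
qed

text \<open>With m = max (y, 1/2) one has e^2 + y^2 \<le> m^2 (1 + 4 e^2), so the correction ln (1 +
  4 e^2) / 2 reduces \<open>lg\<close> to ln m. The cut-off logarithm is at least ln m because it
  never falls below -ln 2.\<close>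

lemma lg_minus_le_logcut:
  assumes e: "e > 0"
  shows "lg e b z - ln (1 + 4 * e^2) / 2 \<le> logcut ((norm (z $ i2 - of_real b))^2)"
    and "norm (z $ i2 - of_real b) \<ge> 1 \<Longrightarrow> lg e b z - ln (1 + 4 * e^2) / 2 \<le> ln (norm (z $ i2 - of_real b))"
proof -
  define y where "y = norm (z $ i2 - of_real b)"
  have y0: "y \<ge> 0" by (simp add: y_def)
  have e2: "1 + 4 * e^2 > 0" by (simp add: add_pos_nonneg)
  have main: "lg e b z - ln (1 + 4 * e^2) / 2 \<le> ln m" if m: "m \<ge> 1/2" "y \<le> m" for m
  proof -
    have "e^2 * 1 \<le> e^2 * (4 * m^2)"
    proof (rule mult_left_mono)
      have "(1/2)^2 \<le> m^2" using m by (intro power_mono) auto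
      then show "1 \<le> 4 * m^2" by (simp add: power2_eq_square)
    qed simp
    moreover have "y^2 \<le> m^2" using m y0 by (intro power_mono) auto
    ultimately have "e^2 + y^2 \<le> m^2 * (1 + 4 * e^2)" by (simp add: algebra_simps)
    then have "ln (e^2 + y^2) \<le> ln (m^2 * (1 + 4 * e^2))" using e by (intro ln_mono) (auto simp: add_pos_nonneg)
    also have "\<dots> = ln (m^2) + ln (1 + 4 * e^2)" using m e2 by (intro ln_mult_pos) auto
    also have "ln (m^2) = 2 * ln m" using m by (subst ln_realpow) auto
    finally show ?thesis by (simp add: lg_eq y_def)
  qed
  show "lg e b z - ln (1 + 4 * e^2) / 2 \<le> logcut ((norm (z $ i2 - of_real b))^2)"
  proof (cases "y \<ge> 1/2")
    case True
    then have "ln y \<le> logcut (y^2)" by (intro logcut_sq_ge) auto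
    then show ?thesis using main[of y] True by (simp add: y_def)
  next
    case False
    have "ln (1/2) = - ln (2::real)" by (simp add: ln_div)
    then have "ln (1/2) \<le> logcut (y^2)" using logcut_sq_ge(2)[OF y0] by simp
    then show ?thesis using main[of "1/2"] False by (simp add: y_def)
  qed
  show "norm (z $ i2 - of_real b) \<ge> 1 \<Longrightarrow> lg e b z - ln (1 + 4 * e^2) / 2 \<le> ln (norm (z $ i2 - of_real b))"
    using main[of y] by (simp add: y_def)
qed

text \<open>The weights \<open>1 / (2 \<cdot> 32\<^sup>j)\<close> are chosen such that the \<open>j\<close>-th term is at most \<open>-6\<close> on the \<open>j\<close>-th disc, the
  last term is at most \<open>-6\<close> on the remaining discs and at \<open>0\<close>, and the total loss at \<open>ctr k / 2\<close> is at most 1.\<close>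

definition penalty :: "nat \<Rightarrow> complex^'n \<Rightarrow> real" where
  "penalty k z = (\<Sum>j\<in>{1..k}. (1 / (2 * 32^j)) * (lg (rad j) (ctr j) z + (- ln 50)))
     + (1 / (2 * 16^k)) * (lg (ctr (Suc k)) 0 z + (- ln 50))"

lemma half_sum: "(\<Sum>j\<in>{1..k}. (1/2)^j) \<le> (1::real)"
proof -
  have "(\<Sum>j\<in>{1..k}. (1/2)^j) = 1 - (1/2::real)^k" by (induction k) auto
  then show ?thesis by simp
qed

text \<open>The weights of the poles at the discs add up to at most 1/2, and the last pole adds at
  most another 1/2.\<close>

lemma clel_penalty: "clel 1 (penalty k)"
proof -
  have "clel ((\<Sum>j\<in>{1..k}. (1 / (2 * 32^j)) * (1 + 0)) + (1 / (2 * 16^k)) * (1 + 0)) (penalty k)"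
    unfolding penalty_def lg_def
    by (intro clel_add clel_sum clel_cmult clel_logreg clel_const rad_pos ctr_pos) auto
  moreover have "(\<Sum>j\<in>{1..k}. (1 / (2 * 32^j)) * (1 + 0)) + (1 / (2 * 16^k)) * (1 + 0) \<le> (1::real)"
  proof -
    have "(\<Sum>j\<in>{1..k}. (1 / (2 * 32^j)) * (1 + 0)) \<le> (\<Sum>j\<in>{1..k}. (1/2) * (1/2::real)^j)"
    proof (rule sum_mono)
      fix j assume "j \<in> {1..k}"
      have "(2::real)^j \<le> 32^j" by (intro power_mono) auto
      then show "(1 / (2 * 32^j)) * (1 + 0) \<le> (1/2) * (1/2::real)^j" by (simp add: power_one_over divide_simps)
    qed
    also have "\<dots> = (1/2) * (\<Sum>j\<in>{1..k}. (1/2::real)^j)" by (simp add: sum_distrib_left)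
    also have "\<dots> \<le> (1/2) * 1" using half_sum by (intro mult_left_mono) auto
    finally have "(\<Sum>j\<in>{1..k}. (1 / (2 * 32^j)) * (1 + 0)) \<le> (1/2::real)" by simp
    moreover have "(1 / (2 * 16^k)) * (1 + 0) \<le> (1/2::real)" by (simp add: divide_simps)
    ultimately show ?thesis by linarith
  qed
  ultimately show ?thesis by (rule clel_mono)
qed

lemma penalty_term_nonpos:
  assumes z: "z \<in> K" and b: "0 \<le> b" "b \<le> 1" and e: "0 < e" "e \<le> 1"
  shows "lg e b z + (- ln 50) \<le> 0"
proof -
  have "norm (z $ i2 - of_real b) \<le> 32" using K_coord_bound[OF z, of i2] norm_triangle_ineq4[of "z $ i2" "of_real b"] b by simp
  then have "(norm (z $ i2 - of_real b))^2 \<le> 32^2" by (intro power_mono) auto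
  moreover have "e^2 \<le> 1^2" using e by (intro power_mono) auto
  ultimately have "lg e b z \<le> ln 50" using e by (intro lg_le) auto
  then show ?thesis by simp
qed

lemma rad_le_1: "rad j \<le> 1" by (simp add: rad_def)

lemma penalty_summands_nonpos:
  assumes z: "z \<in> K"
  shows "j \<in> {1..k} \<Longrightarrow> (1 / (2 * 32^j)) * (lg (rad j) (ctr j) z + (- ln 50)) \<le> 0"
    and "(1 / (2 * 16^k)) * (lg (ctr (Suc k)) 0 z + (- ln 50)) \<le> 0"
proof -
  assume j: "j \<in> {1..k}"
  then have "lg (rad j) (ctr j) z + (- ln 50) \<le> 0"
    using ctr_pos[of j] ctr_le_1[of j] rad_pos[of j] rad_le_1[of j] by (intro penalty_term_nonpos z) auto
  then show "(1 / (2 * 32^j)) * (lg (rad j) (ctr j) z + (- ln 50)) \<le> 0" by (intro mult_nonneg_nonpos) auto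
next
  have "lg (ctr (Suc k)) 0 z + (- ln 50) \<le> 0"
    using ctr_pos[of "Suc k"] ctr_le_1[of "Suc k"] by (intro penalty_term_nonpos z) auto
  then show "(1 / (2 * 16^k)) * (lg (ctr (Suc k)) 0 z + (- ln 50)) \<le> 0" by (intro mult_nonneg_nonpos) auto
qed

lemma penalty_nonpos: assumes z: "z \<in> K" shows "penalty k z \<le> 0"
  unfolding penalty_def by (intro add_nonpos_nonpos sum_nonpos penalty_summands_nonpos z)

text \<open>One summand does the work, the others only have to be nonpositive: the j-th summand on a
  disc with index at most k, and the pole at 0 on everything closer in, that is, within 5/4 ctr (k +
  1).\<close>

lemma penalty_disc:
  assumes z: "z \<in> K" and k: "k \<ge> 1" and j: "z $ i2 = 0 \<or> (\<exists>j\<ge>1. z $ i2 \<in> zdisc j)"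
  shows "penalty k z \<le> - 6"
proof (cases "\<exists>j\<in>{1..k}. z $ i2 \<in> zdisc j")
  case True
  then obtain j where j: "j \<in> {1..k}" "z $ i2 \<in> zdisc j" by blast
  define T where "T = (\<lambda>j. (1 / (2 * 32^j)) * (lg (rad j) (ctr j) z + (- ln 50)))"
  have neg: "T i \<le> 0" if "i \<in> {1..k}" for i unfolding T_def by (rule penalty_summands_nonpos(1)[OF z that])
  have "(norm (z $ i2 - of_real (ctr j)))^2 \<le> (rad j)^2" using j by (intro power_mono) (auto simp: dist_norm norm_minus_commute)
  moreover have "(2 * rad j)^2 = 4 * (rad j)^2" "(rad j)^2 \<ge> 0" by (simp_all add: power_mult_distrib)
  ultimately have "(rad j)^2 + (norm (z $ i2 - of_real (ctr j)))^2 \<le> (2 * rad j)^2" by linarith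
  then have "lg (rad j) (ctr j) z \<le> ln (2 * rad j)" using rad_pos[of j] by (intro lg_le) auto
  also have "\<dots> = ln 2 - 12 * 32^j" using rad_pos[of j] j by (simp add: ln_mult_pos rad_def)
  also have "\<dots> \<le> ln 50 - 12 * 32^j" by simp
  finally have "lg (rad j) (ctr j) z + (- ln 50) \<le> - (12 * 32^j)" by simp
  then have "T j \<le> (1 / (2 * 32^j)) * (- (12 * 32^j))"
    unfolding T_def by (intro mult_left_mono) auto
  also have "\<dots> = - 6" by simp
  finally have tj: "T j \<le> - 6" .
  have "sum T {1..k} = T j + sum T ({1..k} - {j})" using j by (subst sum.remove[of _ j]) auto
  also have "\<dots> \<le> - 6 + 0" using neg by (intro add_mono tj sum_nonpos) auto
  finally show ?thesis using penalty_summands_nonpos(2)[OF z, of k] unfolding penalty_def T_def by simp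
next
  case False
  have neg: "(\<Sum>j\<in>{1..k}. (1 / (2 * 32^j)) * (lg (rad j) (ctr j) z + (- ln 50))) \<le> 0"
    by (intro sum_nonpos penalty_summands_nonpos z)
  define c where "c = ctr (Suc k)"
  have c: "c > 0" using ctr_pos[of "Suc k"] by (simp add: c_def)
  have "norm (z $ i2) \<le> 5/4 * c"
  proof (cases "z $ i2 = 0")
    case True then show ?thesis using c by simp
  next
    case F: False
    then obtain j' where j': "j' \<ge> 1" "z $ i2 \<in> zdisc j'" using j by blast
    then have jk: "Suc k \<le> j'" using False by force
    have "norm (z $ i2) \<le> 5/4 * ctr j'" using zdisc_inner(3)[of k j'] j' jk k by simp
    also have "\<dots> \<le> 5/4 * c" using ctr_le[of "Suc k" j'] jk by (simp add: c_def)
    finally show ?thesis .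
  qed
  then have "(norm (z $ i2 - of_real 0))^2 \<le> (5/4 * c)^2" by (intro power_mono) auto
  also have "\<dots> \<le> 3 * c^2" by (simp add: power2_eq_square)
  finally have "lg c 0 z \<le> ln (2 * c)" using c by (intro lg_le) (auto simp: power_mult_distrib)
  \<comment> \<open>Splitting off the factor 50 cancels the normalization -ln 50; the rest is ln 4 -
    16 * 16^k, and the weight 1 / (2 * 16^k) turns the main part into -8.\<close>
  also have "2 * c = (4 * exp (- (16^Suc k))) * 50" by (simp add: c_def ctr_def)
  also have "ln ((4 * exp (- (16^Suc k))) * 50) = ln 4 - 16^Suc k + ln (50::real)"
    by (subst ln_mult_pos, simp, simp, subst ln_mult_pos) simp_all
  finally have "lg c 0 z + (- ln 50) \<le> 2 - 16 * 16^k" using ln_numeric(3) by simp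
  then have "(1 / (2 * 16^k)) * (lg c 0 z + (- ln 50)) \<le> (1 / (2 * 16^k)) * (2 - 16 * 16^k)" by (intro mult_left_mono) auto
  also have "\<dots> = 1 / 16^k - 8" by (simp add: field_simps)
  also have "\<dots> \<le> - 6"
  proof -
    have "(1::real) \<le> 16^k" by simp
    then have "1 / 16^k \<le> (1::real)" by (simp add: divide_le_eq)
    then show ?thesis by linarith
  qed
  finally show ?thesis using neg unfolding penalty_def c_def by simp
qed

text \<open>At this point in the gap the distance to the j-th centre is at least ctr j / 2, so the
  j-th loss is at most half of 2^(-j). The sum and the pole at 0 lose at most 1/2 each.\<close>

lemma penalty_at:
  assumes k: "k \<ge> 1" shows "penalty k (pt (ctr k / 2)) \<ge> - 1"
proof -
  have nth: "pt (ctr k / 2) $ i2 = of_real (ctr k / 2)" by (simp add: pt_nth)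
  have t: "(1 / (2 * 32^j)) * (lg (rad j) (ctr j) (pt (ctr k / 2)) + (- ln 50)) \<ge> - ((1/2) * (1/2)^j)" if j: "j \<in> {1..k}" for j
  proof -
    have kj: "ctr k \<le> ctr j" using j by (intro ctr_le) auto
    have "norm (pt (ctr k / 2) $ i2 - of_real (ctr j)) = norm (complex_of_real (ctr k / 2 - ctr j))" by (simp add: nth)
    also have "\<dots> = ctr j - ctr k / 2" using kj ctr_pos[of k] by (simp only: norm_of_real; simp)
    finally have "norm (pt (ctr k / 2) $ i2 - of_real (ctr j)) \<ge> ctr j / 2" using kj by simp
    then have "ln (ctr j / 2) \<le> lg (rad j) (ctr j) (pt (ctr k / 2))" using ctr_pos[of j] by (intro lg_ge) auto
    moreover have "ln (ctr j / 2) = ln 50 - 16^j"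
    proof -
      have "ctr j / 2 = 50 * exp (- (16^j))" using j by (simp add: ctr_def)
      then show ?thesis by (simp add: ln_mult_pos)
    qed
    ultimately have "- (16^j) \<le> lg (rad j) (ctr j) (pt (ctr k / 2)) + (- ln 50)" by simp
    then have "(1 / (2 * 32^j)) * (- (16^j)) \<le> (1 / (2 * 32^j)) * (lg (rad j) (ctr j) (pt (ctr k / 2)) + (- ln 50))"
      by (intro mult_left_mono) auto
    moreover have "(1 / (2 * 32^j)) * (- (16^j)) = - ((1/2) * (1/2::real)^j)"
    proof -
      have "(32::real)^j = 16^j * 2^j" by (simp add: power_mult_distrib[symmetric])
      then show ?thesis by (simp add: power_one_over)
    qed
    ultimately show ?thesis by simp
  qed
  have "- (1/2) \<le> - ((1/2) * (\<Sum>j\<in>{1..k}. (1/2::real)^j))" using half_sum[of k] by simp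
  also have "\<dots> = (\<Sum>j\<in>{1..k}. - ((1/2) * (1/2)^j))" by (simp add: sum_distrib_left sum_negf)
  also have "\<dots> \<le> (\<Sum>j\<in>{1..k}. (1 / (2 * 32^j)) * (lg (rad j) (ctr j) (pt (ctr k / 2)) + (- ln 50)))" by (intro sum_mono t)
  finally have s: "- (1/2) \<le> (\<Sum>j\<in>{1..k}. (1 / (2 * 32^j)) * (lg (rad j) (ctr j) (pt (ctr k / 2)) + (- ln 50)))" .
  have "ln (ctr k / 2) \<le> lg (ctr (Suc k)) 0 (pt (ctr k / 2))"
    using ctr_pos[of k] by (intro lg_ge) (auto simp: nth norm_divide)
  moreover have "ln (ctr k / 2) = ln 50 - 16^k"
  proof -
    have "ctr k / 2 = 50 * exp (- (16^k))" using k by (simp add: ctr_def)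
    then show ?thesis by (simp add: ln_mult_pos)
  qed
  ultimately have "- (16^k) \<le> lg (ctr (Suc k)) 0 (pt (ctr k / 2)) + (- ln 50)" by simp
  then have "(1 / (2 * 16^k)) * (- (16^k)) \<le> (1 / (2 * 16^k)) * (lg (ctr (Suc k)) 0 (pt (ctr k / 2)) + (- ln 50))"
    by (intro mult_left_mono) auto
  then show ?thesis using s unfolding penalty_def by simp
qed

section \<open>The jump of the regularized extremal function and its right derivative\<close>

context
  fixes \<tau> :: real assumes \<tau>: "\<tau> > 0"
begin

text \<open>The candidate stays below the weight on the horn because \<open>\<bar>z\<^sub>1\<bar> \<ge> 1\<close> makes \<open>\<tau> ln \<bar>z - p\<bar>\<close> exceed
  \<open>\<tau> ln \<bar>z\<^sub>2 - 30\<bar>\<close> by a fixed amount, and on the discs because of the penalty.\<close>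

lemma candidate_le_weight:
  assumes z: "z \<in> K" and k: "k \<ge> 1" and h: "h > 0" "h * 6 \<le> \<tau> * ln (1 + 1 / 2500)" and e: "e > 0"
  shows "(\<tau> + h / 2) * (lg e 30 z + (- (ln (1 + 4 * e^2) / 2))) + (h / 2) * penalty k z \<le> logweight \<tau> (pt 30) z"
proof -
  define y where "y = norm (z $ i2 - of_real 30)"
  define Y where "Y = norm (z - pt 30)"
  define A where "A = lg e 30 z + (- (ln (1 + 4 * e^2) / 2))"
  have yY: "y \<le> Y" using Finite_Cartesian_Product.norm_nth_le[of "z - pt 30" i2] by (simp add: y_def Y_def pt_nth)
  have W: "logweight \<tau> (pt 30) z = \<tau> * logcut (Y^2)" by (simp add: logweight_def Y_def)
  have cut: "logcut (y^2) \<le> logcut (Y^2)" using yY by (intro logcut(6) power_mono) (auto simp: y_def)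
  have A1: "A \<le> logcut (y^2)" using lg_minus_le_logcut(1)[OF e, where z = z and b = 30] by (simp add: A_def y_def)
  have A2: "A \<le> ln y" if "y \<ge> 1" using lg_minus_le_logcut(2)[OF e, where z = z and b = 30] that by (simp add: A_def y_def)
  have \<tau>A: "\<tau> * A \<le> \<tau> * logcut (Y^2)" using A1 cut \<tau> by (intro mult_left_mono) auto
  have p0: "(h / 2) * penalty k z \<le> 0" using h penalty_nonpos[OF z, of k] by (intro mult_nonneg_nonpos) auto
  consider "z $ i2 \<in> zdisc 0" | "z $ i2 = 0 \<or> (\<exists>j\<ge>1. z $ i2 \<in> zdisc j)" | "horn (z $ i1) (z $ i2)" "norm (z $ i1 + 1) \<le> 2"
  proof -
    have "z $ i2 \<in> zdisc 0 \<or> (\<exists>j\<ge>1. z $ i2 \<in> zdisc j)" if "z $ i2 \<in> zdisc j" for j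
      using that by (cases "j = 0") (auto simp: Suc_le_eq)
    then show ?thesis using z that by (auto simp: hornset_def zset_def)
  qed
  then have "(\<tau> + h / 2) * A + (h / 2) * penalty k z \<le> \<tau> * logcut (Y^2)"
  proof cases
    \<comment> \<open>On the unit disc around 30 the logarithm A is nonpositive, so the extra
      coefficient h / 2 only helps.\<close>
    case 1
    then have "y \<le> 1" by (simp add: y_def ctr_def rad_def dist_norm norm_minus_commute)
    then have "y^2 \<le> 1" by (simp add: y_def abs_square_le_1)
    then have "logcut (y^2) \<le> logcut 1" by (rule logcut(6))
    then have "A \<le> 0" using A1 by (simp add: logcut(2))
    then have "(h / 2) * A \<le> 0" using h by (intro mult_nonneg_nonpos) auto
    then show ?thesis using \<tau>A p0 by (simp add: distrib_right)
  next
    \<comment> \<open>On the small discs and at z2 = 0 the logarithm is at most ln 50 \<le> 6, and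
      the penalty -6 cancels it.\<close>
    case 2
    have z2: "norm (z $ i2) \<le> 5/4"
    proof (cases "z $ i2 = 0")
      case False
      then obtain j where "j \<ge> 1" "z $ i2 \<in> zdisc j" using 2 by blast
      then show ?thesis using zdisc_bounds(1)[of "z $ i2" j] rad_le[of j] ctr_le_1[of j] by simp
    qed simp
    have "norm (30 - z $ i2) \<ge> norm (30::complex) - norm (z $ i2)" by (rule norm_triangle_ineq2)
    then have y1: "y \<ge> 1" using z2 by (simp add: y_def norm_minus_commute)
    have y50: "y \<le> 50" using z2 norm_triangle_ineq4[of "z $ i2" 30] by (simp add: y_def)
    have "ln y \<le> ln 50" using y1 y50 by (intro ln_mono) auto
    then have "A \<le> 6" using A2[OF y1] ln_numeric(1) by linarith
    then have "(h / 2) * A + (h / 2) * penalty k z \<le> (h / 2) * 6 + (h / 2) * (- 6)"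
      using penalty_disc[OF z k 2] h by (intro add_mono mult_left_mono) auto
    then show ?thesis using \<tau>A by (simp add: distrib_right)
  next
    \<comment> \<open>From |z1| \<ge> 1 follows Y^2 \<ge> y^2 + 1, and y \<le> 50 turns this into a
      gain of ln (1 + 1/2500) / 2. The assumption on h says that \<tau> times this gain covers 6 (h
      / 2).\<close>
    case 3
    have R: "Re (z $ i2) \<le> 0" "norm (z $ i2) \<le> 16" "norm (z $ i1) \<ge> 1" using horn_bounds[OF 3] 3(1) by (auto simp: horn_def)
    have "Re (of_real 30 - z $ i2) \<le> y" unfolding y_def using complex_Re_le_cmod[of "of_real 30 - z $ i2"] by (simp add: norm_minus_commute)
    then have y: "y \<ge> 30" using R by simp
    have y50: "y \<le> 50" using R(2) norm_triangle_ineq4[of "z $ i2" 30] by (simp add: y_def)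
    have YY: "Y^2 \<ge> y^2 + 1"
    proof -
      have "(\<Sum>i\<in>{i1, i2}. (norm (z $ i - pt 30 $ i))^2) \<le> (\<Sum>i\<in>UNIV. (norm (z $ i - pt 30 $ i))^2)"
        by (intro sum_mono2) auto
      also have "\<dots> = Y^2" unfolding Y_def norm_vec_sq by simp
      finally have "(norm (z $ i1))^2 + y^2 \<le> Y^2" using ne by (simp add: pt_nth y_def)
      moreover have "(norm (z $ i1))^2 \<ge> 1" using R(3) by simp
      ultimately show ?thesis by simp
    qed
    have y2: "y^2 > 0" "y^2 \<le> 2500" using y power_mono[OF y50, of 2] by auto
    have "ln (1 + 1 / 2500) + ln (y^2) = ln ((1 + 1 / 2500) * y^2)" using y2 by (subst ln_mult_pos) auto
    also have "\<dots> \<le> ln (y^2 + 1)" using y2 by (intro ln_mono) (auto simp: field_simps)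
    also have "\<dots> \<le> ln (Y^2)" using YY y2(1) by (intro ln_mono) linarith+
    also have "\<dots> = 2 * logcut (Y^2)"
    proof -
      have "1 \<le> Y^2" using YY y2(1) by linarith
      then show ?thesis by (simp add: logcut(2))
    qed
    finally have "ln (1 + 1 / 2500) + ln (y^2) \<le> 2 * logcut (Y^2)" .
    moreover have "ln (y^2) = 2 * ln y" using y by (subst ln_realpow) auto
    ultimately have "ln y + ln (1 + 1 / 2500) / 2 \<le> logcut (Y^2)" by simp
    then have "\<tau> * (ln y + ln (1 + 1 / 2500) / 2) \<le> \<tau> * logcut (Y^2)" using \<tau> by (intro mult_left_mono) auto
    moreover have "(\<tau> + h / 2) * A \<le> (\<tau> + h / 2) * ln y" using A2 y \<tau> h by (intro mult_left_mono) auto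
    moreover have "(h / 2) * ln y \<le> (h / 2) * 6"
    proof -
      have "ln y \<le> ln 50" using y y50 by (intro ln_mono) auto
      then show ?thesis using ln_numeric(1) h by (intro mult_left_mono) auto
    qed
    ultimately show ?thesis using h(2) p0 by (simp add: distrib_right distrib_left)
  qed
  then show ?thesis unfolding W A_def .
qed

text \<open>The additional index h is split evenly: h / 2 sharpens the logarithm at 30, and h / 2
  pays for the penalty, which has index at most 1 and costs at most 1 at this point.\<close>

lemma V_lower:
  assumes k: "k \<ge> 1" and h: "h > 0" "h * 6 \<le> \<tau> * ln (1 + 1 / 2500)"
  shows "V \<tau> (\<tau> + h) (pt (ctr k / 2)) \<ge> ereal ((\<tau> + h / 2) * ln (30 - ctr k / 2) - h / 2)"
proof (rule ereal_le_epsilon2)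
  fix d :: real assume d: "d > 0"
  \<comment> \<open>The smoothing parameter that makes the error (\<tau> + h / 2) 2 e^2 equal to
    d.\<close>
  define e where "e = sqrt (d / (2 * (\<tau> + h / 2)))"
  have T: "\<tau> + h / 2 > 0" using \<tau> h by simp
  have e: "e > 0" "(\<tau> + h / 2) * (2 * e^2) = d"
  proof -
    have p: "d / (2 * (\<tau> + h / 2)) > 0" using T d by simp
    then show "e > 0" by (simp add: e_def)
    have "e^2 = d / (2 * (\<tau> + h / 2))" unfolding e_def using p by (subst real_sqrt_pow2) auto
    moreover have "x * (2 * (d / (2 * x))) = d" if "x > 0" for x using that by simp
    ultimately show "(\<tau> + h / 2) * (2 * e^2) = d" using T by (simp only:)
  qed
  define L where "L = (\<lambda>z. (\<tau> + h / 2) * (lg e 30 z + (- (ln (1 + 4 * e^2) / 2))) + (h / 2) * penalty k z)"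
  have "clel ((\<tau> + h / 2) * (1 + 0) + (h / 2) * 1) L" unfolding L_def lg_def
    using T h e by (intro clel_add clel_cmult clel_logreg clel_const clel_penalty) auto
  moreover have "(\<tau> + h / 2) * (1 + 0) + (h / 2) * 1 = \<tau> + h" by simp
  ultimately have "clel (\<tau> + h) L" by (simp only:)
  then have "(\<lambda>z. ereal (L z)) \<in> lelong (\<tau> + h)" by (rule clel_lelong)
  then have LV: "ereal (L (pt (ctr k / 2))) \<le> V \<tau> (\<tau> + h) (pt (ctr k / 2))"
    by (rule extremal_ge) (use candidate_le_weight[OF _ k h e(1)] in \<open>simp add: L_def\<close>)
  have "(\<tau> + h / 2) * ln (30 - ctr k / 2) - h / 2 \<le> L (pt (ctr k / 2)) + d"
  proof -
    have "norm (pt (ctr k / 2) $ i2 - of_real 30) = norm (complex_of_real (ctr k / 2 - 30))" by (simp add: pt_nth)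
    also have "\<dots> = 30 - ctr k / 2" using ctr_le_1[OF k] by (simp only: norm_of_real; simp)
    finally have "ln (30 - ctr k / 2) \<le> lg e 30 (pt (ctr k / 2))" using ctr_le_1[OF k] by (intro lg_ge) auto
    moreover have "ln (1 + 4 * e^2) \<le> 4 * e^2" by (rule ln_add_one_self_le_self) simp
    ultimately have "ln (30 - ctr k / 2) \<le> (lg e 30 (pt (ctr k / 2)) + (- (ln (1 + 4 * e^2) / 2))) + 2 * e^2" by simp
    then have "(\<tau> + h / 2) * ln (30 - ctr k / 2) \<le> (\<tau> + h / 2) * ((lg e 30 (pt (ctr k / 2)) + (- (ln (1 + 4 * e^2) / 2))) + 2 * e^2)"
      using T by (intro mult_left_mono) auto
    also have "\<dots> = (\<tau> + h / 2) * (lg e 30 (pt (ctr k / 2)) + (- (ln (1 + 4 * e^2) / 2))) + d"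
      unfolding e(2)[symmetric] by (rule distrib_left)
    finally have "(\<tau> + h / 2) * ln (30 - ctr k / 2) \<le> (\<tau> + h / 2) * (lg e 30 (pt (ctr k / 2)) + (- (ln (1 + 4 * e^2) / 2))) + d" .
    moreover have "(h / 2) * (- 1) \<le> (h / 2) * penalty k (pt (ctr k / 2))" using penalty_at[OF k] h by (intro mult_left_mono) auto
    ultimately show ?thesis unfolding L_def by linarith
  qed
  then have "ereal ((\<tau> + h / 2) * ln (30 - ctr k / 2) - h / 2) \<le> ereal (L (pt (ctr k / 2))) + ereal d" by simp
  also have "\<dots> \<le> V \<tau> (\<tau> + h) (pt (ctr k / 2)) + ereal d"
    using LV by (intro add_right_mono)
  finally show "ereal ((\<tau> + h / 2) * ln (30 - ctr k / 2) - h / 2) \<le> V \<tau> (\<tau> + h) (pt (ctr k / 2)) + ereal d" .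
qed

text \<open>The points (0, ctr k / 2) tend to a, and there V is asymptotically at least \<tau> ln 30
  + (h / 2) (ln 30 - 1). Since ln 30 \<ge> 3, this is at least \<tau> ln 30 + h; the distance 30 was
  taken large enough for this.\<close>

lemma gain_lower:
  assumes h: "h > 0" "h * 6 \<le> \<tau> * ln (1 + 1 / 2500)"
  shows "gain \<tau> h \<ge> h"
proof (rule ccontr)
  assume "\<not> gain \<tau> h \<ge> h"
  then have lt: "\<tau> * ln 30 + gain \<tau> h < \<tau> * ln 30 + h" by simp
  define y where "y = (\<tau> * ln 30 + gain \<tau> h + (\<tau> * ln 30 + h)) / 2"
  have y: "\<tau> * ln 30 + gain \<tau> h < y" "y < \<tau> * ln 30 + h" using lt by (auto simp: y_def)
  have "Limsup (nhds 0) (V \<tau> (\<tau> + h)) < ereal y"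
    using F_gain[OF \<tau> h(1)] y by (simp add: extremal_reg_def usc_reg_def)
  then have ev: "\<forall>\<^sub>F z in nhds 0. V \<tau> (\<tau> + h) z < ereal y" by (rule Limsup_lessD)
  have "(\<lambda>k. pt (ctr k / 2)) \<longlonglongrightarrow> 0"
  proof (rule tendsto_norm_zero_cancel)
    have "(\<lambda>k. \<bar>ctr k / 2\<bar>) \<longlonglongrightarrow> \<bar>0 / 2\<bar>" by (intro tendsto_intros ctr_tendsto_0) simp
    then show "(\<lambda>k. norm (pt (ctr k / 2))) \<longlonglongrightarrow> 0" by (simp add: norm_pt)
  qed
  then have "\<forall>\<^sub>F k in sequentially. V \<tau> (\<tau> + h) (pt (ctr k / 2)) < ereal y"
    using ev unfolding filterlim_iff by blast
  moreover have "(\<lambda>k. (\<tau> + h / 2) * ln (30 - ctr k / 2) - h / 2) \<longlonglongrightarrow> (\<tau> + h / 2) * ln (30 - 0 / 2) - h / 2"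
    by (intro tendsto_intros ctr_tendsto_0) auto
  then have "\<forall>\<^sub>F k in sequentially. (\<tau> + h / 2) * ln (30 - ctr k / 2) - h / 2 > y"
  proof (rule order_tendstoD(1))
    have "h * 3 \<le> h * ln 30" using ln_numeric(2) h by (intro mult_left_mono) auto
    then show "y < (\<tau> + h / 2) * ln (30 - 0 / 2) - h / 2" using y(2) by (simp add: distrib_right)
  qed
  moreover have "\<forall>\<^sub>F k::nat in sequentially. k \<ge> 1" by (rule eventually_ge_at_top)
  ultimately have "\<forall>\<^sub>F k::nat in sequentially. False"
  proof eventually_elim
    case (elim k)
    have "ereal ((\<tau> + h / 2) * ln (30 - ctr k / 2) - h / 2) < ereal y" using V_lower[OF elim(3) h] elim(1) by (rule le_less_trans)
    then show False using elim(2) by simp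
  qed
  then show False by simp
qed

lemma small_h: obtains h0 where "h0 > 0" "\<And>h. 0 < h \<Longrightarrow> h \<le> h0 \<Longrightarrow> gain \<tau> h \<ge> h"
proof
  have l: "ln (1 + 1 / 2500 :: real) > 0" by simp
  show "\<tau> * ln (1 + 1 / 2500) / 6 > 0" using l \<tau> by simp
  show "gain \<tau> h \<ge> h" if "0 < h" "h \<le> \<tau> * ln (1 + 1 / 2500) / 6" for h
    using that by (intro gain_lower) auto
qed

text \<open>The explicit gain is known only for small h. Monotonicity of F in \<delta> carries it to
  all larger \<delta>.\<close>

lemma F_ne:
  assumes "\<delta> > \<tau>" shows "F \<tau> \<delta> 0 \<noteq> ereal (logweight \<tau> (pt 30) 0)"
proof -
  obtain h0 where h0: "h0 > 0" "\<And>h. 0 < h \<Longrightarrow> h \<le> h0 \<Longrightarrow> gain \<tau> h \<ge> h" by (rule small_h) (rule that)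
  define h where "h = min h0 (\<delta> - \<tau>)"
  have h: "0 < h" "h \<le> h0" "\<tau> + h \<le> \<delta>" using h0 assms by (auto simp: h_def)
  have "ereal (\<tau> * ln 30) < ereal (\<tau> * ln 30 + gain \<tau> h)" using h0(2)[OF h(1,2)] h by simp
  also have "\<dots> = F \<tau> (\<tau> + h) 0" using F_gain[OF \<tau> h(1)] by simp
  also have "\<dots> \<le> F \<tau> \<delta> 0" using h by (intro F_mono[OF \<tau>]) auto
  finally show ?thesis using weight_0[OF \<tau>] by auto
qed

lemma Lambda_reg_K: "Lambda_reg K (logweight \<tau> (pt 30)) = {\<tau>}"
proof (intro equalityI subsetI)
  fix \<delta> assume d: "\<delta> \<in> Lambda_reg K (logweight \<tau> (pt 30))"
  then have "\<delta> \<ge> \<tau>" using Lambda_K[OF \<tau>] by (auto simp: Lambda_reg_def)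
  moreover have "F \<tau> \<delta> 0 = ereal (logweight \<tau> (pt 30) 0)" using d zero_in_K by (auto simp: Lambda_reg_def)
  ultimately show "\<delta> \<in> {\<tau>}" using F_ne[of \<delta>] by force
next
  fix \<delta> assume "\<delta> \<in> {\<tau>}"
  then show "\<delta> \<in> Lambda_reg K (logweight \<tau> (pt 30))" using F_eq[OF \<tau>] Lambda_K[OF \<tau>] by (auto simp: Lambda_reg_def)
qed

text \<open>By \<open>gain_concave\<close> the quotient gain h / h is nonincreasing in h, and it is
  bounded by ln 30. Its limit at 0 is therefore its supremum, which is at least its value at
  h0.\<close>

lemma right_derivative:
  obtains D where "((\<lambda>h. (F \<tau> (\<tau> + h) 0 - ereal (logweight \<tau> (pt 30) 0)) / ereal h) \<longlongrightarrow> ereal D) (at_right 0)" "D \<ge> 1"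
proof -
  define q where "q = (\<lambda>h. gain \<tau> h / h)"
  have anti: "q h' \<le> q h" if "0 < h" "h \<le> h'" for h h'
    using gain_concave[OF \<tau>, of h h'] that by (cases "h = h'") (auto simp: q_def)
  have ub: "q h \<le> ln 30" if "h > 0" for h
  proof -
    have "gain \<tau> h \<le> h * ln 30" using F_bounds(1)[OF \<tau> that] F_gain[OF \<tau> that] by (simp add: distrib_right)
    then show ?thesis using that by (simp add: q_def pos_divide_le_eq mult.commute)
  qed
  define D where "D = (SUP h\<in>{0<..}. q h)"
  have bdd: "bdd_above (q ` {0<..})" using ub by (intro bdd_aboveI[of _ "ln 30"]) auto
  have qD: "q h \<le> D" if "h > 0" for h unfolding D_def using that bdd by (intro cSUP_upper) auto
  obtain h0 where h0: "h0 > 0" "\<And>h. 0 < h \<Longrightarrow> h \<le> h0 \<Longrightarrow> gain \<tau> h \<ge> h" by (rule small_h) (rule that)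
  have "1 \<le> q h0" using h0(2)[of h0] h0(1) by (simp add: q_def)
  then have D1: "D \<ge> 1" using qD[OF h0(1)] by simp
  have lim: "(q \<longlongrightarrow> D) (at_right 0)"
  proof (rule order_tendstoI)
    fix a assume "a < D"
    then obtain h1 where h1: "h1 > 0" "a < q h1" unfolding D_def using bdd less_cSUP_iff[of "{0<..}" q a] by auto
    show "\<forall>\<^sub>F h in at_right 0. a < q h"
      unfolding eventually_at_right_field
    proof (intro exI conjI allI impI)
      show "h1 > 0" by (rule h1)
      fix h assume "0 < h" "h < h1"
      then show "a < q h" using anti[of h h1] h1 by simp
    qed
  next
    fix a assume a: "D < a"
    show "\<forall>\<^sub>F h in at_right 0. q h < a"
      unfolding eventually_at_right_field
    proof (intro exI conjI allI impI)
      show "(1::real) > 0" by simp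
      fix h :: real assume "0 < h" "h < 1"
      then show "q h < a" using qD[of h] a by simp
    qed
  qed
  have eq: "(F \<tau> (\<tau> + h) 0 - ereal (logweight \<tau> (pt 30) 0)) / ereal h = ereal (q h)" if "h > 0" for h
    using that by (simp add: F_gain[OF \<tau>] weight_0[OF \<tau>] q_def)
  have "((\<lambda>h. (F \<tau> (\<tau> + h) 0 - ereal (logweight \<tau> (pt 30) 0)) / ereal h) \<longlongrightarrow> ereal D) (at_right 0)"
  proof (rule Lim_transform_eventually)
    show "((\<lambda>h. ereal (q h)) \<longlongrightarrow> ereal D) (at_right 0)" using lim by simp
    show "\<forall>\<^sub>F h in at_right 0. ereal (q h) = (F \<tau> (\<tau> + h) 0 - ereal (logweight \<tau> (pt 30) 0)) / ereal h"
      unfolding eventually_at_right_field using eq by (intro exI[of _ 1]) auto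
  qed
  then show ?thesis using D1 that by blast
qed

end

end

theorem theorem1p3:
  assumes "CARD('n::finite) \<ge> 2"
  shows "\<exists>(K :: (complex^'n) set) (a :: complex^'n).
    compact K \<and> polynomially_convex K \<and>
    nonpluripolar_everywhere K \<and> nonplurithin_everywhere K \<and>
    (\<forall>z\<in>K. extremal_reg 1 K (\<lambda>_. 0) z = 0) \<and>
    a \<in> K \<and>
    (\<forall>\<tau>>0. \<exists>\<Psi> :: complex^'n \<Rightarrow> real.
      smooth \<Psi> \<and> (\<lambda>z. ereal (\<Psi> z)) \<in> lelong_plus \<tau> \<and>
      Lambda K \<Psi> = {\<tau>..} \<and>
      Lambda_reg K \<Psi> = {\<tau>} \<and>
      (\<forall>\<delta>>\<tau>. extremal_reg \<delta> K \<Psi> a \<noteq> ereal (\<Psi> a)) \<and>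
      (\<exists>D::real.
        ((\<lambda>h. (extremal_reg (\<tau> + h) K \<Psi> a - ereal (\<Psi> a)) / ereal h) \<longlongrightarrow> ereal D) (at_right 0) \<and>
        D \<ge> (8 * ln 3 - 4 * ln 2) / 9 \<and>
        (8 * ln 3 - 4 * ln 2) / 9 > (0::real) \<and>
        0 = extremal_reg 1 K (\<lambda>_. 0) a))"
proof -
  obtain S :: "'n set" where "card S = 2" using assms ex_card by metis
  then obtain i1 i2 :: 'n where "i1 \<noteq> i2" by (auto simp: card_2_iff)
  then interpret two_axes i1 i2 by unfold_locales
  have "\<exists>\<Psi> :: complex^'n \<Rightarrow> real.
      smooth \<Psi> \<and> (\<lambda>z. ereal (\<Psi> z)) \<in> lelong_plus \<tau> \<and>
      Lambda K \<Psi> = {\<tau>..} \<and>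
      Lambda_reg K \<Psi> = {\<tau>} \<and>
      (\<forall>\<delta>>\<tau>. extremal_reg \<delta> K \<Psi> 0 \<noteq> ereal (\<Psi> 0)) \<and>
      (\<exists>D::real.
        ((\<lambda>h. (extremal_reg (\<tau> + h) K \<Psi> 0 - ereal (\<Psi> 0)) / ereal h) \<longlongrightarrow> ereal D) (at_right 0) \<and>
        D \<ge> (8 * ln 3 - 4 * ln 2) / 9 \<and>
        (8 * ln 3 - 4 * ln 2) / 9 > (0::real) \<and>
        0 = extremal_reg 1 K (\<lambda>_. 0) 0)" if \<tau>: "\<tau> > 0" for \<tau>
  proof -
    obtain D where D: "((\<lambda>h. (F \<tau> (\<tau> + h) 0 - ereal (logweight \<tau> (pt 30) 0)) / ereal h) \<longlongrightarrow> ereal D) (at_right 0)" "D \<ge> 1"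
      by (rule right_derivative[OF \<tau>])
    \<comment> \<open>The bound by 1 is stronger than the constant required.\<close>
    have "D \<ge> (8 * ln 3 - 4 * ln 2) / 9" using D(2) ln_numeric(4) by linarith
    then show ?thesis
      using smooth_logweight[of \<tau> "pt 30"] lelong_logweight[OF less_imp_le[OF \<tau>], of "pt 30"] Lambda_K[OF \<tau>] Lambda_reg_K[OF \<tau>]
        F_ne[OF \<tau>] D(1) ln_numeric(5) regular_K[OF zero_in_K]
      by (intro exI[of _ "logweight \<tau> (pt 30)"] conjI exI[of _ D]) auto
  qed
  then show ?thesis
    using compact_K polynomially_convex_K nonpluripolar_K nonplurithin_K regular_K zero_in_K
    by (intro exI[of _ K] exI[of _ 0] conjI) auto
qed

end
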